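(* Let $V$ be a finite-dimensional real normed space, let $\gamma:[0,T]\to V$ be continuous and of bounded variation, put $g=S(\gamma)$, let $l=\log g=\sum_{n\ge1}l_n$, and put $v=l_1$. Assume $R(l)=\infty$. For every $q\ge1$ and every complex-linear map $\Phi:V_{\mathbb C}\to M_q(\mathbb C)$, write $I=I_q$ and define $$A_\Phi(z)=\sum_{n\ge1}z^n\Phi^{(n)}(l_n).$$ Then $$\det(\zeta I-A_\Phi(z))=\det(\zeta I-z\Phi(v))$$ for all $z,\zeta\in\mathbb C$. Thus $A_\Phi(z)$ and $z\Phi(v)$ have the same eigenvalue multiset, counted with algebraic multiplicity, and $$\operatorname{tr}\bigl(A_\Phi(z)^p\bigr)=z^p\operatorname{tr}\bigl(\Phi(v)^p\bigr)\qquad(p\ge1).$$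
   Context: Signature: $S(\gamma)=\sum_{n\ge0}S_n(\gamma)\in\prod_{n\ge0}V^{\otimes n}$ with $S_0=1$ and $S_n(\gamma)=\int_{0<t_1<\cdots<t_n<T}d\gamma_{t_1}\otimes\cdots\otimes d\gamma_{t_n}$; $\log$ is the formal logarithm in the completed tensor algebra, and $l_n\in V^{\otimes n}$ is the degree-$n$ component of $l$. $V_{\mathbb C}=V\otimes_{\mathbb R}\mathbb C$ carries the norm $\|z\|=\sup\{|\lambda_{\mathbb C}(z)|:\lambda\in V^*,\|\lambda\|\le1\}$ ($\lambda_{\mathbb C}$ the complex-linear extension), $\|\cdot\|_{\pi,n}$ is the projective tensor norm on $V_{\mathbb C}^{\otimes n}$, and $R(l)=(\limsup_n\|l_n\|_{\pi,n}^{1/n})^{-1}$ with $0^{-1}=\infty$. $\Phi^{(n)}:V_{\mathbb C}^{\otimes n}\to M_q(\mathbb C)$ is the multiplicative extension: the linear map with $\Phi^{(n)}(w_1\otimes\cdots\otimes w_n)=\Phi(w_1)\cdots\Phi(w_n)$. When $R(l)=\infty$ the series $A_\Phi(z)$ converges absolutely for every $z\in\mathbb C$. *)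

theory Defs
  imports "HOL-Analysis.Analysis" "HOL-Computational_Algebra.Polynomial"
begin

text \<open>
  Throughout, \<open>'v\<close> is a real normed space which the theorem assumes to be finite-dimensional, and
  \<open>'v \<Rightarrow>\<^sub>L real\<close> is its dual with the dual norm.

  Since the dimension is finite, \<open>V\<^sup>\<otimes>\<^sup>n\<close> is realised as the space of \<open>n\<close>-linear forms on the dual:
  a tensor \<open>t\<close> is stored as the function sending the list \<open>[\<xi>\<^sub>1,\<dots>,\<xi>\<^sub>n]\<close> to the value of
  \<open>\<xi>\<^sub>1 \<otimes> \<dots> \<otimes> \<xi>\<^sub>n\<close> on \<open>t\<close>.  Taking the values in the complex numbers gives the complexification
  of \<open>V\<^sup>\<otimes>\<^sup>n\<close>, which is the \<open>n\<close>-fold complex tensor power of the complexification of \<open>V\<close>.  An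
  element of the product over all \<open>n\<close> is accordingly a function on lists of arbitrary length.
\<close>

type_synonym ('v, 'k) tseries = "('v \<Rightarrow>\<^sub>L real) list \<Rightarrow> 'k"


section \<open>Signature of a path\<close>

definition has_bounded_variation_on :: "(real \<Rightarrow> 'v::real_normed_vector) \<Rightarrow> real set \<Rightarrow> bool"
    (infix "has'_bounded'_variation'_on" 50) where
  "\<gamma> has_bounded_variation_on S \<longleftrightarrow>
     (\<exists>M. \<forall>D. D division_of S \<longrightarrow> (\<Sum>K\<in>D. norm (\<gamma> (Sup K) - \<gamma> (Inf K))) \<le> M)"

definition has_RS_integral :: "(real \<Rightarrow> real) \<Rightarrow> (real \<Rightarrow> real) \<Rightarrow> real \<Rightarrow> real \<Rightarrow> real \<Rightarrow> bool" where
  "has_RS_integral f g a b I \<longleftrightarrow>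
     (\<forall>\<epsilon>>0. \<exists>\<delta>>0. \<forall>D. D tagged_division_of {a..b} \<and> (\<forall>(x, K)\<in>D. Sup K - Inf K < \<delta>) \<longrightarrow>
        \<bar>(\<Sum>(x, K)\<in>D. f x * (g (Sup K) - g (Inf K))) - I\<bar> < \<epsilon>)"

definition RS_integral :: "(real \<Rightarrow> real) \<Rightarrow> (real \<Rightarrow> real) \<Rightarrow> real \<Rightarrow> real \<Rightarrow> real" where
  "RS_integral f g a b = (THE I. has_RS_integral f g a b I)"

text \<open>
  \<open>iterated_integral \<gamma> [\<xi>\<^sub>n,\<dots>,\<xi>\<^sub>1] t\<close> is the integral of \<open>d(\<xi>\<^sub>1\<gamma>)(t\<^sub>1) \<dots> d(\<xi>\<^sub>n\<gamma>)(t\<^sub>n)\<close> over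
  \<open>0 < t\<^sub>1 < \<dots> < t\<^sub>n < t\<close>: the head of the list belongs to the outermost, i.e. latest, time, which
  is why the signature reverses its argument.  As \<open>\<gamma>\<close> is continuous, it makes no difference that
  the iterated Riemann--Stieltjes integrals run over the closed simplex.
\<close>

primrec iterated_integral ::
    "(real \<Rightarrow> 'v::real_normed_vector) \<Rightarrow> ('v \<Rightarrow>\<^sub>L real) list \<Rightarrow> real \<Rightarrow> real" where
  "iterated_integral \<gamma> [] t = 1"
| "iterated_integral \<gamma> (\<xi> # \<xi>s) t =
     RS_integral (iterated_integral \<gamma> \<xi>s) (\<lambda>s. blinfun_apply \<xi> (\<gamma> s)) 0 t"

definition signature :: "(real \<Rightarrow> 'v::real_normed_vector) \<Rightarrow> real \<Rightarrow> ('v, real) tseries" where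
  "signature \<gamma> T = (\<lambda>\<xi>s. iterated_integral \<gamma> (rev \<xi>s) T)"


section \<open>The completed tensor algebra\<close>

text \<open>
  For homogeneous \<open>a\<close>, \<open>b\<close> of degrees \<open>k\<close>, \<open>m\<close> the value of \<open>a \<otimes> b\<close> at \<open>[\<xi>\<^sub>1,\<dots>,\<xi>\<^sub>k\<^sub>+\<^sub>m]\<close> is the value
  of \<open>a\<close> at the first \<open>k\<close> functionals times that of \<open>b\<close> at the remaining ones.
\<close>

definition tseries_one :: "('v::real_normed_vector, real) tseries" where
  "tseries_one = (\<lambda>\<xi>s. if \<xi>s = [] then 1 else 0)"

definition tseries_mult :: "('v::real_normed_vector, real) tseries \<Rightarrow> ('v, real) tseries
    \<Rightarrow> ('v, real) tseries" where
  "tseries_mult a b = (\<lambda>\<xi>s. \<Sum>k\<le>length \<xi>s. a (take k \<xi>s) * b (drop k \<xi>s))"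

primrec tseries_power :: "('v::real_normed_vector, real) tseries \<Rightarrow> nat \<Rightarrow> ('v, real) tseries" where
  "tseries_power a 0 = tseries_one"
| "tseries_power a (Suc k) = tseries_mult a (tseries_power a k)"

text \<open>
  For \<open>g\<^sub>0 = 1\<close> the power \<open>(g - 1)\<^sup>k\<close> has no component of degree less than \<open>k\<close>, so in degree \<open>n\<close> the
  logarithm series stops at \<open>k = n\<close>.
\<close>

definition tseries_log :: "('v::real_normed_vector, real) tseries \<Rightarrow> ('v, real) tseries" where
  "tseries_log g = (\<lambda>\<xi>s. \<Sum>k = 1..length \<xi>s.
     (-1) ^ (k + 1) / real k * tseries_power (\<lambda>\<eta>s. g \<eta>s - tseries_one \<eta>s) k \<xi>s)"

text \<open>The identification of a tensor of degree 1 with a vector.\<close>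

definition vector_of :: "('v::real_normed_vector, real) tseries \<Rightarrow> 'v" where
  "vector_of t = (THE v. \<forall>\<xi>. t [\<xi>] = blinfun_apply \<xi> v)"

text \<open>The degree-\<open>n\<close> component of a real series, as an element of the complex tensor power.\<close>

definition component :: "nat \<Rightarrow> ('v::real_normed_vector, real) tseries \<Rightarrow> ('v, complex) tseries" where
  "component n l = (\<lambda>\<xi>s. if length \<xi>s = n then complex_of_real (l \<xi>s) else 0)"


section \<open>Complexification and its tensor powers\<close>

text \<open>The pair \<open>(x, y)\<close> stands for \<open>x + \<i>y\<close> in the complexification of \<open>'v\<close>.\<close>

definition cscale :: "complex \<Rightarrow> 'v::real_vector \<times> 'v \<Rightarrow> 'v \<times> 'v" where
  "cscale c w = (Re c *\<^sub>R fst w - Im c *\<^sub>R snd w, Im c *\<^sub>R fst w + Re c *\<^sub>R snd w)"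

definition cext :: "('v::real_normed_vector \<Rightarrow>\<^sub>L real) \<Rightarrow> 'v \<times> 'v \<Rightarrow> complex" where
  "cext \<xi> w = Complex (blinfun_apply \<xi> (fst w)) (blinfun_apply \<xi> (snd w))"

definition cnorm :: "'v::real_normed_vector \<times> 'v \<Rightarrow> real" where
  "cnorm w = (SUP \<xi>\<in>{\<xi>. norm \<xi> \<le> 1}. cmod (cext \<xi> w))"

definition tensor_power :: "nat \<Rightarrow> ('v::real_normed_vector, complex) tseries set" where
  "tensor_power n = {t.
     (\<forall>\<xi>s. length \<xi>s \<noteq> n \<longrightarrow> t \<xi>s = 0) \<and>
     (\<forall>\<xi>s. \<forall>i<n. length \<xi>s = n \<longrightarrow> linear (\<lambda>\<xi>. t (\<xi>s[i := \<xi>])))}"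

text \<open>\<open>pure_tensor [w\<^sub>1,\<dots>,w\<^sub>n]\<close> is \<open>w\<^sub>1 \<otimes> \<dots> \<otimes> w\<^sub>n\<close>.\<close>

definition pure_tensor :: "('v::real_normed_vector \<times> 'v) list \<Rightarrow> ('v, complex) tseries" where
  "pure_tensor ws = (\<lambda>\<xi>s. if length \<xi>s = length ws then prod_list (map2 cext \<xi>s ws) else 0)"

definition projective_norm :: "nat \<Rightarrow> ('v::real_normed_vector, complex) tseries \<Rightarrow> real" where
  "projective_norm n t = Inf {(\<Sum>(c, ws)\<leftarrow>xs. cmod c * prod_list (map cnorm ws)) |xs.
     (\<forall>(c, ws)\<in>set xs. length ws = n) \<and>
     t = (\<lambda>\<xi>s. \<Sum>(c, ws)\<leftarrow>xs. c * pure_tensor ws \<xi>s)}"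

definition radius :: "('v::real_normed_vector, real) tseries \<Rightarrow> ereal" where
  "radius l = inverse (limsup (\<lambda>n. ereal (root n (projective_norm n (component n l)))))"


section \<open>Matrices\<close>

definition mscale :: "complex \<Rightarrow> complex^'q^'q \<Rightarrow> complex^'q^'q" where
  "mscale c A = map_matrix (\<lambda>a. c * a) A"

primrec mpower :: "complex^'q^'q \<Rightarrow> nat \<Rightarrow> complex^'q^'q" where
  "mpower A 0 = mat 1"
| "mpower A (Suc p) = A ** mpower A p"

definition char_poly :: "complex^'q^'q \<Rightarrow> complex poly" where
  "char_poly A = det (mat [:0, 1:] - map_matrix (\<lambda>a. [:a:]) A)"

definition eigenvalue_mset :: "complex^'q^'q \<Rightarrow> complex multiset" where
  "eigenvalue_mset A = proots (char_poly A)"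

abbreviation complex_linear :: "('v::real_vector \<times> 'v \<Rightarrow> complex^'q^'q) \<Rightarrow> bool" where
  "complex_linear \<equiv> Vector_Spaces.linear cscale mscale"

definition is_mult_extension :: "('v::real_normed_vector \<times> 'v \<Rightarrow> complex^'q^'q) \<Rightarrow> nat
    \<Rightarrow> (('v, complex) tseries \<Rightarrow> complex^'q^'q) \<Rightarrow> bool" where
  "is_mult_extension \<Phi> n F \<longleftrightarrow>
     F \<in> extensional (tensor_power n) \<and>
     (\<forall>c d. \<forall>s\<in>tensor_power n. \<forall>t\<in>tensor_power n.
        F (\<lambda>\<xi>s. c * s \<xi>s + d * t \<xi>s) = mscale c (F s) + mscale d (F t)) \<and>
     (\<forall>ws. length ws = n \<longrightarrow> F (pure_tensor ws) = foldr (**) (map \<Phi> ws) (mat 1))"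

definition mult_extension :: "('v::real_normed_vector \<times> 'v \<Rightarrow> complex^'q^'q) \<Rightarrow> nat
    \<Rightarrow> ('v, complex) tseries \<Rightarrow> complex^'q^'q" where
  "mult_extension \<Phi> n = (THE F. is_mult_extension \<Phi> n F)"


section \<open>The descriptions above determine unique objects\<close>

lemma vector_space_cscale: "vector_space (cscale :: complex \<Rightarrow> 'v::real_vector \<times> 'v \<Rightarrow> 'v \<times> 'v)"
  by unfold_locales (auto simp: cscale_def algebra_simps prod_eq_iff)

lemma vector_space_mscale: "vector_space (mscale :: complex \<Rightarrow> complex^'q^'q \<Rightarrow> complex^'q^'q)"
  by unfold_locales (auto simp: mscale_def vec_eq_iff algebra_simps)

lemma coordinates_bounded:
  fixes B :: "'v::real_normed_vector set"
  assumes "finite B" "independent B"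
  shows "\<exists>C. \<forall>c. (\<Sum>b\<in>B. \<bar>c b\<bar>) \<le> C * norm (\<Sum>b\<in>B. c b *\<^sub>R b)"
  using assms
proof (induction B rule: finite_induct)
  case empty
  then show ?case by auto
next
  case (insert b B)
  then have indB: "independent B" and bB: "b \<notin> span B"
    by (auto simp: independent_insert)
  from insert.IH[OF indB] obtain C0 where
    "\<And>c. (\<Sum>b\<in>B. \<bar>c b\<bar>) \<le> C0 * norm (\<Sum>b\<in>B. c b *\<^sub>R b)" by blast
  define C where "C = max C0 0"
  have C0: "C \<ge> 0" by (simp add: C_def)
  have C: "(\<Sum>b\<in>B. \<bar>c b\<bar>) \<le> C * norm (\<Sum>b\<in>B. c b *\<^sub>R b)" for c :: "'v \<Rightarrow> real"
    by (rule order_trans[OF \<open>(\<Sum>b\<in>B. \<bar>c b\<bar>) \<le> _\<close>]) (simp add: C_def mult_right_mono)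
  have "closed (span B)"
  proof (rule closed_sequential_limits[THEN iffD2], intro allI impI, elim conjE)
    fix x :: "nat \<Rightarrow> 'v" and y assume x: "\<forall>n. x n \<in> span B" and y: "x \<longlonglongrightarrow> y"
    have "\<forall>n. \<exists>c. x n = (\<Sum>b\<in>B. c b *\<^sub>R b)"
      using x unfolding span_finite[OF insert.hyps(1)] by auto
    then obtain c where c: "\<And>n. x n = (\<Sum>b\<in>B. c n b *\<^sub>R b)" by metis
    have Cau: "Cauchy x" using y LIMSEQ_imp_Cauchy by blast
    have cc: "Cauchy (\<lambda>n. c n b')" if "b' \<in> B" for b'
    proof (rule metric_CauchyI)
      fix e :: real assume "e > 0"
      then have "e / (C + 1) > 0" using C0 by simp
      then obtain M where M: "\<And>m n. m \<ge> M \<Longrightarrow> n \<ge> M \<Longrightarrow> dist (x m) (x n) < e / (C+1)"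
        using metric_CauchyD[OF Cau] by blast
      show "\<exists>M. \<forall>m\<ge>M. \<forall>n\<ge>M. dist (c m b') (c n b') < e"
      proof (intro exI allI impI)
        fix m n assume "m \<ge> M" "n \<ge> M"
        have "\<bar>c m b' - c n b'\<bar> \<le> (\<Sum>b\<in>B. \<bar>c m b - c n b\<bar>)"
          using that insert.hyps(1) by (intro member_le_sum) auto
        also have "\<dots> \<le> C * norm (\<Sum>b\<in>B. (c m b - c n b) *\<^sub>R b)" by (rule C)
        also have "(\<Sum>b\<in>B. (c m b - c n b) *\<^sub>R b) = x m - x n"
          by (simp add: c scaleR_left_diff_distrib sum_subtractf)
        also have "C * norm (x m - x n) \<le> (C+1) * norm (x m - x n)" by (simp add: mult_right_mono)
        also have "\<dots> < e" using M[OF \<open>m \<ge> M\<close> \<open>n \<ge> M\<close>] C0 by (simp add: dist_norm field_simps)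
        finally show "dist (c m b') (c n b') < e" by (simp add: dist_real_def)
      qed
    qed
    then have "\<forall>b'\<in>B. \<exists>d. (\<lambda>n. c n b') \<longlonglongrightarrow> d"
      using Cauchy_convergent convergent_def by blast
    then obtain d where d: "\<And>b'. b' \<in> B \<Longrightarrow> (\<lambda>n. c n b') \<longlonglongrightarrow> d b'" by metis
    have "x \<longlonglongrightarrow> (\<Sum>b\<in>B. d b *\<^sub>R b)"
      unfolding c by (intro tendsto_intros d)
    then have "y = (\<Sum>b\<in>B. d b *\<^sub>R b)" using y LIMSEQ_unique by blast
    moreover have "(\<Sum>b\<in>B. d b *\<^sub>R b) \<in> span B" by (intro span_sum span_scale span_base)
    ultimately show "y \<in> span B" by (rule ssubst)
  qed
  then have "open (- span B)" by (rule open_Compl)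
  then obtain \<delta> where \<delta>0: "\<delta> > 0" "ball b \<delta> \<subseteq> - span B" using bB by (auto elim!: openE)
  have \<delta>: "\<delta> > 0" "\<And>y. y \<in> span B \<Longrightarrow> \<delta> \<le> dist b y"
    using \<delta>0 by (force simp: not_less[symmetric] subset_iff)+
  have "(\<Sum>b\<in>insert b B. \<bar>c b\<bar>) \<le> (1/\<delta> + C * (1 + norm b / \<delta>)) * norm (\<Sum>b\<in>insert b B. c b *\<^sub>R b)"
    for c :: "'v \<Rightarrow> real"
  proof -
    define y where "y = (\<Sum>b\<in>B. c b *\<^sub>R b)"
    define x where "x = c b *\<^sub>R b + y"
    have ysp: "y \<in> span B" unfolding y_def by (intro span_sum span_scale span_base)
    have 1: "\<bar>c b\<bar> * \<delta> \<le> norm x"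
    proof (cases "c b = 0")
      case False
      have "- (1 / c b) *\<^sub>R y \<in> span B" using ysp span_scale by blast
      from \<delta>(2)[OF this] have "\<delta> \<le> norm (b + (1 / c b) *\<^sub>R y)" by (simp add: dist_norm)
      then have "\<bar>c b\<bar> * \<delta> \<le> norm (c b *\<^sub>R (b + (1 / c b) *\<^sub>R y))" by (simp add: mult_left_mono)
      then show ?thesis using False by (simp add: x_def scaleR_right_distrib)
    qed auto
    have 2: "\<bar>c b\<bar> \<le> norm x / \<delta>" using 1 \<delta> by (simp add: field_simps)
    have "norm y = norm (x - c b *\<^sub>R b)" by (simp add: x_def)
    also have "\<dots> \<le> norm x + \<bar>c b\<bar> * norm b" by (metis norm_triangle_ineq4 norm_scaleR)
    also have "\<dots> \<le> norm x + norm x / \<delta> * norm b" using mult_right_mono[OF 2 norm_ge_zero[of b]] by simp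
    finally have 3: "norm y \<le> (1 + norm b / \<delta>) * norm x" by (simp add: algebra_simps)
    have "(\<Sum>b\<in>B. \<bar>c b\<bar>) \<le> C * norm y" unfolding y_def by (rule C)
    also have "\<dots> \<le> C * ((1 + norm b / \<delta>) * norm x)" using 3 C0 by (rule mult_left_mono)
    finally show ?thesis using 2 insert.hyps
      by (simp add: x_def y_def[symmetric] algebra_simps)
  qed
  then show ?case by blast
qed

lemma coordinates_exist:
  fixes B0 :: "'v::real_normed_vector set"
  assumes "finite B0" "span B0 = UNIV"
  obtains B :: "'v set" and e :: "'v \<Rightarrow> 'v \<Rightarrow>\<^sub>L real" where "finite B"
    "\<And>x. x = (\<Sum>b\<in>B. blinfun_apply (e b) x *\<^sub>R b)"
    "\<And>a b. a \<in> B \<Longrightarrow> b \<in> B \<Longrightarrow> blinfun_apply (e a) b = (if a = b then 1 else 0)"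
proof -
  obtain B where B: "B \<subseteq> B0" "independent B" "span B = UNIV"
    using maximal_independent_subset[of B0] \<open>span B0 = UNIV\<close>
    by (metis span_superset span_mono span_span subset_UNIV subset_antisym)
  have fin: "finite B" using B \<open>finite B0\<close> finite_subset by blast
  obtain C where C: "\<And>c. (\<Sum>b\<in>B. \<bar>c b\<bar>) \<le> C * norm (\<Sum>b\<in>B. c b *\<^sub>R b)"
    using coordinates_bounded[OF fin B(2)] by blast
  define r where "r b x = representation B x b" for b x
  have rx: "x = (\<Sum>b\<in>B. r b x *\<^sub>R b)" for x
    using sum_representation_eq[of B x B] B fin by (simp add: r_def)
  have bl: "bounded_linear (r b)" if "b \<in> B" for b
  proof (rule bounded_linear_intro[where K = C])
    show "r b (x + y) = r b x + r b y" for x y using B by (simp add: r_def representation_add)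
    show "r b (s *\<^sub>R x) = s *\<^sub>R r b x" for s x using B by (simp add: r_def representation_scale)
    have "\<bar>r b x\<bar> \<le> (\<Sum>b\<in>B. \<bar>r b x\<bar>)" for x using that fin by (intro member_le_sum) auto
    also have "(\<Sum>b\<in>B. \<bar>r b x\<bar>) \<le> C * norm x" for x using C[of "\<lambda>b. r b x"] rx by metis
    finally show "norm (r b x) \<le> norm x * C" for x by (simp add: mult.commute)
  qed
  show ?thesis
  proof (rule that[of B "\<lambda>b. Blinfun (r b)"])
    show "x = (\<Sum>b\<in>B. blinfun_apply (Blinfun (r b)) x *\<^sub>R b)" for x
      by (subst rx) (simp add: bl bounded_linear_Blinfun_apply)
    show "blinfun_apply (Blinfun (r a)) b = (if a = b then 1 else 0)" if "a \<in> B" "b \<in> B" for a b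
      using that B by (simp add: bl bounded_linear_Blinfun_apply r_def representation_basis)
  qed (rule fin)
qed

lemma vector_of_ex1:
  fixes t :: "('v::real_normed_vector, real) tseries"
  assumes "\<exists>B::'v set. finite B \<and> span B = UNIV" and "linear (\<lambda>\<xi>. t [\<xi>])"
  shows "\<exists>!v. \<forall>\<xi>. t [\<xi>] = blinfun_apply \<xi> v"
proof -
  obtain B and e :: "'v \<Rightarrow> 'v \<Rightarrow>\<^sub>L real" where B: "finite B"
    "\<And>x. x = (\<Sum>b\<in>B. blinfun_apply (e b) x *\<^sub>R b)" using coordinates_exist assms(1) by metis
  have \<xi>: "\<xi> = (\<Sum>b\<in>B. blinfun_apply \<xi> b *\<^sub>R e b)" for \<xi> :: "'v \<Rightarrow>\<^sub>L real"
    by (rule blinfun_eqI, subst B(2))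
       (simp add: blinfun.sum_right blinfun.sum_left blinfun.scaleR_left blinfun.scaleR_right mult.commute)
  show ?thesis
  proof (rule ex1I[of _ "\<Sum>b\<in>B. t [e b] *\<^sub>R b"])
    show "\<forall>\<xi>. t [\<xi>] = blinfun_apply \<xi> (\<Sum>b\<in>B. t [e b] *\<^sub>R b)"
    proof
      fix \<xi> :: "'v \<Rightarrow>\<^sub>L real"
      have "t [\<xi>] = (\<Sum>b\<in>B. blinfun_apply \<xi> b * t [e b])"
        by (subst \<xi>) (simp add: linear_sum[OF assms(2)] linear_scale[OF assms(2)])
      then show "t [\<xi>] = blinfun_apply \<xi> (\<Sum>b\<in>B. t [e b] *\<^sub>R b)"
        by (simp add: blinfun.sum_right blinfun.scaleR_right mult.commute)
    qed
    show "v = (\<Sum>b\<in>B. t [e b] *\<^sub>R b)" if "\<forall>\<xi>. t [\<xi>] = blinfun_apply \<xi> v" for v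
      using that B(2)[of v] by simp
  qed
qed


definition words_over :: "'a set \<Rightarrow> nat \<Rightarrow> 'a list set" where
 "words_over B n = {bs. set bs \<subseteq> B \<and> length bs = n}"

lemma finite_words: "finite B \<Longrightarrow> finite (words_over B n)"
  unfolding words_over_def by (rule finite_lists_length_eq)

lemma words_0: "words_over B 0 = {[]}" by (auto simp: words_over_def)

lemma sum_words_Suc:
  assumes "finite B"
  shows "(\<Sum>bs\<in>words_over B (Suc n). f bs) = (\<Sum>b\<in>B. \<Sum>bs\<in>words_over B n. f (b # bs))"
proof -
  have "words_over B (Suc n) = (\<lambda>(b,bs). b # bs) ` (B \<times> words_over B n)"
    by (auto simp: words_over_def length_Suc_conv image_iff)
  moreover have "inj_on (\<lambda>(b,bs). b # bs) (B \<times> words_over B n)" by (auto simp: inj_on_def)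
  ultimately show ?thesis
    by (simp only: sum.reindex sum.cartesian_product o_def) (simp add: case_prod_beta)
qed

lemma tensor_power_Cons:
  assumes "t \<in> tensor_power (Suc n)"
  shows "(\<lambda>\<xi>s. t (\<xi> # \<xi>s)) \<in> tensor_power n"
proof -
  have "linear (\<lambda>\<eta>. t (\<xi> # \<xi>s[i := \<eta>]))" if "i < n" "length \<xi>s = n" for i \<xi>s
  proof -
    have "linear (\<lambda>\<eta>. t ((\<xi> # \<xi>s)[Suc i := \<eta>]))"
      using assms that unfolding tensor_power_def mem_Collect_eq
      by (elim conjE) (drule spec[of _ "\<xi> # \<xi>s"], drule spec[of _ "\<xi> # \<xi>s"], drule spec[of _ "Suc i"], simp)
    then show ?thesis by simp
  qed
  then show ?thesis using assms by (auto simp: tensor_power_def)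
qed

lemma tensor_power_linear_Cons:
  assumes "t \<in> tensor_power (Suc n)" "length \<xi>s = n"
  shows "linear (\<lambda>\<xi>. t (\<xi> # \<xi>s))"
proof -
  have "linear (\<lambda>\<eta>. t ((undefined # \<xi>s)[0 := \<eta>]))"
    using assms unfolding tensor_power_def mem_Collect_eq
    by (elim conjE) (drule spec[of _ "undefined # \<xi>s"], drule spec[of _ "undefined # \<xi>s"], drule spec[of _ 0], simp)
  then show ?thesis by simp
qed

lemma tensor_expand:
  fixes e :: "'v::real_normed_vector \<Rightarrow> 'v \<Rightarrow>\<^sub>L real"
  assumes B: "finite B" "\<And>x. x = (\<Sum>b\<in>B. blinfun_apply (e b) x *\<^sub>R b)"
    and "t \<in> tensor_power n"
  shows "t \<xi>s = (\<Sum>bs\<in>words_over B n. t (map e bs) * pure_tensor (map (\<lambda>b. (b, 0)) bs) \<xi>s)"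
proof (cases "length \<xi>s = n")
  case False
  then show ?thesis using assms(3)
    by (auto simp: tensor_power_def pure_tensor_def words_over_def intro!: sum.neutral[symmetric])
next
  case True
  have \<xi>: "\<xi> = (\<Sum>b\<in>B. blinfun_apply \<xi> b *\<^sub>R e b)" for \<xi> :: "'v \<Rightarrow>\<^sub>L real"
    by (rule blinfun_eqI, subst B(2))
       (simp add: blinfun.sum_right blinfun.sum_left blinfun.scaleR_left blinfun.scaleR_right mult.commute)
  show ?thesis using True assms(3)
  proof (induction n arbitrary: t \<xi>s)
    case 0
    then show ?case by (simp add: words_0 pure_tensor_def)
  next
    case (Suc n)
    obtain \<xi> \<eta>s where [simp]: "\<xi>s = \<xi> # \<eta>s" and len: "length \<eta>s = n"
      using Suc.prems(1) by (auto simp: length_Suc_conv)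
    note lin = tensor_power_linear_Cons[OF Suc.prems(2) len]
    have "t \<xi>s = (\<Sum>b\<in>B. blinfun_apply \<xi> b *\<^sub>R t (e b # \<eta>s))"
      by (simp, subst \<xi>) (simp add: linear_sum[OF lin] linear_scale[OF lin])
    also have "\<dots> = (\<Sum>b\<in>B. \<Sum>bs\<in>words_over B n. blinfun_apply \<xi> b *\<^sub>R (t (e b # map e bs)
        * pure_tensor (map (\<lambda>b. (b, 0)) bs) \<eta>s))"
      using Suc.IH[OF len tensor_power_Cons[OF Suc.prems(2)]]
      by (simp add: scaleR_sum_right)
    also have "\<dots> = (\<Sum>b\<in>B. \<Sum>bs\<in>words_over B n. t (map e (b # bs))
        * pure_tensor (map (\<lambda>b. (b, 0)) (b # bs)) \<xi>s)"
      using len by (intro sum.cong refl)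
        (auto simp: pure_tensor_def words_over_def cext_def scaleR_conv_of_real complex_of_real_def)
    finally show ?case by (simp add: sum_words_Suc[OF B(1)])
  qed
qed

lemma linear_cext: "linear (\<lambda>\<xi>. cext \<xi> w)"
  by (rule linearI) (auto simp: cext_def blinfun.add_left blinfun.scaleR_left complex_eq_iff)

lemma pure_tensor_in: "length ws = n \<Longrightarrow> pure_tensor ws \<in> tensor_power n"
proof -
  have "linear (\<lambda>\<xi>. prod_list (map2 cext (\<xi>s[i := \<xi>]) ws))"
    if "i < length ws" "length \<xi>s = length ws" for i \<xi>s
    using that
  proof (induction ws arbitrary: i \<xi>s)
    case (Cons w ws)
    then obtain \<eta> \<eta>s where [simp]: "\<xi>s = \<eta> # \<eta>s" by (cases \<xi>s) auto
    show ?case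
    proof (cases i)
      case 0
      then show ?thesis using linear_compose[OF linear_cext[of w], of "\<lambda>x. x * prod_list (map2 cext \<eta>s ws)"]
        by (simp add: o_def linear_iff algebra_simps)
    next
      case (Suc j)
      then have "linear (\<lambda>\<xi>. prod_list (map2 cext (\<eta>s[j := \<xi>]) ws))" using Cons by auto
      then show ?thesis using Suc by (simp add: linear_iff algebra_simps)
    qed
  qed auto
  then show "length ws = n \<Longrightarrow> pure_tensor ws \<in> tensor_power n"
    by (auto simp: tensor_power_def pure_tensor_def)
qed

lemma tensor_lincomb: "s \<in> tensor_power n \<Longrightarrow> t \<in> tensor_power n \<Longrightarrow>
   (\<lambda>\<xi>s. c * s \<xi>s + d * t \<xi>s) \<in> tensor_power n"
  unfolding tensor_power_def by (auto simp: linear_iff algebra_simps)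

lemma mscale_simps: "mscale (c + d) A = mscale c A + mscale d A" "mscale c (A + A') = mscale c A + mscale c A'"
  "mscale (c * d) A = mscale c (mscale d A)" "mscale 0 A = 0" "mscale 1 A = A" "mscale c 0 = 0"
  by (auto simp: mscale_def vec_eq_iff algebra_simps)

lemma mscale_sum: "mscale c (sum f S) = (\<Sum>x\<in>S. mscale c (f x))"
  by (induction S rule: infinite_finite_induct) (auto simp: mscale_simps)

lemma mscale_mult: "mscale c A ** mscale d M = mscale (c*d) (A ** M)"
  by (simp add: mscale_def vec_eq_iff matrix_matrix_mult_def sum_distrib_left ac_simps)

lemma matrix_sum_mult: "sum f S ** M = (\<Sum>x\<in>S. f x ** (M::complex^'q^'q))"
  by (induction S rule: infinite_finite_induct) (auto simp: matrix_matrix_mult_def vec_eq_iff sum.distrib algebra_simps)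

lemma matrix_mult_sum: "(M::complex^'q^'q) ** sum f S = (\<Sum>x\<in>S. M ** f x)"
  by (induction S rule: infinite_finite_induct) (auto simp: matrix_matrix_mult_def vec_eq_iff sum.distrib algebra_simps)

proposition mult_extension_ex1:
  fixes \<Phi> :: "'v::real_normed_vector \<times> 'v \<Rightarrow> complex^'q^'q"
  assumes fd: "\<exists>B::'v set. finite B \<and> span B = UNIV" and lin: "complex_linear \<Phi>"
  shows "\<exists>!F. is_mult_extension \<Phi> n F"
proof -
  interpret Vector_Spaces.linear cscale mscale \<Phi> by (rule lin)
  obtain B and e :: "'v \<Rightarrow> 'v \<Rightarrow>\<^sub>L real" where B: "finite B"
    "\<And>x. x = (\<Sum>b\<in>B. blinfun_apply (e b) x *\<^sub>R b)" using coordinates_exist fd by metis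
  let ?p = "\<lambda>ws. foldr (**) (map \<Phi> ws) (mat 1)"
  let ?j = "map (\<lambda>b. (b, 0::'v))"
  define F0 where "F0 n t = (\<Sum>bs\<in>words_over B n. mscale (t (map e bs)) (?p (?j bs)))" for n and t :: "('v, complex) tseries"
  define F where "F = restrict (F0 n) (tensor_power n)"
  have w: "w = (\<Sum>b\<in>B. cscale (cext (e b) w) (b, 0))" for w
  proof -
    have "(\<Sum>b\<in>B. cscale (cext (e b) w) (b, 0)) = (\<Sum>b\<in>B. e b (fst w) *\<^sub>R b, \<Sum>b\<in>B. e b (snd w) *\<^sub>R b)"
      by (simp add: cscale_def cext_def prod_eq_iff fst_sum snd_sum)
    then show ?thesis using B(2) by simp
  qed
  have \<Phi>w: "\<Phi> w = (\<Sum>b\<in>B. mscale (cext (e b) w) (\<Phi> (b, 0)))" for w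
    by (subst w) (simp add: sum scale)
  have pt: "F0 (length ws) (pure_tensor ws) = ?p ws" for ws
  proof (induction ws)
    case Nil
    then show ?case by (simp add: F0_def words_0 pure_tensor_def mscale_simps)
  next
    case (Cons w ws)
    have "F0 (length (w # ws)) (pure_tensor (w # ws)) = (\<Sum>b\<in>B. \<Sum>bs\<in>words_over B (length ws).
       mscale (cext (e b) w) (\<Phi> (b,0)) ** mscale (pure_tensor ws (map e bs)) (?p (?j bs)))"
      by (simp add: F0_def sum_words_Suc[OF B(1)] mscale_mult)
         (intro sum.cong refl, auto simp: pure_tensor_def words_over_def)
    also have "\<dots> = \<Phi> w ** F0 (length ws) (pure_tensor ws)"
      unfolding F0_def matrix_mult_sum \<Phi>w[of w] matrix_sum_mult by (rule sum.swap)
    finally show ?case using Cons by simp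
  qed
  show ?thesis
  proof (rule ex1I[of _ F])
    show "is_mult_extension \<Phi> n F"
      unfolding is_mult_extension_def
    proof (intro conjI allI ballI impI)
      show "F \<in> extensional (tensor_power n)" by (simp add: F_def)
      show "F (\<lambda>\<xi>s. c * s \<xi>s + d * t \<xi>s) = mscale c (F s) + mscale d (F t)"
        if "s \<in> tensor_power n" "t \<in> tensor_power n" for c d s t
      proof -
        have "F0 n (\<lambda>\<xi>s. c * s \<xi>s + d * t \<xi>s) = mscale c (F0 n s) + mscale d (F0 n t)"
          unfolding F0_def mscale_sum mscale_simps(1,3) sum.distrib ..
        then show ?thesis using that tensor_lincomb[OF that, of c d] by (simp add: F_def)
      qed
      show "F (pure_tensor ws) = ?p ws" if "length ws = n" for ws
        using that pt[of ws] pure_tensor_in[OF that] by (simp add: F_def)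
    qed
    fix G assume G: "is_mult_extension \<Phi> n G"
    show "G = F"
    proof (rule extensionalityI)
      show "G \<in> extensional (tensor_power n)" using G by (simp add: is_mult_extension_def)
      show "F \<in> extensional (tensor_power n)" by (simp add: F_def)
      have Glin: "G (\<lambda>\<xi>s. c * s \<xi>s + d * t \<xi>s) = mscale c (G s) + mscale d (G t)"
        if "s \<in> tensor_power n" "t \<in> tensor_power n" for c d s t
        using G that by (simp add: is_mult_extension_def)
      have z: "(\<lambda>_. 0) \<in> tensor_power n" by (auto simp: tensor_power_def linear_iff)
      have G0: "G (\<lambda>_. 0) = 0" using Glin[OF z z, of 0 0] by (simp add: mscale_simps)
      have sums: "(\<lambda>\<xi>s. \<Sum>x\<in>S. c x * f x \<xi>s) \<in> tensor_power n \<and>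
        G (\<lambda>\<xi>s. \<Sum>x\<in>S. c x * f x \<xi>s) = (\<Sum>x\<in>S. mscale (c x) (G (f x)))"
        if "finite S" "\<forall>x\<in>S. f x \<in> tensor_power n" for c and f :: "'v list \<Rightarrow> ('v, complex) tseries" and S
        using that
      proof (induction S rule: finite_induct)
        case empty then show ?case by (simp add: z G0)
      next
        case (insert x S)
        then show ?case
          using Glin[of "f x" "\<lambda>\<xi>s. \<Sum>x\<in>S. c x * f x \<xi>s" "c x" 1]
            tensor_lincomb[of "f x" n "\<lambda>\<xi>s. \<Sum>x\<in>S. c x * f x \<xi>s" "c x" 1]
          by (simp add: mscale_simps)
      qed
      fix t :: "('v, complex) tseries" assume t: "t \<in> tensor_power n"
      have "t = (\<lambda>\<xi>s. \<Sum>bs\<in>words_over B n. t (map e bs) * pure_tensor (?j bs) \<xi>s)"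
        by (rule ext) (rule tensor_expand[OF B t])
      then have "G t = G (\<lambda>\<xi>s. \<Sum>bs\<in>words_over B n. t (map e bs) * pure_tensor (?j bs) \<xi>s)" by simp
      also have "\<dots> = (\<Sum>bs\<in>words_over B n. mscale (t (map e bs)) (G (pure_tensor (?j bs))))"
        by (rule sums[THEN conjunct2]) (auto simp: finite_words[OF B(1)], auto simp: words_over_def pure_tensor_in)
      also have "\<dots> = F0 n t" unfolding F0_def
        using G by (intro sum.cong refl) (auto simp: is_mult_extension_def words_over_def)
      finally show "G t = F t" using t by (simp add: F_def)
    qed
  qed
qed

end

theory Submission
  imports Defs "HOL-Complex_Analysis.Complex_Analysis" "HOL-Computational_Algebra.Fundamental_Theorem_Algebra"
begin

text \<open>
  Since the signature decays factorially and \<open>exp (log g) = g\<close>, the exponential of \<open>A(z)\<close> is the image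
  of the signature under \<open>z\<Phi>\<close> and has operator norm at most \<open>exp (C \<bar>z\<bar>)\<close>.  Every eigenvalue of \<open>A(z)\<close>
  therefore has real part at most \<open>C \<bar>z\<bar>\<close>.  A Borel--Caratheodory argument for the unordered tuple of
  eigenvalues, carried out on determinants, improves this to a bound \<open>K \<bar>z\<bar>\<close> on their moduli.  Writing
  \<open>A(z) = z B(z)\<close> with \<open>B\<close> entire, \<open>det (1 - u B(z))\<close> is then bounded in \<open>z\<close>, hence constant by
  Liouville, and equal to its value at \<open>z = 0\<close>, where \<open>B(0) = \<Phi>(v)\<close>.
\<close>

section \<open>Riemann--Stieltjes integrals\<close>

text \<open>Two obstacles shape the proof. The modulus of an exponential depends on the real part
  alone, so the growth of the signature gives no direct control of imaginary parts of eigenvalues.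
  And the eigenvalues branch as z varies, so no single one is a holomorphic function to which the
  scalar inequality of Borel and Caratheodory could be applied. What is holomorphic is a
  determinant, and "no eigenvalue lies here" is always expressed as a determinant that does not
  vanish. The size q enters because a polynomial of degree at most q with value 1 at 0 and no zero
  in a disc is bounded in terms of q and the radius alone: zero-free discs thus become bounds. The
  infinite radius R(l) makes B holomorphic on the whole plane, as Liouville's theorem demands. The
  identity exp (log g) = g is first an identity of formal series: a basis turns tensor series into
  power series over the endomorphism algebra, with degree as exponent, and convergence is added only
  afterwards.\<close>

definition interval_increment :: "(real \<Rightarrow> real) \<Rightarrow> real set \<Rightarrow> real" where
  "interval_increment g K = (if K = {} then 0 else g (Sup K) - g (Inf K))"

lemma interval_increment_empty [simp]: "interval_increment g {} = 0"
  by (simp add: interval_increment_def)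

lemma interval_increment_atLeastAtMost [simp]:
  "interval_increment g {a..b} = (if a \<le> b then g b - g a else 0)"
  by (simp add: interval_increment_def)

text \<open>Increments over \<open>K \<inter> {u..v}\<close> are additive in K, so they telescope
  over a division; the value 0 on the empty set takes care of pieces that miss
  \<open>{u..v}\<close>. Two divisions can thereby be compared on their common refinement without
  constructing it.\<close>

lemma sum_interval_increment_Int:
  assumes p: "p tagged_division_of {a..b}" and "u \<le> v" "a \<le> u" "v \<le> b"
  shows "(\<Sum>(x, K)\<in>p. interval_increment g (K \<inter> {u..v})) = g v - g u"
proof -
  interpret operative_real plus 0 "\<lambda>K. interval_increment g (K \<inter> {u..v})"
    rewrites "comm_monoid_set.F (+) 0 = sum"
    by standard[1] (auto simp add: sum_def min_def max_def intro: arg_cong[where f = g])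
  have "(\<Sum>(x, K)\<in>p. interval_increment g (K \<inter> {u..v})) = interval_increment g ({a..b} \<inter> {u..v})"
    using tagged_division[of p a b] p by simp
  also have "{a..b} \<inter> {u..v} = {u..v}" using assms by auto
  finally show ?thesis using assms by simp
qed

definition RS_sum :: "(real \<Rightarrow> real) \<Rightarrow> (real \<Rightarrow> real) \<Rightarrow> (real \<times> real set) set \<Rightarrow> real" where
  "RS_sum f g D = (\<Sum>(x, K)\<in>D. f x * (g (Sup K) - g (Inf K)))"

definition mesh_less :: "(real \<times> real set) set \<Rightarrow> real \<Rightarrow> bool" where
  "mesh_less D \<delta> \<longleftrightarrow> (\<forall>(x, K)\<in>D. Sup K - Inf K < \<delta>)"

lemma mesh_less_mono: "mesh_less D \<delta> \<Longrightarrow> \<delta> \<le> \<epsilon> \<Longrightarrow> mesh_less D \<epsilon>"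
  by (fastforce simp: mesh_less_def)

lemma mesh_less_min [simp]: "mesh_less D (min \<delta> \<epsilon>) \<longleftrightarrow> mesh_less D \<delta> \<and> mesh_less D \<epsilon>"
  by (fastforce simp: mesh_less_def)

lemma has_RS_integral_iff:
  "has_RS_integral f g a b I \<longleftrightarrow> (\<forall>\<epsilon>>0. \<exists>\<delta>>0. \<forall>D. D tagged_division_of {a..b} \<and> mesh_less D \<delta> \<longrightarrow>
     \<bar>RS_sum f g D - I\<bar> < \<epsilon>)"
  by (simp add: has_RS_integral_def RS_sum_def mesh_less_def)

lemma has_RS_integralE:
  assumes "has_RS_integral f g a b I" "\<epsilon> > 0"
  obtains \<delta> where "\<delta> > 0"
    "\<And>D. D tagged_division_of {a..b} \<Longrightarrow> mesh_less D \<delta> \<Longrightarrow> \<bar>RS_sum f g D - I\<bar> < \<epsilon>"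
proof -
  from assms obtain \<delta> where "\<delta> > 0"
    "\<forall>D. D tagged_division_of {a..b} \<and> mesh_less D \<delta> \<longrightarrow> \<bar>RS_sum f g D - I\<bar> < \<epsilon>"
    unfolding has_RS_integral_iff by metis
  then show ?thesis by (intro that[of \<delta>]) auto
qed

lemma tagged_division_member:
  fixes a b :: real
  assumes "D tagged_division_of {a..b}" "(x, K) \<in> D"
  obtains u v where "K = {u..v}" "u \<le> v" "a \<le> u" "v \<le> b" "u \<le> x" "x \<le> v"
proof -
  have "x \<in> K" "K \<subseteq> {a..b}" "\<exists>u v. K = cbox u v"
    using tagged_division_ofD[OF assms(1)] assms(2) by blast+
  then show ?thesis using that by (auto simp: )
qed

lemma tagged_division_mesh_exists:
  assumes "\<delta> > 0"
  obtains D where "D tagged_division_of {a..b::real}" "mesh_less D \<delta>"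
proof -
  obtain D where D: "D tagged_division_of {a..b}" "(\<lambda>x. ball x (\<delta> / 2)) fine D"
    using fine_division_exists_real[of "\<lambda>x. ball x (\<delta> / 2)" a b] assms by (auto simp: gauge_def)
  have "Sup K - Inf K < \<delta>" if xK: "(x, K) \<in> D" for x K
  proof -
    obtain u v where uv: "K = {u..v}" "u \<le> v" using tagged_division_member[OF D(1) xK] by metis
    have "K \<subseteq> ball x (\<delta> / 2)" using D(2) xK by auto
    moreover have "u \<in> K" "v \<in> K" using uv by auto
    ultimately have "dist x u < \<delta> / 2" "dist x v < \<delta> / 2" by auto
    moreover have "v - u \<le> dist x u + dist x v" by (simp add: dist_real_def)
    ultimately have "v - u < \<delta>" by linarith
    then show ?thesis using uv by simp
  qed
  then have "mesh_less D \<delta>" by (auto simp: mesh_less_def)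
  with D(1) show ?thesis by (rule that)
qed

text \<open>The intervals are kept and only the tags change. Pairs over one degenerate interval with
  different tags merge, so the new division is built from the set of intervals.\<close>

lemma left_tagged_division_exists:
  assumes "\<delta> > 0"
  obtains D where "D tagged_division_of {a..b::real}" "mesh_less D \<delta>" "\<And>x K. (x, K) \<in> D \<Longrightarrow> x = Inf K"
proof -
  obtain D where D: "D tagged_division_of {a..b}" "mesh_less D \<delta>"
    using tagged_division_mesh_exists[OF assms] by blast
  let ?E = "(\<lambda>K. (Inf K, K)) ` (snd ` D)"
  note d = division_ofD[OF division_of_tagged_division[OF D(1)]]
  have "?E tagged_division_of {a..b}"
  proof (rule tagged_division_ofI)
    show "finite ?E" using d(1) by blast
    show "x \<in> K" "K \<subseteq> {a..b}" "\<exists>a b. K = cbox a b" if "(x, K) \<in> ?E" for x K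
    proof -
      from that have K: "K \<in> snd ` D" "x = Inf K" by auto
      then obtain y where "(y, K) \<in> D" by auto
      from tagged_division_member[OF D(1) this] obtain u v where "K = {u..v}" "u \<le> v" by metis
      then show "x \<in> K" using K by simp
      show "K \<subseteq> {a..b}" "\<exists>a b. K = cbox a b" using d K by blast+
    qed
    show "interior K1 \<inter> interior K2 = {}"
      if "(x1, K1) \<in> ?E" "(x2, K2) \<in> ?E" "(x1, K1) \<noteq> (x2, K2)" for x1 K1 x2 K2
      using that d(5)[of K1 K2] by (cases "K1 = K2") auto
    have "{K. \<exists>x. (x, K) \<in> ?E} = snd ` D" by (auto simp: image_iff)
    then show "\<Union>{K. \<exists>x. (x, K) \<in> ?E} = {a..b}" using d(6) by simp
  qed
  moreover have "mesh_less ?E \<delta>" using D(2) by (auto simp: mesh_less_def)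
  ultimately show ?thesis using that by blast
qed

section \<open>Uniqueness, existence and linearity of the integral\<close>

lemma has_RS_integral_unique:
  assumes "has_RS_integral f g a b I" "has_RS_integral f g a b J"
  shows "I = J"
proof (rule ccontr)
  define e where "e = \<bar>I - J\<bar> / 2"
  assume "I \<noteq> J"
  then have e: "e > 0" by (simp add: e_def)
  obtain d1 where d1: "d1 > 0" "\<And>D. D tagged_division_of {a..b} \<Longrightarrow> mesh_less D d1 \<Longrightarrow> \<bar>RS_sum f g D - I\<bar> < e"
    by (rule has_RS_integralE[OF assms(1) e]) (rule that)
  obtain d2 where d2: "d2 > 0" "\<And>D. D tagged_division_of {a..b} \<Longrightarrow> mesh_less D d2 \<Longrightarrow> \<bar>RS_sum f g D - J\<bar> < e"
    by (rule has_RS_integralE[OF assms(2) e]) (rule that)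
  have "min d1 d2 > 0" using d1(1) d2(1) by simp
  then obtain D where D: "D tagged_division_of {a..b}" "mesh_less D (min d1 d2)"
    by (rule tagged_division_mesh_exists)
  then have "mesh_less D d1" "mesh_less D d2" by simp_all
  from d1(2)[OF D(1) this(1)] d2(2)[OF D(1) this(2)]
  have "I - J < 2 * e" "J - I < 2 * e" unfolding abs_less_iff by linarith+
  then have "\<bar>I - J\<bar> < 2 * e" by simp
  then show False by (simp add: e_def)
qed

lemma RS_integral_eqI: "has_RS_integral f g a b I \<Longrightarrow> RS_integral f g a b = I"
  unfolding RS_integral_def by (rule the_equality) (assumption, rule has_RS_integral_unique)

text \<open>\<open>\<omega>\<close> stands for a variation function, but only its increments matter.
  One \<open>\<omega>\<close> serves all coordinates of a path up to a factor, and it restricts to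
  subintervals unchanged.\<close>

definition dominated_on :: "(real \<Rightarrow> real) \<Rightarrow> (real \<Rightarrow> real) \<Rightarrow> real \<Rightarrow> real \<Rightarrow> bool" where
  "dominated_on g \<omega> a b \<longleftrightarrow> (\<forall>s t. a \<le> s \<and> s \<le> t \<and> t \<le> b \<longrightarrow> \<bar>g t - g s\<bar> \<le> \<omega> t - \<omega> s)"

lemma dominated_onD: "dominated_on g \<omega> a b \<Longrightarrow> a \<le> s \<Longrightarrow> s \<le> t \<Longrightarrow> t \<le> b \<Longrightarrow> \<bar>g t - g s\<bar> \<le> \<omega> t - \<omega> s"
  by (simp add: dominated_on_def)

lemma dominated_on_subset: "dominated_on g \<omega> a b \<Longrightarrow> a \<le> c \<Longrightarrow> d \<le> b \<Longrightarrow> dominated_on g \<omega> c d"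
  unfolding dominated_on_def by (meson order_trans)

text \<open>Both sums become double sums over pairs (K, L) weighted by the increment over
  \<open>K \<inter> L\<close>. If K and L meet and are shorter than \<open>\<delta>\<close>, their
  tags are less than \<open>2 * \<delta>\<close> apart and the oscillation bound applies; disjoint
  pairs contribute nothing, and the increments of \<open>\<omega>\<close> telescope.\<close>

lemma RS_sum_close:
  assumes dom: "dominated_on g \<omega> a b" and ab: "a \<le> b"
    and osc: "\<And>x y. x \<in> {a..b} \<Longrightarrow> y \<in> {a..b} \<Longrightarrow> \<bar>x - y\<bar> < 2 * \<delta> \<Longrightarrow> \<bar>f x - f y\<bar> \<le> \<epsilon>"
    and D: "D tagged_division_of {a..b}" "mesh_less D \<delta>"
    and E: "E tagged_division_of {a..b}" "mesh_less E \<delta>"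
  shows "\<bar>RS_sum f g D - RS_sum f g E\<bar> \<le> \<epsilon> * (\<omega> b - \<omega> a)"
proof -
  have split: "g (Sup K) - g (Inf K) = (\<Sum>(y, L)\<in>E'. interval_increment g (K \<inter> L))"
    if D': "D' tagged_division_of {a..b}" and E': "E' tagged_division_of {a..b}" and xK: "(x, K) \<in> D'"
    for D' E' x K and g :: "real \<Rightarrow> real"
  proof -
    obtain u v where "K = {u..v}" "u \<le> v" "a \<le> u" "v \<le> b" using tagged_division_member[OF D' xK] by metis
    then show ?thesis using sum_interval_increment_Int[OF E', of u v g]
      by (simp add: Int_commute)
  qed
  have RS: "RS_sum f g D = (\<Sum>(x, K)\<in>D. \<Sum>(y, L)\<in>E. f x * interval_increment g (K \<inter> L))"
    unfolding RS_sum_def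
    by (rule sum.cong) (auto simp: split[OF D(1) E(1)] sum_distrib_left case_prod_beta)
  have RS': "RS_sum f g E = (\<Sum>(x, K)\<in>D. \<Sum>(y, L)\<in>E. f y * interval_increment g (K \<inter> L))"
  proof -
    have "RS_sum f g E = (\<Sum>(y, L)\<in>E. \<Sum>(x, K)\<in>D. f y * interval_increment g (L \<inter> K))"
      unfolding RS_sum_def
      by (rule sum.cong) (auto simp: split[OF E(1) D(1)] sum_distrib_left case_prod_beta)
    also have "\<dots> = (\<Sum>(x, K)\<in>D. \<Sum>(y, L)\<in>E. f y * interval_increment g (K \<inter> L))"
      unfolding case_prod_beta by (subst sum.swap) (simp add: Int_commute)
    finally show ?thesis .
  qed
  have "RS_sum f g D - RS_sum f g E =
      (\<Sum>(x, K)\<in>D. \<Sum>(y, L)\<in>E. (f x - f y) * interval_increment g (K \<inter> L))"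
    unfolding RS RS' by (simp add: case_prod_beta sum_subtractf left_diff_distrib)
  also have "\<bar>\<dots>\<bar> \<le> (\<Sum>(x, K)\<in>D. \<Sum>(y, L)\<in>E. \<bar>(f x - f y) * interval_increment g (K \<inter> L)\<bar>)"
    unfolding case_prod_beta by (intro order_trans[OF sum_abs] sum_mono order_trans[OF sum_abs] order_refl)
  also have "\<dots> \<le> (\<Sum>(x, K)\<in>D. \<Sum>(y, L)\<in>E. \<epsilon> * interval_increment \<omega> (K \<inter> L))"
  proof (rule sum_mono, clarify, rule sum_mono, clarify)
    fix x K y L assume xK: "(x, K) \<in> D" and yL: "(y, L) \<in> E"
    obtain u v where K: "K = {u..v}" "u \<le> v" "a \<le> u" "v \<le> b" "u \<le> x" "x \<le> v"
      using tagged_division_member[OF D(1) xK] by metis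
    obtain p q where L: "L = {p..q}" "p \<le> q" "a \<le> p" "q \<le> b" "p \<le> y" "y \<le> q"
      using tagged_division_member[OF E(1) yL] by metis
    show "\<bar>(f x - f y) * interval_increment g (K \<inter> L)\<bar> \<le> \<epsilon> * interval_increment \<omega> (K \<inter> L)"
    proof (cases "max u p \<le> min v q")
      case True
      have "v - u < \<delta>" "q - p < \<delta>" using D(2) E(2) xK yL K L by (auto simp: mesh_less_def)
      then have "\<bar>f x - f y\<bar> \<le> \<epsilon>" using K L True by (intro osc) auto
      moreover have "\<bar>g (min v q) - g (max u p)\<bar> \<le> \<omega> (min v q) - \<omega> (max u p)"
        using True K L by (intro dominated_onD[OF dom]) auto
      ultimately show ?thesis using True K L by (simp add: abs_mult mult_mono)
    qed (use K L in auto)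
  qed
  also have "\<dots> = (\<Sum>(x, K)\<in>D. \<epsilon> * (\<omega> (Sup K) - \<omega> (Inf K)))"
    by (rule sum.cong) (auto simp: split[OF D(1) E(1)] sum_distrib_left case_prod_beta)
  also have "\<dots> = \<epsilon> * (\<omega> b - \<omega> a)"
    using additive_tagged_division_1[OF ab D(1), of \<omega>] by (simp add: case_prod_beta sum_distrib_left[symmetric])
  finally show ?thesis .
qed

lemma RS_integrable_continuous:
  assumes dom: "dominated_on g \<omega> a b" and ab: "a \<le> b" and cont: "continuous_on {a..b} f"
  shows "\<exists>I. has_RS_integral f g a b I"
proof -
  have \<omega>: "\<omega> b - \<omega> a \<ge> 0" using dominated_onD[OF dom order_refl ab order_refl] by simp
  have close: "\<exists>\<delta>>0. \<forall>D E. D tagged_division_of {a..b} \<and> mesh_less D \<delta> \<and> E tagged_division_of {a..b}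
      \<and> mesh_less E \<delta> \<longrightarrow> \<bar>RS_sum f g D - RS_sum f g E\<bar> < \<epsilon>" if "\<epsilon> > 0" for \<epsilon>
  proof -
    define e where "e = \<epsilon> / (\<omega> b - \<omega> a + 1)"
    have e: "e > 0" "e * (\<omega> b - \<omega> a) < \<epsilon>" using that \<omega> by (auto simp: e_def field_simps)
    have "uniformly_continuous_on {a..b} f" using cont by (simp add: compact_uniformly_continuous)
    then obtain d where d: "d > 0" "\<And>x y. x \<in> {a..b} \<Longrightarrow> y \<in> {a..b} \<Longrightarrow> dist y x < d \<Longrightarrow> dist (f y) (f x) < e"
      using e(1) unfolding uniformly_continuous_on_def by metis
    have "\<bar>RS_sum f g D - RS_sum f g E\<bar> \<le> e * (\<omega> b - \<omega> a)"
      if "D tagged_division_of {a..b}" "mesh_less D (d/2)" "E tagged_division_of {a..b}" "mesh_less E (d/2)" for D E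
      
    proof (rule RS_sum_close[OF dom ab _ that])
      show "\<bar>f x - f y\<bar> \<le> e" if "x \<in> {a..b}" "y \<in> {a..b}" "\<bar>x - y\<bar> < 2 * (d / 2)" for x y
        using d(2)[of y x] that by (simp add: dist_real_def)
    qed
    then show ?thesis using e(2) d(1) by (intro exI[of _ "d/2"] conjI allI impI) (auto intro: le_less_trans)
  qed
  define P where "P \<epsilon> \<delta> \<longleftrightarrow> \<delta> > 0 \<and> (\<forall>D E. D tagged_division_of {a..b} \<and> mesh_less D \<delta> \<and> E tagged_division_of {a..b}
      \<and> mesh_less E \<delta> \<longrightarrow> \<bar>RS_sum f g D - RS_sum f g E\<bar> < \<epsilon>)" for \<epsilon> \<delta>
  define \<delta> where "\<delta> n = (SOME d. P (1 / Suc n) d)" for n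
  have \<delta>: "P (1 / Suc n) (\<delta> n)" for n
    unfolding \<delta>_def by (rule someI_ex) (use close[of "1 / Suc n"] in \<open>simp add: P_def\<close>)
  \<comment> \<open>The thresholds are arbitrary choices and need not decrease with n; the minimum
    of the first ones allows \<open>D n\<close> to be compared at every level
    \<open>m \<le> n\<close>.\<close>
  have "\<exists>D. D tagged_division_of {a..b} \<and> mesh_less D (MIN i\<in>{..n}. \<delta> i)" for n
  proof -
    have "(MIN i\<in>{..n}. \<delta> i) > 0" using \<delta> by (auto simp: P_def)
    from tagged_division_mesh_exists[OF this] show ?thesis by blast
  qed
  then obtain D where D: "\<And>n. D n tagged_division_of {a..b}" "\<And>n. mesh_less (D n) (MIN i\<in>{..n}. \<delta> i)"
    by metis
  have mesh: "mesh_less (D n) (\<delta> m)" if "m \<le> n" for m n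
  proof -
    have "(MIN i\<in>{..n}. \<delta> i) \<le> \<delta> m" using that by simp
    with D(2) show ?thesis by (rule mesh_less_mono)
  qed
  have lt: "\<bar>RS_sum f g (D n) - RS_sum f g E\<bar> < 1 / Suc m"
    if "m \<le> n" "E tagged_division_of {a..b}" "mesh_less E (\<delta> m)" for n m E
    using \<delta>[of m] D(1)[of n] mesh[OF that(1)] that unfolding P_def by blast
  have "Cauchy (\<lambda>n. RS_sum f g (D n))"
  proof (rule metric_CauchyI)
    fix e :: real assume "e > 0"
    then obtain m where m: "1 / Suc m < e" using nat_approx_posE by blast
    show "\<exists>M. \<forall>m\<ge>M. \<forall>n\<ge>M. dist (RS_sum f g (D m)) (RS_sum f g (D n)) < e"
    proof (intro exI[of _ m] allI impI)
      fix i j assume "m \<le> i" "m \<le> j"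
      from lt[OF this(1) D(1) mesh[OF this(2)]] m
      show "dist (RS_sum f g (D i)) (RS_sum f g (D j)) < e" by (simp add: dist_real_def)
    qed
  qed
  then obtain I where I: "(\<lambda>n. RS_sum f g (D n)) \<longlonglongrightarrow> I" using Cauchy_convergent convergent_def by blast
  show ?thesis
  proof (rule exI[of _ I], unfold has_RS_integral_iff, intro allI impI)
    fix \<epsilon> :: real assume "\<epsilon> > 0"
    then obtain m where m: "1 / Suc m < \<epsilon>" using nat_approx_posE by blast
    show "\<exists>\<delta>>0. \<forall>D. D tagged_division_of {a..b} \<and> mesh_less D \<delta> \<longrightarrow> \<bar>RS_sum f g D - I\<bar> < \<epsilon>"
    proof (intro exI[of _ "\<delta> m"] conjI allI impI)
      show "\<delta> m > 0" using \<delta> by (simp add: P_def)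
      fix E assume E: "E tagged_division_of {a..b} \<and> mesh_less E (\<delta> m)"
      have "(\<lambda>n. \<bar>RS_sum f g (D n) - RS_sum f g E\<bar>) \<longlonglongrightarrow> \<bar>I - RS_sum f g E\<bar>"
        by (intro tendsto_intros I)
      then have "\<bar>I - RS_sum f g E\<bar> \<le> 1 / Suc m"
        by (rule Lim_bounded[where M = m]) (use lt E in \<open>auto intro: less_imp_le\<close>)
      then show "\<bar>RS_sum f g E - I\<bar> < \<epsilon>" using m by simp
    qed
  qed
qed

lemma has_RS_integral_RS_integral:
  assumes "dominated_on g \<omega> a b" "a \<le> b" "continuous_on {a..b} f"
  shows "has_RS_integral f g a b (RS_integral f g a b)"
  using RS_integrable_continuous[OF assms] RS_integral_eqI by metis

text \<open>Linearity is asked of the Riemann sums, so one argument serves both the integrand and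
  the integrator.\<close>

lemma has_RS_integral_combine:
  assumes "\<And>D. RS_sum f g D = c1 * RS_sum f1 g1 D + c2 * RS_sum f2 g2 D"
    and "has_RS_integral f1 g1 a b I1" "has_RS_integral f2 g2 a b I2"
  shows "has_RS_integral f g a b (c1 * I1 + c2 * I2)"
  unfolding has_RS_integral_iff
proof (intro allI impI)
  fix \<epsilon> :: real assume \<epsilon>: "\<epsilon> > 0"
  define e where "e = \<epsilon> / (\<bar>c1\<bar> + \<bar>c2\<bar> + 1)"
  have e: "e > 0" using \<epsilon> by (simp add: e_def)
  have e2: "(\<bar>c1\<bar> + \<bar>c2\<bar>) * e < \<epsilon>" using \<epsilon> by (simp add: e_def field_simps)
  obtain d1 where d1: "d1 > 0" "\<And>D. D tagged_division_of {a..b} \<Longrightarrow> mesh_less D d1 \<Longrightarrow> \<bar>RS_sum f1 g1 D - I1\<bar> < e"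
    by (rule has_RS_integralE[OF assms(2) e]) (rule that)
  obtain d2 where d2: "d2 > 0" "\<And>D. D tagged_division_of {a..b} \<Longrightarrow> mesh_less D d2 \<Longrightarrow> \<bar>RS_sum f2 g2 D - I2\<bar> < e"
    by (rule has_RS_integralE[OF assms(3) e]) (rule that)
  show "\<exists>\<delta>>0. \<forall>D. D tagged_division_of {a..b} \<and> mesh_less D \<delta> \<longrightarrow> \<bar>RS_sum f g D - (c1 * I1 + c2 * I2)\<bar> < \<epsilon>"
  proof (intro exI[of _ "min d1 d2"] conjI allI impI)
    show "min d1 d2 > 0" using d1 d2 by simp
    fix D assume D: "D tagged_division_of {a..b} \<and> mesh_less D (min d1 d2)"
    then have m: "mesh_less D d1" "mesh_less D d2" by simp_all
    have "\<bar>RS_sum f g D - (c1 * I1 + c2 * I2)\<bar> = \<bar>c1 * (RS_sum f1 g1 D - I1) + c2 * (RS_sum f2 g2 D - I2)\<bar>"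
      by (simp add: assms(1) algebra_simps)
    also have "\<dots> \<le> \<bar>c1\<bar> * \<bar>RS_sum f1 g1 D - I1\<bar> + \<bar>c2\<bar> * \<bar>RS_sum f2 g2 D - I2\<bar>"
      by (metis abs_mult abs_triangle_ineq)
    also have "\<dots> \<le> \<bar>c1\<bar> * e + \<bar>c2\<bar> * e"
      by (intro add_mono mult_left_mono less_imp_le[OF d1(2)] less_imp_le[OF d2(2)]) (use D m in auto)
    also have "\<dots> < \<epsilon>" using e2 by (simp add: algebra_simps)
    finally show "\<bar>RS_sum f g D - (c1 * I1 + c2 * I2)\<bar> < \<epsilon>" .
  qed
qed

lemma RS_sum_linear:
  assumes "\<And>x u v. f x * (g v - g u) = c1 * (f1 x * (g1 v - g1 u)) + c2 * (f2 x * (g2 v - g2 u))"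
  shows "RS_sum f g D = c1 * RS_sum f1 g1 D + c2 * RS_sum f2 g2 D"
  unfolding RS_sum_def sum_distrib_left sum.distrib[symmetric] by (rule sum.cong) (auto simp: assms)

lemma RS_integral_linear_integrand:
  assumes "dominated_on g \<omega> a b" "a \<le> b" "continuous_on {a..b} f1" "continuous_on {a..b} f2"
  shows "RS_integral (\<lambda>x. c1 * f1 x + c2 * f2 x) g a b = c1 * RS_integral f1 g a b + c2 * RS_integral f2 g a b"
  by (intro RS_integral_eqI has_RS_integral_combine[of _ _ c1 f1 g c2 f2 g]
        has_RS_integral_RS_integral[OF assms(1,2)] assms)
     (rule RS_sum_linear; simp add: algebra_simps)

lemma RS_integral_linear_integrator:
  assumes "dominated_on g1 \<omega>1 a b" "dominated_on g2 \<omega>2 a b" "a \<le> b" "continuous_on {a..b} f"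
  shows "RS_integral f (\<lambda>x. c1 * g1 x + c2 * g2 x) a b = c1 * RS_integral f g1 a b + c2 * RS_integral f g2 a b"
  by (intro RS_integral_eqI has_RS_integral_combine[of _ _ c1 f g1 c2 f g2]
        has_RS_integral_RS_integral[OF assms(1,3)] has_RS_integral_RS_integral[OF assms(2,3)] assms)
     (rule RS_sum_linear; simp add: algebra_simps)

lemma RS_integral_split:
  assumes dom: "dominated_on g \<omega> a b" and "a \<le> c" "c \<le> b" and cont: "continuous_on {a..b} f"
  shows "RS_integral f g a b = RS_integral f g a c + RS_integral f g c b"
proof (rule ccontr)
  let ?I = "RS_integral f g a b" and ?J = "RS_integral f g a c" and ?K = "RS_integral f g c b"
  assume "?I \<noteq> ?J + ?K"
  define e where "e = \<bar>?I - (?J + ?K)\<bar> / 3"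
  have e: "e > 0" using \<open>?I \<noteq> ?J + ?K\<close> by (simp add: e_def)
  have 1: "has_RS_integral f g a b ?I" using assms by (intro has_RS_integral_RS_integral) auto
  have 2: "has_RS_integral f g a c ?J" using assms
    by (intro has_RS_integral_RS_integral[OF dominated_on_subset[OF dom]]) (auto elim: continuous_on_subset)
  have 3: "has_RS_integral f g c b ?K" using assms
    by (intro has_RS_integral_RS_integral[OF dominated_on_subset[OF dom]]) (auto elim: continuous_on_subset)
  obtain d1 where d1: "d1 > 0" "\<And>D. D tagged_division_of {a..b} \<Longrightarrow> mesh_less D d1 \<Longrightarrow> \<bar>RS_sum f g D - ?I\<bar> < e"
    by (rule has_RS_integralE[OF 1 e]) (rule that)
  obtain d2 where d2: "d2 > 0" "\<And>D. D tagged_division_of {a..c} \<Longrightarrow> mesh_less D d2 \<Longrightarrow> \<bar>RS_sum f g D - ?J\<bar> < e"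
    by (rule has_RS_integralE[OF 2 e]) (rule that)
  obtain d3 where d3: "d3 > 0" "\<And>D. D tagged_division_of {c..b} \<Longrightarrow> mesh_less D d3 \<Longrightarrow> \<bar>RS_sum f g D - ?K\<bar> < e"
    by (rule has_RS_integralE[OF 3 e]) (rule that)
  obtain D where D: "D tagged_division_of {a..c}" "mesh_less D (min d1 d2)"
    by (rule tagged_division_mesh_exists[of "min d1 d2"]) (use d1(1) d2(1) in \<open>simp, blast\<close>)
  obtain E where E: "E tagged_division_of {c..b}" "mesh_less E (min d1 d3)"
    by (rule tagged_division_mesh_exists[of "min d1 d3"]) (use d1(1) d3(1) in \<open>simp, blast\<close>)
  have "{a..c} = {a..b} \<inter> {x. x \<bullet> 1 \<le> c}" "{c..b} = {a..b} \<inter> {x. x \<bullet> 1 \<ge> c}" using assms by auto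
  then have DE: "(D \<union> E) tagged_division_of {a..b}"
    using tagged_division_Un_interval_real[of D a b 1 c E] D(1) E(1) by simp
  have "mesh_less (D \<union> E) d1" using D(2) E(2) by (auto simp: mesh_less_def)
  from d1(2)[OF DE this] have 4: "\<bar>RS_sum f g (D \<union> E) - ?I\<bar> < e" .
  have "mesh_less D d2" using D(2) by simp_all
  from d2(2)[OF D(1) this] have 5: "\<bar>RS_sum f g D - ?J\<bar> < e" .
  have "mesh_less E d3" using E(2) by simp_all
  from d3(2)[OF E(1) this] have 6: "\<bar>RS_sum f g E - ?K\<bar> < e" .
  \<comment> \<open>An interval in both divisions can only be the point c, whose increment is 0, so
    the sums add even if D and E are not disjoint.\<close>
  have "RS_sum f g (D \<union> E) = RS_sum f g D + RS_sum f g E"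
    unfolding RS_sum_def
  proof (rule sum.union_inter_neutral)
    show "finite D" "finite E" using D(1) E(1) by blast+
    show "\<forall>p\<in>D \<inter> E. (case p of (x, K) \<Rightarrow> f x * (g (Sup K) - g (Inf K))) = 0"
    proof clarify
      fix x K assume "(x, K) \<in> D" "(x, K) \<in> E"
      obtain u v where 1: "K = {u..v}" "u \<le> v" "v \<le> c"
        using tagged_division_member[OF D(1) \<open>(x, K) \<in> D\<close>] by metis
      obtain p q where 2: "K = {p..q}" "c \<le> p" "p \<le> q"
        using tagged_division_member[OF E(1) \<open>(x, K) \<in> E\<close>] by metis
      from 1 2 have "u = v" by (simp add: Icc_eq_Icc) 
      with \<open>K = {u..v}\<close> show "f x * (g (Sup K) - g (Inf K)) = 0" by simp
    qed
  qed
  with 4 5 6 have "\<bar>?I - (?J + ?K)\<bar> < 3 * e" by linarith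
  then show False by (simp add: e_def)
qed

text \<open>The majorant H is left free instead of being a supremum of f times a variation: for
  iterated integrals it is a power of \<open>\<omega>\<close> over a factorial, and a supremum would
  lose that factorial.\<close>

lemma RS_integral_bound:
  assumes dom: "dominated_on g \<omega> a b" and ab: "a \<le> b" and cont: "continuous_on {a..b} f"
    and le: "\<And>s t. a \<le> s \<Longrightarrow> s \<le> t \<Longrightarrow> t \<le> b \<Longrightarrow> \<bar>f s * (g t - g s)\<bar> \<le> H t - H s"
  shows "\<bar>RS_integral f g a b\<bar> \<le> H b - H a"
proof (rule field_le_epsilon)
  fix e :: real assume "e > 0"
  then obtain d where d: "d > 0" "\<And>D. D tagged_division_of {a..b} \<Longrightarrow> mesh_less D d \<Longrightarrow> \<bar>RS_sum f g D - RS_integral f g a b\<bar> < e"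
    by (rule has_RS_integralE[OF has_RS_integral_RS_integral[OF dom ab cont]]) (rule that)
  \<comment> \<open>\<open>le\<close> controls only the value of \<open>f\<close> at left end points, so these are taken as tags.\<close>
  obtain D where D: "D tagged_division_of {a..b::real}" "mesh_less D d" "\<And>x K. (x, K) \<in> D \<Longrightarrow> x = Inf K"
    using left_tagged_division_exists[OF d(1)] by blast
  have "\<bar>RS_sum f g D\<bar> \<le> (\<Sum>(x, K)\<in>D. \<bar>f x * (g (Sup K) - g (Inf K))\<bar>)"
    unfolding RS_sum_def case_prod_beta by (rule sum_abs)
  also have "\<dots> \<le> (\<Sum>(x, K)\<in>D. H (Sup K) - H (Inf K))"
  proof (rule sum_mono, clarify)
    fix x K assume xK: "(x, K) \<in> D"
    obtain u v where "K = {u..v}" "u \<le> v" "a \<le> u" "v \<le> b" using tagged_division_member[OF D(1) xK] by metis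
    then show "\<bar>f x * (g (Sup K) - g (Inf K))\<bar> \<le> H (Sup K) - H (Inf K)"
      using le[of u v] D(3)[OF xK] by simp
  qed
  also have "\<dots> = H b - H a" using additive_tagged_division_1[OF ab D(1), of H] by simp
  finally show "\<bar>RS_integral f g a b\<bar> \<le> H b - H a + e" using d(2)[OF D(1,2)] by linarith
qed

text \<open>Continuity makes the indefinite integral admissible as the next integrand. As
  \<open>\<omega>\<close> may jump, its increments cannot bound those of the integral well enough.
  Instead f is split on \<open>{s..t}\<close> as \<open>f s\<close> plus a remainder: the constant
  part gives exactly \<open>f s * (g t - g s)\<close>, small by continuity of g, and the remainder
  gives at most the oscillation of f times the total variation.\<close>

lemma continuous_on_RS_integral:
  assumes dom: "dominated_on g \<omega> a b" and g: "continuous_on {a..b} g" and f: "continuous_on {a..b} f"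
  shows "continuous_on {a..b} (\<lambda>t. RS_integral f g a t)"
proof (cases "a \<le> b")
  case ab: True
  let ?h = "\<lambda>t. RS_integral f g a t"
  obtain M where M: "M > 0" "\<And>x. x \<in> {a..b} \<Longrightarrow> \<bar>f x\<bar> \<le> M"
    using compact_imp_bounded[OF compact_continuous_image[OF f]] unfolding bounded_pos by auto
  have \<omega>: "\<omega> s \<le> \<omega> t" if "a \<le> s" "s \<le> t" "t \<le> b" for s t
    using dominated_onD[OF dom that] by linarith
  have est: "\<bar>?h t - ?h s\<bar> \<le> M * \<bar>g t - g s\<bar> + e * (\<omega> b - \<omega> a)"
    if st: "a \<le> s" "s \<le> t" "t \<le> b" and e: "e \<ge> 0" "\<And>x. x \<in> {s..t} \<Longrightarrow> \<bar>f x - f s\<bar> \<le> e" for s t e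
  proof -
    have fst: "continuous_on {s..t} f" and dst: "dominated_on g \<omega> s t"
      using f continuous_on_subset[of "{a..b}" f "{s..t}"] dominated_on_subset[OF dom] st by auto
    have "?h t - ?h s = RS_integral f g s t"
      using RS_integral_split[of g \<omega> a t s f] st dominated_on_subset[OF dom, of a t] f
        continuous_on_subset[of "{a..b}" f "{a..t}"] by simp
    also have "\<dots> = f s * RS_integral (\<lambda>_. 1) g s t + RS_integral (\<lambda>x. f x - f s) g s t"
      using RS_integral_linear_integrand[OF dst st(2), of "\<lambda>_. 1" "\<lambda>x. f x - f s" "f s" 1] fst
      by (simp add: continuous_intros)
    also have "RS_integral (\<lambda>_. 1) g s t = g t - g s"
    proof (rule RS_integral_eqI)
      show "has_RS_integral (\<lambda>_. 1) g s t (g t - g s)"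
        unfolding has_RS_integral_iff RS_sum_def
        using additive_tagged_division_1[OF st(2), of _ g] by (auto intro!: exI[of _ 1])
    qed
    finally have "?h t - ?h s = f s * (g t - g s) + RS_integral (\<lambda>x. f x - f s) g s t" .
    moreover have "\<bar>RS_integral (\<lambda>x. f x - f s) g s t\<bar> \<le> e * \<omega> t - e * \<omega> s"
    proof (rule RS_integral_bound[OF dst st(2)])
      show "continuous_on {s..t} (\<lambda>x. f x - f s)" using fst by (intro continuous_intros)
      show "\<bar>(f x - f s) * (g y - g x)\<bar> \<le> e * \<omega> y - e * \<omega> x" if "s \<le> x" "x \<le> y" "y \<le> t" for x y
        unfolding abs_mult right_diff_distrib[symmetric]
        using that e dominated_onD[OF dst that] by (intro mult_mono) auto
    qed
    moreover have "e * \<omega> t - e * \<omega> s \<le> e * (\<omega> b - \<omega> a)"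
      using \<omega>[of a s] \<omega>[of t b] st e(1) by (simp add: right_diff_distrib[symmetric] mult_left_mono)
    moreover have "\<bar>f s * (g t - g s)\<bar> \<le> M * \<bar>g t - g s\<bar>"
      using M(2)[of s] st by (simp add: abs_mult mult_right_mono)
    ultimately show ?thesis by linarith
  qed
  have "uniformly_continuous_on {a..b} ?h"
    unfolding uniformly_continuous_on_def
  proof (intro allI impI)
    fix e :: real assume e: "e > 0"
    \<comment> \<open>\<open>e1\<close> limits the oscillation of f and leaves at most e / 2 after
      multiplication by the variation; \<open>e2\<close> limits the increment of g and leaves e / 4
      after multiplication by M.\<close>
    define e1 where "e1 = e / (2 * (\<omega> b - \<omega> a + 1))"
    define e2 where "e2 = e / (4 * M)"
    have pos: "\<omega> b - \<omega> a + 1 > 0" using \<omega>[of a b] ab by simp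
    have e1: "e1 > 0" "e1 * (\<omega> b - \<omega> a) \<le> e / 2"
      using e pos by (auto simp: e1_def field_simps)
    have e2: "e2 > 0" "M * e2 < e / 2" using e M(1) by (auto simp: e2_def)
    have ucf: "uniformly_continuous_on {a..b} f" and ucg: "uniformly_continuous_on {a..b} g"
      using f g by (simp_all add: compact_uniformly_continuous)
    obtain d1 where d1: "d1 > 0" "\<And>x y. x \<in> {a..b} \<Longrightarrow> y \<in> {a..b} \<Longrightarrow> dist y x < d1 \<Longrightarrow> dist (f y) (f x) < e1"
      using ucf e1(1) unfolding uniformly_continuous_on_def by metis
    obtain d2 where d2: "d2 > 0" "\<And>x y. x \<in> {a..b} \<Longrightarrow> y \<in> {a..b} \<Longrightarrow> dist y x < d2 \<Longrightarrow> dist (g y) (g x) < e2"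
      using ucg e2(1) unfolding uniformly_continuous_on_def by metis
    have main: "\<bar>?h t - ?h s\<bar> < e" if "a \<le> s" "s \<le> t" "t \<le> b" "t - s < min d1 d2" for s t
    proof -
      have "\<bar>?h t - ?h s\<bar> \<le> M * \<bar>g t - g s\<bar> + e1 * (\<omega> b - \<omega> a)"
      proof (rule est)
        show "\<bar>f x - f s\<bar> \<le> e1" if "x \<in> {s..t}" for x
          using d1(2)[of s x] that \<open>a \<le> s\<close> \<open>t \<le> b\<close> \<open>t - s < min d1 d2\<close> by (auto simp: dist_real_def)
      qed (use that e1 in auto)
      also have "M * \<bar>g t - g s\<bar> \<le> M * e2"
        using d2(2)[of s t] that M(1) by (intro mult_left_mono) (auto simp: dist_real_def)
      finally show ?thesis using e1 e2 by linarith
    qed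
    show "\<exists>d>0. \<forall>x\<in>{a..b}. \<forall>y\<in>{a..b}. dist y x < d \<longrightarrow> dist (?h y) (?h x) < e"
    proof (intro exI[of _ "min d1 d2"] conjI ballI impI)
      fix x y assume "x \<in> {a..b}" "y \<in> {a..b}" "dist y x < min d1 d2"
      then show "dist (?h y) (?h x) < e"
        using main[of x y] main[of y x] by (cases "x \<le> y") (auto simp: dist_real_def abs_minus_commute)
    qed (use d1 d2 in auto)
  qed
  then show ?thesis by (rule uniformly_continuous_imp_continuous)
qed auto

section \<open>Iterated integrals of paths of bounded variation\<close>

text \<open>\<open>\<omega> t\<close> is the total variation on \<open>{0..t}\<close>. Adding the
  single interval \<open>{s..t}\<close> to a division of \<open>{0..s}\<close> shows that the
  variation grows by at least the norm of the increment, and also that the bound for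
  \<open>{0..T}\<close> holds on every shorter interval.\<close>

lemma bounded_variation_dominated:
  fixes \<gamma> :: "real \<Rightarrow> 'v::real_normed_vector"
  assumes bv: "\<gamma> has_bounded_variation_on {0..T}"
  obtains \<omega> where "\<omega> 0 = 0"
    "\<And>s t. 0 \<le> s \<Longrightarrow> s \<le> t \<Longrightarrow> t \<le> T \<Longrightarrow> norm (\<gamma> t - \<gamma> s) \<le> \<omega> t - \<omega> s"
proof -
  define V where "V D = (\<Sum>K\<in>D. norm (\<gamma> (Sup K) - \<gamma> (Inf K)))" for D
  define S where "S t = V ` {D. D division_of {0..t::real}}" for t
  obtain M where M: "\<And>D. D division_of {0..T} \<Longrightarrow> V D \<le> M"
    using bv unfolding has_bounded_variation_on_def V_def by blast
  have extend: "\<exists>E. E division_of {0..t} \<and> V E = V D + norm (\<gamma> t - \<gamma> s)"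
    if D: "D division_of {0..s}" and st: "0 \<le> s" "s < t" for D s t
  proof (intro exI conjI)
    have fin: "finite D" using D by blast
    have "{{s..t}} division_of {s..t}" using division_of_self[of s t] st by simp
    then have "D \<union> {{s..t}} division_of {0..s} \<union> {s..t}"
      by (rule division_disjoint_union[OF D]) auto
    moreover have "{0..s} \<union> {s..t} = {0..t}" using st by auto
    ultimately show "insert {s..t} D division_of {0..t}" by simp
    \<comment> \<open>Strictness of s < t excludes a degenerate interval, which D might already
      contain.\<close>
    have "{s..t} \<notin> D"
    proof
      assume "{s..t} \<in> D"
      then have "{s..t} \<subseteq> {0..s}" using D by blast
      then show False using st by auto
    qed
    then show "V (insert {s..t} D) = V D + norm (\<gamma> t - \<gamma> s)" using fin st by (simp add: V_def)
  qed
  have bdd: "V D \<le> M" if "D division_of {0..t}" "0 \<le> t" "t \<le> T" for D t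
  proof (cases "t = T")
    case False
    with extend[OF that(1), of T] that obtain E where "E division_of {0..T}" "V E = V D + norm (\<gamma> T - \<gamma> t)"
      by auto
    then show ?thesis using M[of E] norm_ge_zero[of "\<gamma> T - \<gamma> t"] by linarith
  qed (use M that in auto)
  have ne: "S t \<noteq> {}" for t
    using elementary_interval[of 0 t] by (force simp: S_def)
  have main: "norm (\<gamma> t - \<gamma> s) \<le> Sup (S t) - Sup (S s)" if st: "0 \<le> s" "s \<le> t" "t \<le> T" for s t
  proof (cases "s = t")
    case False
    then have lt: "s < t" using st by simp
    have "Sup (S s) \<le> Sup (S t) - norm (\<gamma> t - \<gamma> s)"
    proof (rule cSup_least[OF ne])
      fix x assume "x \<in> S s"
      then obtain D where D: "D division_of {0..s}" "x = V D" by (auto simp: S_def)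
      obtain E where E: "E division_of {0..t}" "V E = V D + norm (\<gamma> t - \<gamma> s)"
        using extend[OF D(1) st(1) lt] by blast
      have "bdd_above (S t)" using bdd[of _ t] st by (auto simp: S_def intro!: bdd_aboveI[of _ M])
      then have "V E \<le> Sup (S t)" using E(1) by (intro cSup_upper) (auto simp: S_def)
      then show "x \<le> Sup (S t) - norm (\<gamma> t - \<gamma> s)" using D E by simp
    qed
    then show ?thesis by simp
  qed auto
  show ?thesis
    by (rule that[of "\<lambda>t. Sup (S t) - Sup (S 0)"]) (use main in auto)
qed

text \<open>In the factorisation of \<open>y ^ Suc n - x ^ Suc n\<close> by \<open>y - x\<close>
  each of the n + 1 summands is at least \<open>x ^ n\<close>. Applied to values of
  \<open>\<omega>\<close>, this integrates one factorial bound to the next with tags at left end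
  points.\<close>

lemma power_Suc_increment:
  fixes x y :: real
  assumes "0 \<le> x" "x \<le> y"
  shows "x ^ n / fact n * (y - x) \<le> y ^ Suc n / fact (Suc n) - x ^ Suc n / fact (Suc n)"
proof -
  have "real (Suc n) * x ^ n * (y - x) \<le> y ^ Suc n - x ^ Suc n"
  proof -
    have "real (Suc n) * x ^ n = (\<Sum>i<Suc n. x ^ n)" by simp
    also have "\<dots> \<le> (\<Sum>i<Suc n. x ^ (Suc n - Suc i) * y ^ i)"
    proof (rule sum_mono)
      fix i assume "i \<in> {..<Suc n}"
      then have "x ^ n = x ^ (Suc n - Suc i) * x ^ i" by (simp flip: power_add)
      also have "\<dots> \<le> x ^ (Suc n - Suc i) * y ^ i" using assms by (intro mult_left_mono power_mono) auto
      finally show "x ^ n \<le> x ^ (Suc n - Suc i) * y ^ i" .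
    qed
    finally show ?thesis
      unfolding power_diff_sumr2 using assms by (simp only: mult.commute[of "y - x"]) (simp add: mult_right_mono)
  qed
  then have "real (Suc n) * x ^ n * (y - x) / fact (Suc n) \<le> (y ^ Suc n - x ^ Suc n) / fact (Suc n)"
    by (rule divide_right_mono) simp
  moreover have "real (Suc n) * x ^ n * (y - x) / fact (Suc n) = x ^ n / fact n * (y - x)"
    unfolding fact_Suc mult.assoc by (simp del: of_nat_Suc)
  ultimately show ?thesis by (simp only: diff_divide_distrib)
qed

locale bv_path =
  fixes \<gamma> :: "real \<Rightarrow> 'v::real_normed_vector" and T :: real and \<omega> :: "real \<Rightarrow> real"
  assumes T: "0 \<le> T" and cont: "continuous_on {0..T} \<gamma>" and \<omega>0: "\<omega> 0 = 0"
    and \<omega>: "0 \<le> s \<Longrightarrow> s \<le> t \<Longrightarrow> t \<le> T \<Longrightarrow> norm (\<gamma> t - \<gamma> s) \<le> \<omega> t - \<omega> s"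
begin

lemma \<omega>_mono: "0 \<le> s \<Longrightarrow> s \<le> t \<Longrightarrow> t \<le> T \<Longrightarrow> \<omega> s \<le> \<omega> t"
  using \<omega>[of s t] norm_ge_zero[of "\<gamma> t - \<gamma> s"] by linarith

lemma \<omega>_nonneg: "0 \<le> t \<Longrightarrow> t \<le> T \<Longrightarrow> 0 \<le> \<omega> t"
  using \<omega>_mono[of 0 t] \<omega>0 by simp

lemma coordinate_increment:
  assumes "0 \<le> s" "s \<le> t" "t \<le> T"
  shows "\<bar>blinfun_apply \<xi> (\<gamma> t) - blinfun_apply \<xi> (\<gamma> s)\<bar> \<le> norm \<xi> * (\<omega> t - \<omega> s)"
proof -
  have "\<bar>blinfun_apply \<xi> (\<gamma> t) - blinfun_apply \<xi> (\<gamma> s)\<bar> \<le> norm \<xi> * norm (\<gamma> t - \<gamma> s)"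
    using norm_blinfun[of \<xi> "\<gamma> t - \<gamma> s"] by (simp add: blinfun.diff_right)
  also have "\<dots> \<le> norm \<xi> * (\<omega> t - \<omega> s)" using \<omega>[OF assms] by (rule mult_left_mono) simp
  finally show ?thesis .
qed

lemma dominated_coordinate:
  assumes "t \<le> T"
  shows "dominated_on (\<lambda>s. blinfun_apply \<xi> (\<gamma> s)) (\<lambda>s. norm \<xi> * \<omega> s) 0 t"
  using assms coordinate_increment[of _ _ \<xi>] by (auto simp: dominated_on_def right_diff_distrib)

lemma continuous_coordinate: "continuous_on {0..T} (\<lambda>s. blinfun_apply \<xi> (\<gamma> s))"
  using cont by (intro continuous_intros)

lemma continuous_iterated_integral: "continuous_on {0..T} (iterated_integral \<gamma> \<xi>s)"
proof (induction \<xi>s)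
  case (Cons \<xi> \<xi>s)
  have "continuous_on {0..T} (RS_integral (iterated_integral \<gamma> \<xi>s) (\<lambda>s. blinfun_apply \<xi> (\<gamma> s)) 0)"
    by (rule continuous_on_RS_integral[OF dominated_coordinate[OF order_refl] continuous_coordinate Cons])
  moreover have "iterated_integral \<gamma> (\<xi> # \<xi>s) =
      RS_integral (iterated_integral \<gamma> \<xi>s) (\<lambda>s. blinfun_apply \<xi> (\<gamma> s)) 0"
    by (rule ext) simp
  ultimately show ?case by (simp only:)
qed (simp add: fun_eq_iff[symmetric])

lemma continuous_iterated_integral': "t \<le> T \<Longrightarrow> continuous_on {0..t} (iterated_integral \<gamma> \<xi>s)"
  by (rule continuous_on_subset[OF continuous_iterated_integral]) auto

text \<open>With \<open>\<omega>\<close> as the clock, the factor after the norms is the volume of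
  the simplex. In the induction \<open>?H\<close> is the primitive of the bound for the tail, and
  \<open>\<omega> 0 = 0\<close> removes its lower end.\<close>

lemma iterated_integral_bound:
  assumes "0 \<le> t" "t \<le> T"
  shows "\<bar>iterated_integral \<gamma> \<xi>s t\<bar> \<le> prod_list (map norm \<xi>s) * (\<omega> t ^ length \<xi>s / fact (length \<xi>s))"
  using assms
proof (induction \<xi>s arbitrary: t)
  case (Cons \<xi> \<xi>s)
  let ?n = "length \<xi>s"
  let ?P = "prod_list (map norm \<xi>s)"
  let ?H = "\<lambda>s. norm \<xi> * ?P * (\<omega> s ^ Suc ?n / fact (Suc ?n))"
  have P: "?P \<ge> 0" by (rule prod_list_nonneg) auto
  have "\<bar>iterated_integral \<gamma> (\<xi> # \<xi>s) t\<bar> \<le> ?H t - ?H 0"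
    unfolding iterated_integral.simps
  proof (rule RS_integral_bound[OF dominated_coordinate[OF Cons.prems(2)] Cons.prems(1)
          continuous_iterated_integral'[OF Cons.prems(2)]])
    fix r s assume rs: "0 \<le> r" "r \<le> s" "s \<le> t"
    then have T: "r \<le> T" "s \<le> T" using Cons.prems by auto
    have "\<bar>iterated_integral \<gamma> \<xi>s r * (blinfun_apply \<xi> (\<gamma> s) - blinfun_apply \<xi> (\<gamma> r))\<bar>
        \<le> (?P * (\<omega> r ^ ?n / fact ?n)) * (norm \<xi> * (\<omega> s - \<omega> r))"
      unfolding abs_mult using rs T Cons.IH[of r] coordinate_increment[of r s \<xi>] P \<omega>_nonneg[of r]
      by (intro mult_mono) auto
    also have "\<dots> = norm \<xi> * ?P * (\<omega> r ^ ?n / fact ?n * (\<omega> s - \<omega> r))" by (simp add: mult_ac)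
    also have "\<dots> \<le> norm \<xi> * ?P * (\<omega> s ^ Suc ?n / fact (Suc ?n) - \<omega> r ^ Suc ?n / fact (Suc ?n))"
      using power_Suc_increment[OF \<omega>_nonneg[of r] \<omega>_mono[of r s], of ?n] rs T P by (intro mult_left_mono) auto
    also have "\<dots> = ?H s - ?H r" by (simp add: right_diff_distrib)
    finally show "\<bar>iterated_integral \<gamma> \<xi>s r * (blinfun_apply \<xi> (\<gamma> s) - blinfun_apply \<xi> (\<gamma> r))\<bar> \<le> ?H s - ?H r" .
  qed
  then show ?case by (simp add: \<omega>0)
qed simp

text \<open>A letter at the head of the list is the integrator, a letter further down is hidden in
  the integrand; the induction therefore uses linearity in both variables of the integral.\<close>

lemma iterated_integral_linear:
  assumes "0 \<le> t" "t \<le> T"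
  shows "iterated_integral \<gamma> (\<xi>s @ (c *\<^sub>R \<xi> + d *\<^sub>R \<eta>) # \<eta>s) t =
    c * iterated_integral \<gamma> (\<xi>s @ \<xi> # \<eta>s) t + d * iterated_integral \<gamma> (\<xi>s @ \<eta> # \<eta>s) t"
  using assms
proof (induction \<xi>s arbitrary: t)
  case Nil
  show ?case
    using RS_integral_linear_integrator[OF dominated_coordinate[of t \<xi>] dominated_coordinate[of t \<eta>],
        of "iterated_integral \<gamma> \<eta>s" c d] Nil
    by (simp add: continuous_iterated_integral' blinfun.add_left blinfun.scaleR_left)
next
  case (Cons \<zeta> \<zeta>s)
  let ?f = "\<lambda>s. c * iterated_integral \<gamma> (\<zeta>s @ \<xi> # \<eta>s) s + d * iterated_integral \<gamma> (\<zeta>s @ \<eta> # \<eta>s) s"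
  \<comment> \<open>The induction hypothesis concerns times in \<open>{0..T}\<close> only, so the
    integrands are known to agree only on \<open>{0..t}\<close>. All tags lie there; hence the
    defining predicates coincide, and with them the values selected by \<open>THE\<close>.\<close>
  have cong: "RS_integral f g 0 t = RS_integral f' g 0 t"
    if "\<And>s. s \<in> {0..t} \<Longrightarrow> f s = f' s" for f f' g :: "real \<Rightarrow> real"
  proof -
    have "RS_sum f g D = RS_sum f' g D" if D: "D tagged_division_of {0..t}" for D
      unfolding RS_sum_def
    proof (rule sum.cong[OF refl], clarify)
      fix x K assume "(x, K) \<in> D"
      then have "x \<in> {0..t}" using tag_in_interval[OF D] by blast
      then show "f x * (g (Sup K) - g (Inf K)) = f' x * (g (Sup K) - g (Inf K))" using \<open>\<And>s. _ \<Longrightarrow> f s = f' s\<close> by simp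
    qed
    then have "has_RS_integral f g 0 t = has_RS_integral f' g 0 t"
      by (intro ext) (simp add: has_RS_integral_iff cong: conj_cong imp_cong)
    then show ?thesis by (simp add: RS_integral_def)
  qed
  have "iterated_integral \<gamma> ((\<zeta> # \<zeta>s) @ (c *\<^sub>R \<xi> + d *\<^sub>R \<eta>) # \<eta>s) t =
      RS_integral ?f (\<lambda>s. blinfun_apply \<zeta> (\<gamma> s)) 0 t"
    using Cons by (simp, intro cong) auto
  also have "\<dots> = c * iterated_integral \<gamma> ((\<zeta> # \<zeta>s) @ \<xi> # \<eta>s) t + d * iterated_integral \<gamma> ((\<zeta> # \<zeta>s) @ \<eta> # \<eta>s) t"
    using RS_integral_linear_integrand[OF dominated_coordinate[of t \<zeta>]] Cons.prems
    by (simp add: continuous_iterated_integral')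
  finally show ?case .
qed

end

section \<open>Multilinearity of tensor series\<close>

definition multilinear :: "('v::real_normed_vector, real) tseries \<Rightarrow> bool" where
  "multilinear f \<longleftrightarrow> (\<forall>\<xi>s \<eta>s. linear (\<lambda>\<xi>. f (\<xi>s @ \<xi> # \<eta>s)))"

lemma (in bv_path) multilinear_signature: "multilinear (signature \<gamma> T)"
  unfolding multilinear_def signature_def
proof (intro allI linearI)
  fix \<xi>s \<eta>s :: "('v \<Rightarrow>\<^sub>L real) list" and \<xi> \<eta> :: "'v \<Rightarrow>\<^sub>L real" and c
  show "iterated_integral \<gamma> (rev (\<xi>s @ (\<xi> + \<eta>) # \<eta>s)) T =
      iterated_integral \<gamma> (rev (\<xi>s @ \<xi> # \<eta>s)) T + iterated_integral \<gamma> (rev (\<xi>s @ \<eta> # \<eta>s)) T"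
    using iterated_integral_linear[OF T order_refl, of "rev \<eta>s" 1 \<xi> 1 \<eta> "rev \<xi>s"] by simp
  show "iterated_integral \<gamma> (rev (\<xi>s @ (c *\<^sub>R \<xi>) # \<eta>s)) T = c *\<^sub>R iterated_integral \<gamma> (rev (\<xi>s @ \<xi> # \<eta>s)) T"
    using iterated_integral_linear[OF T order_refl, of "rev \<eta>s" c \<xi> 0 0 "rev \<xi>s"] by simp
qed

lemma (in bv_path) signature_bound:
  "\<bar>signature \<gamma> T \<xi>s\<bar> \<le> prod_list (map norm \<xi>s) * (\<omega> T ^ length \<xi>s / fact (length \<xi>s))"
proof -
  have "prod_list (map norm (rev \<xi>s)) = prod_list (map norm \<xi>s)" by (metis rev_map prod_list.rev)
  then show ?thesis using iterated_integral_bound[OF T order_refl, of "rev \<xi>s"] by (simp add: signature_def)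
qed

text \<open>Cutting the word at k leaves the distinguished letter in exactly one of the two factors,
  and that factor alone depends on it.\<close>

lemma multilinear_tseries_mult:
  assumes "multilinear a" "multilinear b"
  shows "multilinear (tseries_mult a b)"
  unfolding multilinear_def tseries_mult_def
proof (intro allI)
  fix \<xi>s \<eta>s :: "('a \<Rightarrow>\<^sub>L real) list"
  have "linear (\<lambda>\<xi>. a (take k (\<xi>s @ \<xi> # \<eta>s)) * b (drop k (\<xi>s @ \<xi> # \<eta>s)))" for k
  proof (cases "k \<le> length \<xi>s")
    case True
    then have "linear (\<lambda>\<xi>. b (drop k \<xi>s @ \<xi> # \<eta>s))" using assms by (simp add: multilinear_def)
    with True show ?thesis by (simp add: linear_iff distrib_left)
  next
    case False
    then obtain m where m: "k - length \<xi>s = Suc m" by (metis diff_is_0_eq not0_implies_Suc)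
    have "linear (\<lambda>\<xi>. a (\<xi>s @ \<xi> # take m \<eta>s))" using assms by (simp add: multilinear_def)
    with False m show ?thesis by (simp add: linear_iff distrib_right)
  qed
  then show "linear (\<lambda>\<xi>. \<Sum>k\<le>length (\<xi>s @ \<xi> # \<eta>s). a (take k (\<xi>s @ \<xi> # \<eta>s)) * b (drop k (\<xi>s @ \<xi> # \<eta>s)))"
    by (simp only: length_append list.size) (intro linear_compose_sum ballI)
qed

lemma multilinear_tseries_one: "multilinear tseries_one"
  by (simp add: multilinear_def tseries_one_def linear_iff)

lemma multilinear_tseries_power: "multilinear a \<Longrightarrow> multilinear (tseries_power a k)"
  by (induction k) (auto simp: multilinear_tseries_one multilinear_tseries_mult)

lemma multilinear_tseries_log:
  assumes "multilinear g"
  shows "multilinear (tseries_log g)"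
  unfolding multilinear_def tseries_log_def
proof (intro allI)
  fix \<xi>s \<eta>s :: "('a \<Rightarrow>\<^sub>L real) list"
  have "multilinear (\<lambda>\<eta>s. g \<eta>s - tseries_one \<eta>s)"
    using assms by (simp add: multilinear_def linear_iff tseries_one_def right_diff_distrib)
  then have "linear (\<lambda>\<xi>. tseries_power (\<lambda>\<eta>s. g \<eta>s - tseries_one \<eta>s) k (\<xi>s @ \<xi> # \<eta>s))" for k
    by (drule_tac k = k in multilinear_tseries_power) (simp add: multilinear_def)
  then have "linear (\<lambda>\<xi>. c * tseries_power (\<lambda>\<eta>s. g \<eta>s - tseries_one \<eta>s) k (\<xi>s @ \<xi> # \<eta>s))" for k c
    by (simp add: linear_iff distrib_left)
  then show "linear (\<lambda>\<xi>. \<Sum>k = 1..length (\<xi>s @ \<xi> # \<eta>s). (- 1) ^ (k + 1) / real k *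
      tseries_power (\<lambda>\<eta>s. g \<eta>s - tseries_one \<eta>s) k (\<xi>s @ \<xi> # \<eta>s))"
    by (simp only: length_append list.size) (intro linear_compose_sum ballI)
qed

lemma component_in_tensor_power:
  assumes "multilinear f"
  shows "component n f \<in> tensor_power n"
proof -
  have "linear (\<lambda>\<xi>. complex_of_real (f (\<xi>s[i := \<xi>])))" if "i < length \<xi>s" for i \<xi>s
    using assms unfolding multilinear_def
    by (simp add: upd_conv_take_nth_drop[OF that] linear_iff scaleR_conv_of_real)
  then show ?thesis by (auto simp: tensor_power_def component_def)
qed

section \<open>Exponential of the logarithm\<close>

lemma fps_power_nth_below:
  fixes X :: "'b::ring_1 fps"
  assumes "fps_nth X 0 = 0" "n < j"
  shows "fps_nth (X ^ j) n = 0"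
  using assms(2)
proof (induction j arbitrary: n)
  case (Suc j)
  have "fps_nth X i * fps_nth (X ^ j) (n - i) = 0" if "i \<le> n" for i
    using that Suc assms(1) by (cases "i = 0") auto
  then show ?case by (auto simp: fps_mult_nth intro: sum.neutral)
qed auto

text \<open>Coefficient n stops at j = n because X is meant to have no constant term. The
  coefficients of X may fail to commute, while those of \<open>a\<close> are real and hence
  central.\<close>

definition fps_subst :: "'b::real_algebra_1 fps \<Rightarrow> real fps \<Rightarrow> 'b fps" where
  "fps_subst X a = Abs_fps (\<lambda>n. \<Sum>j\<le>n. fps_nth a j *\<^sub>R fps_nth (X ^ j) n)"

lemma fps_subst_nth:
  assumes "fps_nth X 0 = 0" "n \<le> N"
  shows "fps_nth (fps_subst X a) n = (\<Sum>j\<le>N. fps_nth a j *\<^sub>R fps_nth (X ^ j) n)"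
  unfolding fps_subst_def fps_nth_Abs_fps
  using assms fps_power_nth_below[OF assms(1)] by (intro sum.mono_neutral_left) auto

lemma fps_subst_one: "fps_subst X 1 = 1"
  by (auto simp: fps_subst_def fps_eq_iff fps_one_nth if_distrib[of "\<lambda>c. c *\<^sub>R _"] sum.delta' cong: if_cong)

text \<open>Only powers of the single element X and central scalars occur, so the Cauchy product
  goes through in a noncommutative algebra. Indices with i + k > n drop out because
  \<open>X ^ (i + k)\<close> starts in degree i + k.\<close>

lemma fps_subst_mult:
  assumes "fps_nth X 0 = 0"
  shows "fps_subst X (a * b) = fps_subst X a * fps_subst X b"
proof (rule fps_ext)
  fix n
  let ?a = "fps_nth a" and ?b = "fps_nth b" and ?X = "\<lambda>j. fps_nth (X ^ j)"
  have "fps_nth (fps_subst X a * fps_subst X b) n =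
      (\<Sum>p\<le>n. (\<Sum>i\<le>n. ?a i *\<^sub>R ?X i p) * (\<Sum>k\<le>n. ?b k *\<^sub>R ?X k (n - p)))"
    unfolding fps_mult_nth atLeast0AtMost
    by (intro sum.cong refl arg_cong2[where f = "(*)"] fps_subst_nth[OF assms]) auto
  also have "\<dots> = (\<Sum>p\<le>n. \<Sum>i\<le>n. \<Sum>k\<le>n. (?a i * ?b k) *\<^sub>R (?X i p * ?X k (n - p)))"
    by (simp add: sum_product mult.commute)
  also have "\<dots> = (\<Sum>i\<le>n. \<Sum>k\<le>n. \<Sum>p\<le>n. (?a i * ?b k) *\<^sub>R (?X i p * ?X k (n - p)))"
    by (subst sum.swap, rule sum.cong, simp, subst sum.swap, simp)
  also have "\<dots> = (\<Sum>i\<le>n. \<Sum>k\<le>n. (?a i * ?b k) *\<^sub>R ?X (i + k) n)"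
    by (simp add: power_add fps_mult_nth atLeast0AtMost scaleR_sum_right)
  also have "\<dots> = (\<Sum>(i, k)\<in>{..n} \<times> {..n}. (?a i * ?b k) *\<^sub>R ?X (i + k) n)"
    by (simp add: sum.cartesian_product)
  also have "\<dots> = (\<Sum>(i, k)\<in>{(i, k). i + k \<le> n}. (?a i * ?b k) *\<^sub>R ?X (i + k) n)"
  proof (rule sum.mono_neutral_right)
    show "\<forall>p\<in>{..n} \<times> {..n} - {(i, k). i + k \<le> n}. (case p of (i, k) \<Rightarrow> (?a i * ?b k) *\<^sub>R ?X (i + k) n) = 0"
      by auto (metis fps_power_nth_below[OF assms] not_le)
  qed auto
  also have "\<dots> = (\<Sum>j\<le>n. \<Sum>i\<le>j. (?a i * ?b (j - i)) *\<^sub>R ?X (i + (j - i)) n)"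
    by (rule sum.triangle_reindex_eq)
  also have "\<dots> = fps_nth (fps_subst X (a * b)) n"
    by (simp add: fps_subst_def fps_mult_nth atLeast0AtMost scaleR_sum_left)
  finally show "fps_nth (fps_subst X (a * b)) n = fps_nth (fps_subst X a * fps_subst X b) n" by simp
qed

lemma fps_subst_power: "fps_nth X 0 = 0 \<Longrightarrow> fps_subst X (a ^ m) = fps_subst X a ^ m"
  by (induction m) (auto simp: fps_subst_one fps_subst_mult)

text \<open>These are the coefficients of exp (ln (1 + x)) = 1 + x over the reals, where the two
  series are compositional inverses. Being relations between numbers, they carry over to every real
  algebra.\<close>

lemma sum_fps_ln_power:
  "(\<Sum>m\<le>j. fps_nth (fps_ln 1 ^ m) j / fact m) = (if j \<le> 1 then 1 else (0::real))"
proof -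
  have "(fps_exp 1 - 1) oo fps_ln 1 = (fps_X :: real fps)"
    by (subst fps_ln_fps_exp_inv, simp, rule fps_inv_right) auto
  then have "fps_exp 1 oo fps_ln 1 = (1 + fps_X :: real fps)"
    by (simp add: fps_compose_sub_distrib algebra_simps)
  then have "fps_nth (fps_exp 1 oo fps_ln 1) j = fps_nth (1 + fps_X :: real fps) j" by simp
  then show ?thesis by (auto simp: fps_compose_nth atLeast0AtMost fps_X_def split: if_splits)
qed

text \<open>Exchanging the two finite sums isolates, for each power of X, a purely numerical
  coefficient given by \<open>sum_fps_ln_power\<close>; only the powers 0 and 1 survive.\<close>

lemma sum_power_fps_subst_ln:
  assumes X: "fps_nth X 0 = 0"
  shows "(\<Sum>m\<le>n. fps_nth (fps_subst X (fps_ln 1) ^ m) n /\<^sub>R fact m) = fps_nth (1 + X) n"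
proof -
  have "(\<Sum>m\<le>n. fps_nth (fps_subst X (fps_ln 1) ^ m) n /\<^sub>R fact m) =
      (\<Sum>m\<le>n. \<Sum>j\<le>n. (fps_nth (fps_ln 1 ^ m) j / fact m) *\<^sub>R fps_nth (X ^ j) n)"
    unfolding fps_subst_power[OF X, symmetric]
    by (simp add: fps_subst_def scaleR_sum_right divide_inverse mult.commute)
  also have "\<dots> = (\<Sum>j\<le>n. (\<Sum>m\<le>n. fps_nth (fps_ln 1 ^ m) j / fact m) *\<^sub>R fps_nth (X ^ j) n)"
    by (subst sum.swap) (simp add: scaleR_sum_left)
  also have "\<dots> = (\<Sum>j\<le>n. (if j \<le> 1 then 1 else 0) *\<^sub>R fps_nth (X ^ j) n)"
  proof (rule sum.cong, simp)
    fix j assume "j \<in> {..n}"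
    then have "(\<Sum>m\<le>n. fps_nth (fps_ln 1 ^ m) j / fact m) = (\<Sum>m\<le>j. fps_nth (fps_ln 1 ^ m) j / fact m :: real)"
      by (intro sum.mono_neutral_right) (auto simp: fps_power_nth_below)
    then show "(\<Sum>m\<le>n. fps_nth (fps_ln 1 ^ m) j / fact m) *\<^sub>R fps_nth (X ^ j) n =
        (if j \<le> 1 then 1 else 0) *\<^sub>R fps_nth (X ^ j) n"
      by (simp only: sum_fps_ln_power)
  qed
  also have "\<dots> = (\<Sum>j\<in>{..n} \<inter> {..1}. fps_nth (X ^ j) n)"
    unfolding sum.inter_restrict[OF finite_atMost] by (rule sum.cong) auto
  also have "\<dots> = fps_nth (1 + X) n"
  proof (cases n)
    case 0
    then have "{..n} \<inter> {..1} = {0}" by auto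
    then show ?thesis using 0 X by simp
  next
    case (Suc m)
    then have "{..n} \<inter> {..1} = {0, 1}" by auto
    then show ?thesis by simp
  qed
  finally show ?thesis .
qed

section \<open>Majorants and the exponential of a convergent series\<close>

lemma fps_power_nonneg_sums:
  fixes N :: "real fps"
  assumes "\<And>n. fps_nth N n \<ge> 0" "fps_nth N sums s"
  shows "fps_nth (N ^ m) n \<ge> 0" "fps_nth (N ^ m) sums s ^ m"
proof -
  have "(\<forall>n. fps_nth (N ^ m) n \<ge> 0) \<and> fps_nth (N ^ m) sums s ^ m"
  proof (induction m)
    case 0
    have "fps_nth (1 :: real fps) = (\<lambda>n. if n = 0 then 1 else 0)" by (auto simp: fps_one_nth)
    then show ?case using sums_single[of 0 "\<lambda>_. 1::real"] by simp
  next
    case (Suc m)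
    have abs: "(\<lambda>n. norm (fps_nth N n)) = fps_nth N" "(\<lambda>n. norm (fps_nth (N ^ m) n)) = fps_nth (N ^ m)"
      using Suc assms(1) by auto
    have sm: "summable (fps_nth N)" "summable (fps_nth (N ^ m))" using assms(2) Suc sums_summable by blast+
    have "(\<lambda>k. \<Sum>i\<le>k. fps_nth N i * fps_nth (N ^ m) (k - i)) sums ((\<Sum>n. fps_nth N n) * (\<Sum>n. fps_nth (N ^ m) n))"
      by (rule Cauchy_product_sums) (simp_all only: abs sm)
    moreover have "(\<lambda>k. \<Sum>i\<le>k. fps_nth N i * fps_nth (N ^ m) (k - i)) = fps_nth (N ^ Suc m)"
      by (rule ext) (simp add: fps_mult_nth atLeast0AtMost)
    moreover have "(\<Sum>n. fps_nth N n) * (\<Sum>n. fps_nth (N ^ m) n) = s ^ Suc m"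
      using assms(2) Suc by (metis sums_unique power_Suc)
    moreover have "fps_nth (N ^ Suc m) n \<ge> 0" for n
      using assms(1) Suc by (auto simp: fps_mult_nth intro!: sum_nonneg mult_nonneg_nonneg)
    ultimately show ?case by simp
  qed
  then show "fps_nth (N ^ m) n \<ge> 0" "fps_nth (N ^ m) sums s ^ m" by auto
qed

text \<open>The method of majorants: L is replaced by the real series of its norms, to which
  \<open>fps_power_nonneg_sums\<close> applies.\<close>

lemma norm_fps_power_le:
  fixes L :: "'b::real_normed_algebra_1 fps"
  shows "norm (fps_nth (L ^ m) n) \<le> fps_nth (Abs_fps (\<lambda>n. norm (fps_nth L n)) ^ m) n"
proof (induction m arbitrary: n)
  case (Suc m)
  have "norm (fps_nth (L ^ Suc m) n) \<le> (\<Sum>i=0..n. norm (fps_nth L i) * norm (fps_nth (L ^ m) (n - i)))"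
    by (simp add: fps_mult_nth) (intro order_trans[OF norm_sum] sum_mono norm_mult_ineq)
  also have "\<dots> \<le> fps_nth (Abs_fps (\<lambda>n. norm (fps_nth L n)) ^ Suc m) n"
    by (simp add: fps_mult_nth) (intro sum_mono mult_left_mono Suc norm_ge_zero)
  finally show ?case .
qed (simp add: fps_one_nth)

lemma fps_power_sums:
  fixes L :: "'b::{real_normed_algebra_1,banach} fps"
  assumes "summable (\<lambda>n. norm (fps_nth L n))"
  shows "summable (\<lambda>n. norm (fps_nth (L ^ m) n))"
    "(\<Sum>n. norm (fps_nth (L ^ m) n)) \<le> (\<Sum>n. norm (fps_nth L n)) ^ m"
    "fps_nth (L ^ m) sums (\<Sum>n. fps_nth L n) ^ m"
proof -
  let ?N = "Abs_fps (\<lambda>n. norm (fps_nth L n))"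
  have N: "fps_nth (?N ^ m) sums (\<Sum>n. norm (fps_nth L n)) ^ m" for m
    using summable_sums[OF assms] by (intro fps_power_nonneg_sums) (simp_all add: Abs_fps_inverse)
  show sm: "summable (\<lambda>n. norm (fps_nth (L ^ m) n))" for m
    by (rule summable_comparison_test'[OF sums_summable[OF N[of m]], of 0]) (simp add: norm_fps_power_le)
  show "(\<Sum>n. norm (fps_nth (L ^ m) n)) \<le> (\<Sum>n. norm (fps_nth L n)) ^ m"
    using suminf_le[OF norm_fps_power_le sm sums_summable[OF N]] sums_unique[OF N[of m]] by simp
  show "fps_nth (L ^ m) sums (\<Sum>n. fps_nth L n) ^ m"
  proof (induction m)
    case 0
    have "fps_nth (1 :: 'b fps) = (\<lambda>n. if n = 0 then 1 else 0)" by (auto simp: fps_one_nth)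
    then show ?case using sums_single[of 0 "\<lambda>_. 1::'b"] by simp
  next
    case (Suc m)
    have "(\<lambda>k. \<Sum>i\<le>k. fps_nth L i * fps_nth (L ^ m) (k - i)) sums ((\<Sum>n. fps_nth L n) * (\<Sum>n. fps_nth (L ^ m) n))"
      by (rule Cauchy_product_sums[OF assms sm])
    then show ?case using Suc by (simp add: fps_mult_nth atLeast0AtMost sums_iff)
  qed
qed

text \<open>The double series \<open>c m n\<close> is regrouped by degree n instead of power m. Its
  rows have absolute sum at most \<open>s ^ m / fact m\<close>, so it converges absolutely; its
  columns are finite because \<open>L ^ m\<close> starts in degree m.\<close>

lemma exp_suminf_fps:
  fixes L :: "'b::{real_normed_algebra_1,banach} fps"
  assumes L0: "fps_nth L 0 = 0" and sm: "summable (\<lambda>n. norm (fps_nth L n))"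
  shows "(\<lambda>n. \<Sum>m\<le>n. fps_nth (L ^ m) n /\<^sub>R fact m) sums exp (\<Sum>n. fps_nth L n)"
proof -
  define c where "c m n = fps_nth (L ^ m) n /\<^sub>R fact m" for m n
  define s where "s = (\<Sum>n. norm (fps_nth L n))"
  have c_sm: "summable (\<lambda>n. norm (c m n))" for m
    using fps_power_sums(1)[OF sm, of m] by (simp add: c_def summable_mult)
  have c_le: "(\<Sum>n. norm (c m n)) \<le> s ^ m / fact m" for m
    using fps_power_sums(2)[OF sm, of m] fps_power_sums(1)[OF sm, of m]
    by (simp add: c_def s_def suminf_mult divide_inverse mult.commute)
  have c_sums: "c m sums ((\<Sum>n. fps_nth L n) ^ m /\<^sub>R fact m)" for m
    using sums_scaleR_right[OF fps_power_sums(3)[OF sm, of m]] by (simp add: c_def[abs_def])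
  have "(\<lambda>(m, n). c m n) abs_summable_on UNIV \<times> UNIV"
  proof (rule Infinite_Sum.abs_summable_on_Sigma_iff[where f = "\<lambda>(m, n). c m n", THEN iffD2], intro conjI ballI)
    show "(\<lambda>n. case (m, n) of (m, n) \<Rightarrow> c m n) abs_summable_on UNIV" for m
      using norm_summable_imp_summable_on[of "\<lambda>n. norm (c m n)"] c_sm by simp
    have "(\<lambda>m. infsum (\<lambda>n. norm (c m n)) UNIV) summable_on UNIV"
    proof (rule norm_summable_imp_summable_on, rule summable_comparison_test')
      show "summable (\<lambda>m. s ^ m / fact m)"
        using summable_exp_generic[of s] by (simp add: divide_inverse mult.commute)
      show "norm (norm (infsum (\<lambda>n. norm (c m n)) UNIV)) \<le> s ^ m / fact m" for m
      proof -
        have "infsum (\<lambda>n. norm (c m n)) UNIV = (\<Sum>n. norm (c m n))"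
          using c_sm[of m] by (intro infsumI norm_summable_imp_has_sum) (auto intro: summable_sums)
        then show ?thesis using c_le[of m] by (simp add: suminf_nonneg[OF c_sm])
      qed
    qed
    then show "(\<lambda>m. norm (\<Sum>\<^sub>\<infinity>n. norm (case (m, n) of (m, n) \<Rightarrow> c m n))) summable_on UNIV"
      by (simp add: infsum_nonneg)
  qed
  then have abs: "(\<lambda>(m, n). c m n) summable_on UNIV \<times> UNIV" by (rule abs_summable_summable)
  have row: "(\<Sum>\<^sub>\<infinity>n. c m n) = (\<Sum>n. fps_nth L n) ^ m /\<^sub>R fact m" for m
    by (rule infsumI norm_summable_imp_has_sum c_sm c_sums)+
  have col: "(\<Sum>\<^sub>\<infinity>m. c m n) = (\<Sum>m\<le>n. c m n)" for n
  proof -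
    have "c m n = 0" if "m \<notin> {..n}" for m
      using that fps_power_nth_below[OF L0] by (simp add: c_def)
    then have "(\<Sum>\<^sub>\<infinity>m. c m n) = (\<Sum>\<^sub>\<infinity>m\<in>{..n}. c m n)" by (intro infsum_cong_neutral) auto
    then show ?thesis by simp
  qed
  have "(\<Sum>\<^sub>\<infinity>m. \<Sum>\<^sub>\<infinity>n. c m n) = exp (\<Sum>n. fps_nth L n)"
    unfolding row by (rule infsumI norm_summable_imp_has_sum summable_norm_exp exp_converges)+
  then have "(\<Sum>\<^sub>\<infinity>n. \<Sum>\<^sub>\<infinity>m. c m n) = exp (\<Sum>n. fps_nth L n)"
    using infsum_swap_banach[OF abs] by simp
  moreover have "(\<lambda>n. \<Sum>\<^sub>\<infinity>m. c m n) summable_on UNIV"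
  proof -
    have "(\<lambda>(n, m). c m n) summable_on UNIV \<times> UNIV"
      using abs by (subst (asm) summable_on_swap) simp
    from summable_on_Sigma_banach[OF this] show ?thesis by simp
  qed
  ultimately have "((\<lambda>n. \<Sum>m\<le>n. c m n) has_sum exp (\<Sum>n. fps_nth L n)) UNIV"
    unfolding col by (metis has_sum_infsum)
  then show ?thesis unfolding c_def by (rule has_sum_imp_sums)
qed

section \<open>Evaluation of tensor series on words in a basis\<close>

lemma sum_words_add:
  assumes "finite B"
  shows "(\<Sum>bs\<in>words_over B (k + m). f bs) = (\<Sum>us\<in>words_over B k. \<Sum>vs\<in>words_over B m. f (us @ vs))"
  by (induction k arbitrary: f) (simp_all add: words_0 sum_words_Suc[OF assms])

text \<open>When e gives the coordinates with respect to B, this is the algebra homomorphism that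
  sends a basis vector b to \<open>a b\<close>, with a grading variable recording the tensor
  degree.\<close>

definition word_eval :: "'a set \<Rightarrow> ('a \<Rightarrow> 'v::real_normed_vector \<Rightarrow>\<^sub>L real) \<Rightarrow> ('a \<Rightarrow> 'b::real_normed_algebra_1)
    \<Rightarrow> ('v, real) tseries \<Rightarrow> 'b fps" where
  "word_eval B e a t = Abs_fps (\<lambda>n. \<Sum>bs\<in>words_over B n. t (map e bs) *\<^sub>R prod_list (map a bs))"

lemma word_eval_one: "word_eval B e a tseries_one = 1"
proof (rule fps_ext)
  show "fps_nth (word_eval B e a tseries_one) n = fps_nth 1 n" for n
  proof (cases "n = 0")
    case True
    then show ?thesis by (simp add: word_eval_def words_0 tseries_one_def)
  next
    case False
    then show ?thesis by (auto simp: word_eval_def tseries_one_def words_over_def intro!: sum.neutral)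
  qed
qed

lemma word_eval_diff: "word_eval B e a (\<lambda>\<xi>s. s \<xi>s - t \<xi>s) = word_eval B e a s - word_eval B e a t"
  by (rule fps_ext) (simp add: word_eval_def scaleR_left_diff_distrib sum_subtractf)

text \<open>A word of length n with a cut at k is the same as a pair of words of lengths k and n -
  k; this turns the splitting of lists in \<open>tseries_mult\<close> into the Cauchy
  product.\<close>

lemma word_eval_mult:
  assumes "finite B"
  shows "word_eval B e a (tseries_mult s t) = word_eval B e a s * word_eval B e a t"
proof (rule fps_ext)
  fix n
  have "fps_nth (word_eval B e a (tseries_mult s t)) n = (\<Sum>bs\<in>words_over B n. \<Sum>k\<le>n.
      (s (map e (take k bs)) * t (map e (drop k bs))) *\<^sub>R (prod_list (map a (take k bs)) * prod_list (map a (drop k bs))))"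
    by (auto simp: word_eval_def tseries_mult_def words_over_def scaleR_sum_left take_map drop_map
        simp flip: prod_list.append map_append intro!: sum.cong)
  also have "\<dots> = (\<Sum>k\<le>n. \<Sum>bs\<in>words_over B (k + (n - k)).
      (s (map e (take k bs)) * t (map e (drop k bs))) *\<^sub>R (prod_list (map a (take k bs)) * prod_list (map a (drop k bs))))"
    by (subst sum.swap) simp
  also have "\<dots> = (\<Sum>k\<le>n. (\<Sum>us\<in>words_over B k. s (map e us) *\<^sub>R prod_list (map a us)) *
      (\<Sum>vs\<in>words_over B (n - k). t (map e vs) *\<^sub>R prod_list (map a vs)))"
    unfolding sum_words_add[OF assms] sum_product
    by (intro sum.cong refl) (auto simp: words_over_def mult.commute)
  also have "\<dots> = fps_nth (word_eval B e a s * word_eval B e a t) n"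
    by (simp add: word_eval_def fps_mult_nth atLeast0AtMost)
  finally show "fps_nth (word_eval B e a (tseries_mult s t)) n = fps_nth (word_eval B e a s * word_eval B e a t) n" .
qed

lemma word_eval_power: "finite B \<Longrightarrow> word_eval B e a (tseries_power t k) = word_eval B e a t ^ k"
  by (induction k) (simp_all add: word_eval_one word_eval_mult)

lemma word_eval_log:
  assumes "finite B"
  shows "word_eval B e a (tseries_log g) = fps_subst (word_eval B e a g - 1) (fps_ln 1)"
proof (rule fps_ext)
  fix n
  let ?h = "\<lambda>\<eta>s. g \<eta>s - tseries_one \<eta>s"
  have "fps_nth (word_eval B e a (tseries_log g)) n = (\<Sum>bs\<in>words_over B n. \<Sum>k=1..n.
      ((-1) ^ (k + 1) / real k) *\<^sub>R (tseries_power ?h k (map e bs) *\<^sub>R prod_list (map a bs)))"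
    by (auto simp: word_eval_def tseries_log_def words_over_def scaleR_sum_left intro!: sum.cong)
  also have "\<dots> = (\<Sum>k=1..n. ((-1) ^ (k + 1) / real k) *\<^sub>R fps_nth (word_eval B e a (tseries_power ?h k)) n)"
    by (subst sum.swap) (simp add: word_eval_def scaleR_sum_right)
  also have "\<dots> = (\<Sum>k=1..n. ((-1) ^ (k + 1) / real k) *\<^sub>R fps_nth ((word_eval B e a g - 1) ^ k) n)"
    by (simp only: word_eval_power[OF assms] word_eval_diff word_eval_one)
  also have "\<dots> = (\<Sum>k=1..n. fps_nth (fps_ln 1) k *\<^sub>R fps_nth ((word_eval B e a g - 1) ^ k) n)"
  proof (rule sum.cong, simp)
    fix k assume "k \<in> {1..n}"
    then obtain m where "k = Suc m" by (cases k) auto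
    then show "((-1) ^ (k + 1) / real k) *\<^sub>R fps_nth ((word_eval B e a g - 1) ^ k) n =
        fps_nth (fps_ln 1) k *\<^sub>R fps_nth ((word_eval B e a g - 1) ^ k) n"
      by (simp add: fps_ln_nth)
  qed
  \<comment> \<open>The index k = 0, present only on the right, carries the constant term of the
    logarithm, which is 0.\<close>
  also have "\<dots> = fps_nth (fps_subst (word_eval B e a g - 1) (fps_ln 1)) n"
    unfolding fps_subst_def fps_nth_Abs_fps by (rule sum.mono_neutral_left) (auto simp: not_le Suc_le_eq)
  finally show "fps_nth (word_eval B e a (tseries_log g)) n =
    fps_nth (fps_subst (word_eval B e a g - 1) (fps_ln 1)) n" .
qed

text \<open>Absolute convergence is assumed of the logarithm only; convergence of the series of g is
  read off from the exponential regrouped by degree.\<close>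

proposition exp_word_eval_log:
  fixes a :: "'a \<Rightarrow> 'b::{real_normed_algebra_1,banach}"
  assumes "finite B" "g [] = 1"
    and "summable (\<lambda>n. norm (fps_nth (word_eval B e a (tseries_log g)) n))"
  shows "fps_nth (word_eval B e a g) sums exp (\<Sum>n. fps_nth (word_eval B e a (tseries_log g)) n)"
proof -
  let ?X = "word_eval B e a g - 1"
  have X: "fps_nth ?X 0 = 0" using assms(2) by (simp add: word_eval_def words_0)
  have L: "word_eval B e a (tseries_log g) = fps_subst ?X (fps_ln 1)" by (rule word_eval_log[OF assms(1)])
  have "fps_nth (word_eval B e a (tseries_log g)) 0 = 0" unfolding L by (simp add: fps_subst_def)
  from exp_suminf_fps[OF this assms(3)] sum_power_fps_subst_ln[OF X] show ?thesis
    unfolding L by simp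
qed

section \<open>Matrices as a Banach algebra\<close>

text \<open>
  A copy of the bounded linear endomorphisms whose product is composition, so that powers and \<open>exp\<close>
  become available; on the matrix type itself \<open>*\<close> is the componentwise product.
\<close>

typedef (overloaded) 'a endo = "UNIV :: ('a::real_normed_vector \<Rightarrow>\<^sub>L 'a) set"
  by simp

setup_lifting type_definition_endo

instantiation endo :: (real_normed_vector) real_normed_vector
begin

lift_definition zero_endo :: "'a endo" is 0 .
lift_definition plus_endo :: "'a endo \<Rightarrow> 'a endo \<Rightarrow> 'a endo" is "(+)" .
lift_definition minus_endo :: "'a endo \<Rightarrow> 'a endo \<Rightarrow> 'a endo" is "(-)" .
lift_definition uminus_endo :: "'a endo \<Rightarrow> 'a endo" is uminus .
lift_definition scaleR_endo :: "real \<Rightarrow> 'a endo \<Rightarrow> 'a endo" is "(*\<^sub>R)" .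
lift_definition norm_endo :: "'a endo \<Rightarrow> real" is norm .
definition "dist (f :: 'a endo) g = norm (f - g)"
definition "sgn (f :: 'a endo) = inverse (norm f) *\<^sub>R f"
definition [code del]: "(uniformity :: ('a endo \<times> 'a endo) filter) = (INF e\<in>{0<..}. principal {(x, y). dist x y < e})"
definition [code del]: "open (S :: 'a endo set) \<longleftrightarrow> (\<forall>x\<in>S. \<forall>\<^sub>F (x', y) in uniformity. x' = x \<longrightarrow> y \<in> S)"

instance
proof
  fix f g h :: "'a endo" and r s :: real
  show "f + g + h = f + (g + h)" "f + g = g + f" "0 + f = f" "- f + f = 0" "f - g = f + - g"
    "r *\<^sub>R (f + g) = r *\<^sub>R f + r *\<^sub>R g" "(r + s) *\<^sub>R f = r *\<^sub>R f + s *\<^sub>R f"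
    "r *\<^sub>R s *\<^sub>R f = (r * s) *\<^sub>R f" "1 *\<^sub>R f = f"
    by (transfer; simp add: algebra_simps)+
  show "norm f = 0 \<longleftrightarrow> f = 0" "norm (f + g) \<le> norm f + norm g" "norm (r *\<^sub>R f) = \<bar>r\<bar> * norm f"
    by (transfer; simp add: norm_triangle_ineq)+
qed (simp_all add: dist_endo_def sgn_endo_def uniformity_endo_def open_endo_def)

end

instantiation endo :: (real_normed_vector) real_normed_algebra
begin

lift_definition times_endo :: "'a endo \<Rightarrow> 'a endo \<Rightarrow> 'a endo" is "(o\<^sub>L)" .

instance
proof
  fix f g h :: "'a endo" and r :: real
  show "f * g * h = f * (g * h)" "(f + g) * h = f * h + g * h" "f * (g + h) = f * g + f * h"
    "r *\<^sub>R f * g = r *\<^sub>R (f * g)" "f * r *\<^sub>R g = r *\<^sub>R (f * g)"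
    by (transfer; rule blinfun_eqI; simp add: blinfun.bilinear_simps)+
  show "norm (f * g) \<le> norm f * norm g" by transfer (rule norm_blinfun_compose)
qed

end

text \<open>\<open>perfect_space\<close> rules out the zero space, where the identity has norm 0
  instead of 1.\<close>

instantiation endo :: ("{real_normed_vector, perfect_space}") real_normed_algebra_1
begin

lift_definition one_endo :: "'a endo" is id_blinfun .

instance
proof
  fix f :: "'a endo"
  show "1 * f = f" "f * 1 = f" by (transfer; rule blinfun_eqI; simp)+
  show "norm (1 :: 'a endo) = 1" by transfer simp
  then show "(0 :: 'a endo) \<noteq> 1" by (metis norm_zero zero_neq_one)
qed

end

instance endo :: (banach) banach
proof
  fix X :: "nat \<Rightarrow> 'a endo" assume X: "Cauchy X"
  have d: "dist (Rep_endo f) (Rep_endo g) = dist f g" for f g :: "'a endo"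
    unfolding dist_norm by transfer simp
  have "Cauchy (\<lambda>n. Rep_endo (X n))" using X unfolding Cauchy_def d .
  then obtain L where L: "(\<lambda>n. Rep_endo (X n)) \<longlonglongrightarrow> L" using Cauchy_convergent convergent_def by blast
  have "(\<lambda>n. dist (X n) (Abs_endo L)) \<longlonglongrightarrow> 0"
    using L unfolding tendsto_dist_iff[of _ L] d[symmetric] by (simp add: Abs_endo_inverse)
  then show "convergent X" using tendsto_dist_iff convergent_def by blast
qed

lift_definition endo_apply :: "'a::real_normed_vector endo \<Rightarrow> 'a \<Rightarrow> 'a" is blinfun_apply .

lemma bounded_bilinear_endo_apply: "bounded_bilinear endo_apply"
proof
  fix f g :: "'a endo" and x y and r :: real
  show "endo_apply (f + g) x = endo_apply f x + endo_apply g x"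
    "endo_apply f (x + y) = endo_apply f x + endo_apply f y"
    "endo_apply (r *\<^sub>R f) x = r *\<^sub>R endo_apply f x"
    "endo_apply f (r *\<^sub>R x) = r *\<^sub>R endo_apply f x"
    by (transfer; simp add: blinfun.bilinear_simps)+
  have "norm (endo_apply f x) \<le> norm f * norm x * 1" for f :: "'a endo" and x
    by transfer (simp add: norm_blinfun)
  then show "\<exists>K. \<forall>(f :: 'a endo) x. norm (endo_apply f x) \<le> norm f * norm x * K" by blast
qed

lemma norm_endo_apply: "norm (endo_apply f x) \<le> norm f * norm x"
  by transfer (rule norm_blinfun)

lemma endo_apply_times: "endo_apply (f * g) x = endo_apply f (endo_apply g x)"
  by transfer simp

lemma endo_apply_one: "endo_apply 1 x = x"
  by transfer simp

lemma endo_eqI: "(\<And>x. endo_apply f x = endo_apply g x) \<Longrightarrow> f = g"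
  by transfer (rule blinfun_eqI)

lemma bounded_linear_matrix_vector: "bounded_linear (\<lambda>x. (M :: complex^'q^'q) *v x)"
  by (intro linear_conv_bounded_linear[THEN iffD1] linearI)
     (auto simp: matrix_vector_mult_def vec_eq_iff sum.distrib algebra_simps scaleR_sum_right)

lift_definition endo_of_matrix :: "complex^'q^'q \<Rightarrow> (complex^'q) endo" is "\<lambda>M. Blinfun (\<lambda>x. M *v x)" .

lemma endo_apply_matrix [simp]: "endo_apply (endo_of_matrix M) x = M *v x"
  by transfer (simp add: bounded_linear_Blinfun_apply bounded_linear_matrix_vector)

lemma mscale_nth [simp]: "mscale c M $ i $ j = c * M $ i $ j"
  by (simp add: mscale_def)

lemma mscale_matrix_vector: "mscale c M *v x = c *s (M *v x)"
  by (simp add: vec_eq_iff matrix_vector_mult_def sum_distrib_left mult.assoc)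

lemma matrix_vector_smult: "(M :: complex^'q^'q) *v (c *s x) = c *s (M *v x)"
  by (simp add: vec_eq_iff matrix_vector_mult_def sum_distrib_left mult_ac)

lemma norm_smult: "norm (c *s x) = cmod c * norm (x :: complex^'q)"
  by (simp add: norm_vec_def norm_mult L2_set_right_distrib)

lemma endo_of_matrix_mult: "endo_of_matrix (M ** N) = endo_of_matrix M * endo_of_matrix N"
  by (rule endo_eqI) (simp add: endo_apply_times matrix_vector_mul_assoc)

lemma endo_of_matrix_one: "endo_of_matrix (mat 1) = 1"
  by (rule endo_eqI) (simp add: endo_apply_one)

lemma bounded_linear_endo_of_matrix: "bounded_linear (endo_of_matrix :: complex^'q^'q \<Rightarrow> _)"
proof (intro linear_conv_bounded_linear[THEN iffD1] linearI)
  interpret bounded_bilinear "endo_apply :: (complex^'q) endo \<Rightarrow> _" by (rule bounded_bilinear_endo_apply)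
  fix M N :: "complex^'q^'q" and r :: real
  show "endo_of_matrix (M + N) = endo_of_matrix M + endo_of_matrix N"
    by (rule endo_eqI) (simp add: add_left matrix_vector_mult_add_rdistrib)
  show "endo_of_matrix (r *\<^sub>R M) = r *\<^sub>R endo_of_matrix M"
    by (rule endo_eqI) (simp add: scaleR_left vec_eq_iff matrix_vector_mult_def scaleR_sum_right)
qed

text \<open>The operator norm for the Euclidean norm on \<open>complex^'q\<close>. In contrast to
  the norm of the matrix type it always gives the identity the value 1.\<close>

definition matrix_norm :: "complex^'q^'q \<Rightarrow> real" where
  "matrix_norm M = norm (endo_of_matrix M)"

lemma matrix_norm_nonneg [simp]: "matrix_norm M \<ge> 0"
  by (simp add: matrix_norm_def)

lemma matrix_norm_one [simp]: "matrix_norm (mat 1) = 1"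
  by (simp add: matrix_norm_def endo_of_matrix_one)

lemma matrix_norm_zero [simp]: "matrix_norm 0 = 0"
  by (simp add: matrix_norm_def linear_0[OF bounded_linear.linear[OF bounded_linear_endo_of_matrix]])

lemma matrix_norm_add: "matrix_norm (M + N) \<le> matrix_norm M + matrix_norm N"
  by (simp add: matrix_norm_def linear_add[OF bounded_linear.linear[OF bounded_linear_endo_of_matrix]] norm_triangle_ineq)

lemma matrix_norm_sum: "matrix_norm (sum f S) \<le> (\<Sum>x\<in>S. matrix_norm (f x))"
  by (simp add: matrix_norm_def linear_sum[OF bounded_linear.linear[OF bounded_linear_endo_of_matrix]] norm_sum)

lemma matrix_norm_mult: "matrix_norm (M ** N) \<le> matrix_norm M * matrix_norm N"
  by (simp add: matrix_norm_def endo_of_matrix_mult norm_mult_ineq)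

lemma norm_matrix_vector_le: "norm (M *v x) \<le> matrix_norm M * norm x"
  using norm_endo_apply[of "endo_of_matrix M" x] by (simp add: matrix_norm_def)

lemma matrix_norm_leI:
  assumes "C \<ge> 0" "\<And>x. norm (M *v x) \<le> C * norm x"
  shows "matrix_norm M \<le> C"
proof -
  have "norm (blinfun_apply (Rep_endo (endo_of_matrix M)) x) \<le> C * norm x" for x
    using assms(2)[of x] by (simp flip: endo_apply.rep_eq)
  then show ?thesis
    unfolding matrix_norm_def norm_endo.rep_eq by (rule norm_blinfun_bound[OF assms(1)])
qed

lemma matrix_norm_mscale: "matrix_norm (mscale c M) \<le> cmod c * matrix_norm M"
  using norm_matrix_vector_le[of M]
  by (intro matrix_norm_leI) (simp_all add: mscale_matrix_vector norm_smult mult.assoc mult_left_mono)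

lemma component_le_matrix_norm: "cmod (M $ i $ j) \<le> matrix_norm M"
proof -
  have "cmod (M $ i $ j) = cmod ((M *v axis j 1) $ i)"
    by (simp add: matrix_vector_mult_def axis_def if_distrib cong: if_cong)
  also have "\<dots> \<le> norm (M *v axis j 1)" by (rule Finite_Cartesian_Product.norm_nth_le)
  also have "\<dots> \<le> matrix_norm M" using norm_matrix_vector_le[of M "axis j 1"] by simp
  finally show ?thesis .
qed

lemma norm_trace_le: "cmod (trace (M :: complex^'q^'q)) \<le> real CARD('q) * matrix_norm M"
proof -
  have "cmod (trace M) \<le> (\<Sum>i\<in>UNIV. cmod (M $ i $ i))" unfolding trace_def by (rule norm_sum)
  also have "\<dots> \<le> (\<Sum>i\<in>(UNIV :: 'q set). matrix_norm M)" by (intro sum_mono component_le_matrix_norm)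
  finally show ?thesis by simp
qed

text \<open>Bounding a Euclidean norm by the sum of moduli is crude, but only summability is
  transferred through this estimate.\<close>

lemma norm_le_matrix_norm: "norm (M :: complex^'q^'q) \<le> real CARD('q) * (real CARD('q) * matrix_norm M)"
proof -
  have "norm (M $ i) \<le> (\<Sum>j\<in>(UNIV :: 'q set). matrix_norm M)" for i
    unfolding norm_vec_def[of "M $ i"]
    by (intro order_trans[OF L2_set_le_sum] sum_mono component_le_matrix_norm) auto
  then have "norm M \<le> (\<Sum>i\<in>(UNIV :: 'q set). \<Sum>j\<in>(UNIV :: 'q set). matrix_norm M)"
    unfolding norm_vec_def[of M] by (intro order_trans[OF L2_set_le_sum] sum_mono) auto
  then show ?thesis by simp
qed

text \<open>An eigenvector of M is an eigenvector of every power, and the exponential series can be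
  applied to it term by term. A bound on the norm of exp M thereby bounds the real parts of the
  eigenvalues of M.\<close>

lemma exp_matrix_eigenvector:
  fixes x :: "complex^'q"
  assumes "M *v x = c *s x"
  shows "endo_apply (exp (endo_of_matrix M)) x = exp c *s x"
proof -
  interpret bounded_bilinear "endo_apply :: (complex^'q) endo \<Rightarrow> _" by (rule bounded_bilinear_endo_apply)
  have pow: "endo_apply (endo_of_matrix M ^ m) x = c ^ m *s x" for m
    by (induction m) (simp_all add: endo_apply_one endo_apply_times matrix_vector_smult assms vector_smult_assoc mult.commute)
  have "(\<lambda>m. endo_apply (endo_of_matrix M ^ m /\<^sub>R fact m) x) sums endo_apply (exp (endo_of_matrix M)) x"
    by (rule bounded_linear.sums[OF bounded_linear_left exp_converges])
  moreover have "(\<lambda>m. (c ^ m /\<^sub>R fact m) *s x) sums (exp c *s x)"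
  proof (rule bounded_linear.sums[OF _ exp_converges])
    show "bounded_linear (\<lambda>c. c *s x)"
      by (intro linear_conv_bounded_linear[THEN iffD1] linearI) (auto simp: vec_eq_iff algebra_simps)
  qed
  moreover have "endo_apply (endo_of_matrix M ^ m /\<^sub>R fact m) x = (c ^ m /\<^sub>R fact m) *s x" for m
    by (simp add: scaleR_left pow vec_eq_iff)
  ultimately show ?thesis by (simp add: sums_iff)
qed

section \<open>Determinants and resolvents\<close>

lemma det_linear_polynomial:
  fixes M N :: "complex^'q^'q"
  obtains p where "degree p \<le> CARD('q)" "\<And>u. poly p u = det (M + mscale u N)"
proof -
  define p where "p = (\<Sum>\<pi> | \<pi> permutes (UNIV :: 'q set).
    smult (of_int (sign \<pi>)) (\<Prod>i\<in>UNIV. [:M $ i $ \<pi> i, N $ i $ \<pi> i:]))"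
  have "degree (\<Prod>i\<in>UNIV. [:M $ i $ \<pi> i, N $ i $ \<pi> i:]) \<le> CARD('q)" for \<pi> :: "'q \<Rightarrow> 'q"
  proof -
    have "degree (\<Prod>i\<in>UNIV. [:M $ i $ \<pi> i, N $ i $ \<pi> i:]) \<le> (\<Sum>i\<in>(UNIV :: 'q set). degree [:M $ i $ \<pi> i, N $ i $ \<pi> i:])"
      by (rule order_trans[OF degree_prod_sum_le]) (simp_all add: o_def)
    also have "\<dots> \<le> (\<Sum>i\<in>(UNIV :: 'q set). 1)" by (rule sum_mono) simp
    finally show ?thesis by simp
  qed
  then have "degree p \<le> CARD('q)"
    unfolding p_def by (intro degree_sum_le) (auto intro: order_trans[OF degree_smult_le] finite_permutations)
  moreover have "poly p u = det (M + mscale u N)" for u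
    by (simp add: p_def det_def poly_sum poly_prod)
  ultimately show ?thesis using that by blast
qed

text \<open>The polynomial is a product of at most n factors 1 - u / a over its roots, all with |a|
  at least r. The bound sees p only through n and r, which makes it uniform over a family of
  determinants.\<close>

lemma poly_near_one:
  fixes p :: "complex poly"
  assumes "degree p \<le> n" "poly p 0 = 1" "r > 0" "\<And>u. cmod u < r \<Longrightarrow> poly p u \<noteq> 0"
  shows "cmod (poly p u - 1) \<le> (1 + cmod u / r) ^ n - 1"
  using assms
proof (induction n arbitrary: p)
  case 0
  then obtain a where "p = [:a:]" by (auto elim: degree_eq_zeroE)
  then show ?case using 0 by simp
next
  case (Suc n)
  have ge1: "1 + cmod u / r \<ge> 1" using Suc.prems(3) by simp
  show ?case
  proof (cases "degree p = 0")
    case True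
    then obtain a where "p = [:a:]" by (auto elim: degree_eq_zeroE)
    moreover have "(1 + cmod u / r) ^ Suc n \<ge> 1" by (rule one_le_power[OF ge1])
    ultimately show ?thesis using Suc.prems by simp
  next
    case False
    then obtain a where a: "poly p a = 0"
      using Fundamental_Theorem_Algebra.fundamental_theorem_of_algebra[of p] constant_degree[of p] by auto
    then have ar: "cmod a \<ge> r" using Suc.prems(4)[of a] by (meson not_le)
    then have a0: "a \<noteq> 0" using Suc.prems(3) by auto
    obtain k where k: "p = [:-a, 1:] * k" using a by (auto simp: poly_eq_0_iff_dvd)
    define p' where "p' = smult (-a) k"
    have p: "poly p x = (1 - x / a) * poly p' x" for x
      using a0 by (simp add: k p'_def field_simps)
    have k0: "k \<noteq> 0" using k False by auto
    have "degree p = Suc (degree k)" unfolding k using k0 by (subst degree_mult_eq) auto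
    then have "degree p' \<le> n" using Suc.prems(1) by (simp add: p'_def)
    moreover have "poly p' 0 = 1" using p[of 0] Suc.prems(2) by simp
    moreover have "poly p' x \<noteq> 0" if "cmod x < r" for x using Suc.prems(4)[OF that] p[of x] by auto
    ultimately have IH: "cmod (poly p' u - 1) \<le> (1 + cmod u / r) ^ n - 1"
      using Suc.IH[of p'] Suc.prems(3) by simp
    define D where "D = (1 + cmod u / r) ^ n - 1"
    have D: "cmod (poly p' u - 1) \<le> D" "D \<ge> 0" using IH norm_ge_zero order_trans unfolding D_def by blast+
    have y: "cmod (u / a) \<le> cmod u / r"
      using ar Suc.prems(3) by (simp add: norm_divide frac_le)
    have "poly p u - 1 = (poly p' u - 1) - u / a - u / a * (poly p' u - 1)"
      by (simp add: p algebra_simps)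
    also have "cmod \<dots> \<le> cmod (poly p' u - 1) + cmod (u / a) + cmod (u / a) * cmod (poly p' u - 1)"
      using norm_triangle_ineq4[of "poly p' u - 1 - u / a" "u / a * (poly p' u - 1)"]
        norm_triangle_ineq4[of "poly p' u - 1" "u / a"] unfolding norm_mult by linarith
    also have "\<dots> \<le> D + cmod u / r + cmod u / r * D"
      using D y Suc.prems(3) by (intro add_mono mult_mono) auto
    also have "\<dots> = (1 + cmod u / r) ^ Suc n - 1" by (simp add: D_def algebra_simps)
    finally show ?thesis .
  qed
qed

lemma mat_smult_one: "mat c = mscale c (mat 1)"
  by (simp add: vec_eq_iff mat_def)

lemma mscale_mscale: "mscale c (mscale d M) = mscale (c * d) M"
  by (simp add: vec_eq_iff)

lemma det_mscale: "det (mscale c (M :: complex^'q^'q)) = c ^ CARD('q) * det M"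
  by (simp add: det_def prod.distrib sum_distrib_left mult_ac)

lemma holomorphic_on_det:
  fixes M :: "complex \<Rightarrow> complex^'q^'q"
  assumes "\<And>i j. (\<lambda>z. M z $ i $ j) holomorphic_on S"
  shows "(\<lambda>z. det (M z)) holomorphic_on S"
  unfolding det_def by (intro holomorphic_intros assms)

lemma eigenvector_exists:
  fixes M :: "complex^'q^'q"
  assumes "det (mat \<mu> - M) = 0"
  obtains x where "x \<noteq> 0" "M *v x = \<mu> *s x"
proof -
  have "\<not> (\<exists>N. N ** (mat \<mu> - M) = mat 1)"
    using assms invertible_det_nz[of "mat \<mu> - M"] invertible_left_inverse[of "mat \<mu> - M"] by blast
  then obtain x where x: "x \<noteq> 0" "(mat \<mu> - M) *v x = 0"
    unfolding matrix_left_invertible_ker by blast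
  have "mat \<mu> *v x = \<mu> *s x" by (subst mat_smult_one) (simp add: mscale_matrix_vector)
  then show ?thesis using that[OF x(1)] x(2) by (simp add: matrix_vector_mult_diff_rdistrib)
qed

text \<open>The scalar factor and the argument of B are varied independently: \<open>step1\<close>
  moves the factor from z to z + w while B stays at z. For small |z| this allows multiplying by any
  complex number of modulus at most 1, so \<open>step2\<close> can rotate a large eigenvalue onto
  the positive axis, where \<open>step1\<close> excludes it. That turns a half plane into a
  disc.\<close>

proposition char_poly_constant:
  fixes B :: "complex \<Rightarrow> complex^'q^'q"
  assumes hol: "\<And>i j. (\<lambda>z. B z $ i $ j) holomorphic_on UNIV"
    and ev: "\<And>z \<mu>. det (mat \<mu> - mscale z (B z)) = 0 \<Longrightarrow> Re \<mu> \<le> C * cmod z"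
  shows "det (mat \<zeta> - mscale z (B z)) = det (mat \<zeta> - mscale z (B 0))"
proof -
  \<comment> \<open>The maximum with 1 makes the bound positive, so that the point
    \<open>2 * c * R\<close> used below lies strictly to the right of all eigenvalues belonging to
    |z| at most R.\<close>
  define c where "c = max C 1"
  have c: "c > 0" "C \<le> c" by (auto simp: c_def)
  let ?q = "CARD('q)"
  have ev': "Re \<mu> \<le> c * cmod z" if "det (mat \<mu> - mscale z (B z)) = 0" for \<mu> z
    by (rule order_trans[OF ev[OF that]]) (simp add: c mult_right_mono)
  have holdet: "(\<lambda>z. det (mat a - mscale (f z) (B z))) holomorphic_on S"
    if "f holomorphic_on S" for a f S
    using that holomorphic_on_subset[OF hol] by (intro holomorphic_on_det) (auto intro!: holomorphic_intros)
  \<comment> \<open>\<open>\<epsilon>\<close> depends on the size q alone. It makes the bound of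
    \<open>poly_near_one\<close> smaller than 1, and a number at distance less than 1 from 1 is not
    0.\<close>
  obtain \<epsilon> :: real where \<epsilon>: "0 < \<epsilon>" "\<epsilon> < 1" "(1 + \<epsilon>) ^ ?q < 2"
  proof -
    have "((\<lambda>e::real. (1 + e) ^ ?q) \<longlongrightarrow> (1 + 0) ^ ?q) (at_right 0)"
      by (intro tendsto_intros)
    then have "\<forall>\<^sub>F e in at_right 0. (1 + e :: real) ^ ?q < 2"
      by (rule order_tendstoD) simp
    moreover have "\<forall>\<^sub>F e :: real in at_right 0. 0 < e \<and> e < 1"
      by (rule eventually_conj[OF eventually_at_right_less eventually_at_rightI[of 0 1]]) auto
    ultimately have "\<forall>\<^sub>F e in at_right 0. 0 < e \<and> e < 1 \<and> (1 + e :: real) ^ ?q < 2"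
      by eventually_elim auto
    then show ?thesis using that eventually_happens[of _ "at_right (0::real)"] by force
  qed
  define b where "b = (1 + \<epsilon>) ^ ?q - 1"
  have b: "b < 1" using \<epsilon>(3) by (simp add: b_def)

  \<comment> \<open>For \<open>\<bar>z\<bar> = R\<close> the eigenvalues of \<open>z B(z)\<close> have real part at most \<open>c R\<close>, so the quotient
    \<open>?N z / ?D z\<close> is a polynomial in \<open>w / z\<close> without zeros in the unit disc.  It is thus close to 1
    on the circle, and by the maximum principle also inside, where \<open>w / z\<close> may be large.\<close>
  have step1: "det (mat (2 * c * R) - mscale (z + w) (B z)) \<noteq> 0"
    if R: "R > 0" and z: "cmod z \<le> R" and w: "cmod w \<le> \<epsilon> * R" for R z w
  proof -
    define a where "a = complex_of_real (2 * c * R)"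
    let ?N = "\<lambda>z. det (mat a - mscale (z + w) (B z))" and ?D = "\<lambda>z. det (mat a - mscale z (B z))"
    have D0: "?D z \<noteq> 0" if "cmod z \<le> R" for z
    proof
      assume "?D z = 0"
      from ev'[OF this] have "2 * c * R \<le> c * cmod z" by (simp add: a_def)
      also have "\<dots> \<le> c * R" using that c by simp
      finally show False using c R by simp
    qed
    have "cmod (?N z / ?D z - 1) \<le> b"
    proof (rule maximum_modulus_frontier[where S = "cball 0 R" and f = "\<lambda>z. ?N z / ?D z - 1"])
      show "(\<lambda>z. ?N z / ?D z - 1) holomorphic_on interior (cball 0 R)"
        using D0 by (intro holomorphic_intros holdet) auto
      show "continuous_on (closure (cball 0 R)) (\<lambda>z. ?N z / ?D z - 1)"
        using D0 by (intro holomorphic_on_imp_continuous_on holomorphic_intros holdet) auto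
      show "z \<in> cball 0 R" using z by simp
      fix z :: complex assume "z \<in> frontier (cball 0 R)"
      then have zR: "cmod z = R" using R by (simp add: frontier_cball)
      then have z0: "z \<noteq> 0" using R by auto
      have Dz: "?D z \<noteq> 0" using D0 zR by simp
      obtain p where p: "degree p \<le> ?q" "\<And>u. poly p u = det (mat a - mscale z (B z) + mscale u (- mscale z (B z)))"
        by (rule det_linear_polynomial[of "mat a - mscale z (B z)" "- mscale z (B z)"]) (rule that)
      have p': "poly p u = det (mat a - mscale ((1 + u) * z) (B z))" for u
        unfolding p(2) by (rule arg_cong[where f = det]) (simp add: vec_eq_iff algebra_simps)
      define P where "P = smult (inverse (?D z)) p"
      have "cmod (poly P (w / z) - 1) \<le> (1 + cmod (w / z) / 1) ^ ?q - 1"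
      proof (rule poly_near_one)
        show "degree P \<le> ?q" using p(1) by (simp add: P_def)
        show "poly P 0 = 1" using Dz by (simp add: P_def p')
        fix u :: complex assume u: "cmod u < 1"
        have n: "1 + Re u > 0" using u abs_Re_le_cmod[of u] by linarith
        then have u1: "1 + u \<noteq> 0" by (auto simp: complex_eq_iff)
        show "poly P u \<noteq> 0"
        proof
          assume "poly P u = 0"
          then have "det (mat a - mscale ((1 + u) * z) (B z)) = 0" using Dz by (simp add: P_def p')
          moreover have "mat a - mscale ((1 + u) * z) (B z) = mscale (1 + u) (mat (a / (1 + u)) - mscale z (B z))"
            using u1 by (simp add: vec_eq_iff mat_def right_diff_distrib)
          ultimately have "det (mat (a / (1 + u)) - mscale z (B z)) = 0" using u1 by (simp add: det_mscale)
          from ev'[OF this] have 1: "Re (a / (1 + u)) \<le> c * R" by (simp add: zR)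
          \<comment> \<open>A zero of P at u would make a / (1 + u) an eigenvalue. Inversion maps
            the disc of radius 1 about 1 onto the half plane Re > 1/2, and the factor 2 in
            \<open>a\<close> is chosen to match: the real part then exceeds c R.\<close>
          have "Re (a / (1 + u)) = 2 * c * R * ((1 + Re u) / (cmod (1 + u))\<^sup>2)"
            by (simp add: a_def Re_divide cmod_power2)
          moreover have "(1 + Re u) / (cmod (1 + u))\<^sup>2 > 1 / 2"
          proof -
            have "(cmod (1 + u))\<^sup>2 = 1 + 2 * Re u + (cmod u)\<^sup>2"
              unfolding cmod_power2 by (simp add: power2_eq_square algebra_simps)
            moreover have "(cmod u)\<^sup>2 < 1" using u by (simp add: abs_square_less_1)
            moreover have "(cmod (1 + u))\<^sup>2 > 0" using u1 by simp
            ultimately show ?thesis by (simp add: field_simps)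
          qed
          then have "2 * c * R * (1 / 2) < 2 * c * R * ((1 + Re u) / (cmod (1 + u))\<^sup>2)"
            by (rule mult_strict_left_mono) (use c R in simp)
          ultimately show False using 1 by simp
        qed
      qed simp
      also have "poly P (w / z) = ?N z / ?D z"
      proof -
        have "(1 + w / z) * z = z + w" using z0 by (simp add: field_simps)
        then show ?thesis by (simp add: P_def p' divide_inverse mult.commute)
      qed
      also have "(1 + cmod (w / z) / 1) ^ ?q - 1 \<le> b"
      proof -
        have "cmod (w / z) \<le> \<epsilon>" using w zR R by (simp add: norm_divide divide_le_eq)
        then show ?thesis by (simp add: b_def power_mono)
      qed
      finally show "cmod (?N z / ?D z - 1) \<le> b" .
    qed simp
    then have "cmod (?N z / ?D z - 1) < 1" using b by simp
    then show ?thesis unfolding a_def by auto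
  qed

  define K where "K = 4 * c / \<epsilon>"
  have K: "K > 0" using c \<epsilon> by (simp add: K_def)
  \<comment> \<open>K is chosen so that \<open>2 * c * R = K * cmod z\<close> for the radius R
    below. The multiplier \<open>s\<close> sends \<open>\<mu>\<close> to this point and has modulus
    at most 1, so s z differs from z by at most 2 |z|, which is \<open>\<epsilon> * R\<close>; thus
    \<open>step1\<close> applies.\<close>
  have step2: "det (mat \<mu> - mscale z (B z)) \<noteq> 0" if z: "z \<noteq> 0" and \<mu>: "cmod \<mu> \<ge> K * cmod z" for z \<mu>
  proof -
    define R where "R = 2 * cmod z / \<epsilon>"
    have R: "R > 0" using z \<epsilon> by (simp add: R_def)
    have \<mu>0: "\<mu> \<noteq> 0" using \<mu> mult_pos_pos[OF K, of "cmod z"] z by auto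
    define s where "s = complex_of_real (2 * c * R) / \<mu>"
    have KR: "2 * c * R = K * cmod z" by (simp add: R_def K_def)
    have s0: "s \<noteq> 0" using c R \<mu>0 by (simp add: s_def)
    have "cmod s = 2 * c * R / cmod \<mu>" using c R by (simp add: s_def norm_divide norm_mult)
    also have "\<dots> \<le> 1" using \<mu> \<mu>0 unfolding KR by (simp add: divide_le_eq)
    finally have s: "cmod s \<le> 1" .
    have "cmod ((s - 1) * z) \<le> 2 * cmod z"
      unfolding norm_mult using norm_triangle_ineq4[of s 1] s by (intro mult_right_mono) auto
    also have "\<dots> = \<epsilon> * R" using \<epsilon> by (simp add: R_def)
    finally have "det (mat (2 * c * R) - mscale (z + (s - 1) * z) (B z)) \<noteq> 0"
      using \<epsilon> z by (intro step1[OF R]) (simp_all add: R_def field_simps)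
    moreover have "mat (2 * c * R) - mscale (z + (s - 1) * z) (B z) = mscale s (mat \<mu> - mscale z (B z))"
      using \<mu>0 by (simp add: vec_eq_iff mat_def s_def field_simps)
    ultimately show ?thesis by (auto simp: det_mscale)
  qed

  \<comment> \<open>The zeros in u are the reciprocals of the nonzero eigenvalues of B(z), so
    \<open>step2\<close> keeps them outside the disc of radius 1 / K for every z other than 0. Since
    this radius does not depend on z, neither does the bound from
    \<open>poly_near_one\<close>.\<close>
  have step3: "det (mat 1 - mscale u (B z)) = det (mat 1 - mscale u (B 0))" for u z
  proof -
    let ?h = "\<lambda>z. det (mat 1 - mscale u (B z))"
    have "cmod (?h z - 1) \<le> (1 + cmod u / (1 / K)) ^ ?q - 1" if z: "z \<noteq> 0" for z
    proof -
      obtain p where p: "degree p \<le> ?q" "\<And>u. poly p u = det (mat 1 + mscale u (- B z))"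
        by (rule det_linear_polynomial[of "mat 1" "- B z"]) (rule that)
      have p': "poly p u = det (mat 1 - mscale u (B z))" for u
        unfolding p(2) by (rule arg_cong[where f = det]) (simp add: vec_eq_iff)
      have "cmod (poly p u - 1) \<le> (1 + cmod u / (1 / K)) ^ ?q - 1"
      proof (rule poly_near_one[OF p(1)])
        show "poly p 0 = 1" by (simp add: p' mscale_simps)
        show "1 / K > 0" using K by simp
        fix u assume u: "cmod u < 1 / K"
        show "poly p u \<noteq> 0"
        proof (cases "u = 0")
          case False
          have "mat (z / u) - mscale z (B z) = mscale (z / u) (mat 1 - mscale u (B z))"
            using False by (simp add: vec_eq_iff mat_def right_diff_distrib)
          moreover have "det (mat (z / u) - mscale z (B z)) \<noteq> 0"
            using u False z K by (intro step2) (auto simp: norm_divide field_simps)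
          ultimately show ?thesis by (auto simp: p' det_mscale)
        qed (simp add: p' mscale_simps)
      qed
      then show ?thesis by (simp add: p')
    qed
    then have "?h ` (- {0}) \<subseteq> cball 1 ((1 + cmod u / (1 / K)) ^ ?q - 1)"
      by (intro image_subsetI) (simp add: dist_norm norm_minus_commute)
    then have "bounded (?h ` (- {0}))" using bounded_subset bounded_cball by blast
    \<comment> \<open>The point z = 0, where \<open>step2\<close> says nothing, adds a single value
      to the range.\<close>
    then have "bounded (insert (?h 0) (?h ` (- {0})))" by simp
    moreover have "insert (?h 0) (?h ` (- {0})) = range ?h" by auto
    ultimately have "bounded (range ?h)" by simp
    moreover have "?h holomorphic_on UNIV" by (intro holdet holomorphic_intros)
    ultimately have "?h constant_on UNIV" by (intro Liouville_theorem)
    then show ?thesis unfolding constant_on_def by (metis UNIV_I)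
  qed

  have ne: "det (mat \<zeta> - mscale z (B z)) = det (mat \<zeta> - mscale z (B 0))" if "\<zeta> \<noteq> 0" for \<zeta>
  proof -
    have "mat \<zeta> - mscale z M = mscale \<zeta> (mat 1 - mscale (z / \<zeta>) M)" for M :: "complex^'q^'q"
      using that by (simp add: vec_eq_iff mat_def right_diff_distrib)
    then show ?thesis using step3[of "z / \<zeta>" z] by (simp add: det_mscale)
  qed
  \<comment> \<open>Rescaling by \<open>\<zeta>\<close> fails at 0; there the claim follows because
    both sides are polynomials in \<open>\<zeta>\<close> that agree elsewhere.\<close>
  obtain p1 where p1: "\<And>u. poly p1 u = det (- mscale z (B z) + mscale u (mat 1))"
    by (rule det_linear_polynomial) (rule that)
  obtain p2 where p2: "\<And>u. poly p2 u = det (- mscale z (B 0) + mscale u (mat 1))"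
    by (rule det_linear_polynomial) (rule that)
  have eq: "poly p1 u = det (mat u - mscale z (B z))" "poly p2 u = det (mat u - mscale z (B 0))" for u
    by (simp_all add: p1 p2 mat_smult_one[symmetric])
  have "poly (p1 - p2) u = 0" if "u \<noteq> 0" for u using ne[OF that] eq by simp
  then have "- {0} \<subseteq> {u. poly (p1 - p2) u = 0}" by auto
  moreover have "infinite (- {0 :: complex})"
    using infinite_UNIV_char_0[where 'a = complex] by (simp add: Compl_eq_Diff_UNIV)
  ultimately have "p1 - p2 = 0" using poly_roots_finite finite_subset by blast
  then show ?thesis using eq[of \<zeta>] by simp
qed

section \<open>Traces of powers from the characteristic polynomial\<close>

lemma has_derivative_det_at_one:
  fixes M :: "complex^'q^'q"
  shows "((\<lambda>h. det (mat 1 + mscale h M)) has_field_derivative trace M) (at 0)"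
proof -
  let ?e = "\<lambda>\<pi> i h. (mat 1 + mscale h M) $ i $ (\<pi> i)"
  have "((\<lambda>h. \<Prod>i\<in>UNIV. ?e \<pi> i h) has_field_derivative
      (\<Sum>j\<in>UNIV. M $ j $ \<pi> j * (\<Prod>i\<in>UNIV - {j}. ?e \<pi> i 0))) (at 0)" for \<pi> :: "'q \<Rightarrow> 'q"
    by (rule has_field_derivative_prod) (auto intro!: derivative_eq_intros)
  then have "((\<lambda>h. det (mat 1 + mscale h M)) has_field_derivative
     (\<Sum>\<pi> | \<pi> permutes (UNIV :: 'q set). of_int (sign \<pi>) * (\<Sum>j\<in>UNIV. M $ j $ \<pi> j * (\<Prod>i\<in>UNIV - {j}. ?e \<pi> i 0)))) (at 0)"
    unfolding det_def by (intro DERIV_sum DERIV_cmult)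
  also have "(\<Sum>\<pi> | \<pi> permutes (UNIV :: 'q set). of_int (sign \<pi>) * (\<Sum>j\<in>UNIV. M $ j $ \<pi> j * (\<Prod>i\<in>UNIV - {j}. ?e \<pi> i 0)))
     = (\<Sum>\<pi>\<in>{id}. of_int (sign \<pi>) * (\<Sum>j\<in>UNIV. M $ j $ \<pi> j * (\<Prod>i\<in>UNIV - {j}. ?e \<pi> i 0)))"
  proof (rule sum.mono_neutral_right)
    show "{id} \<subseteq> {\<pi>. \<pi> permutes (UNIV :: 'q set)}" by (simp add: permutes_id)
    show "\<forall>\<pi>\<in>{\<pi>. \<pi> permutes (UNIV :: 'q set)} - {id}.
        of_int (sign \<pi>) * (\<Sum>j\<in>UNIV. M $ j $ \<pi> j * (\<Prod>i\<in>UNIV - {j}. ?e \<pi> i 0)) = 0"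
    proof
      fix \<pi> assume \<pi>: "\<pi> \<in> {\<pi>. \<pi> permutes (UNIV :: 'q set)} - {id}"
      then obtain k where k: "\<pi> k \<noteq> k" by (auto simp: fun_eq_iff)
      have "inj \<pi>" using \<pi> permutes_inj by blast
      then have k': "\<pi> (\<pi> k) \<noteq> \<pi> k" using k by (auto dest: injD)
      \<comment> \<open>The permutation moves both k and \<open>\<pi> k\<close>, so at least one
        moved index remains after j is deleted; its factor is an off-diagonal entry of the
        identity.\<close>
      have "(\<Prod>i\<in>UNIV - {j}. ?e \<pi> i 0) = 0" for j
        using k k' by (intro prod_zero bexI[of _ "if j = k then \<pi> k else k"]) (auto simp: mat_def)
      then show "of_int (sign \<pi>) * (\<Sum>j\<in>UNIV. M $ j $ \<pi> j * (\<Prod>i\<in>UNIV - {j}. ?e \<pi> i 0)) = 0"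
        by (simp only: mult_zero_right sum.neutral_const)
    qed
  qed simp
  also have "\<dots> = trace M" by (simp add: trace_def mat_def)
  finally show ?thesis .
qed

text \<open>Factoring 1 - (w + h) A as (1 - w A) (1 - h R A) reduces the logarithmic derivative at w
  to the derivative of the determinant at the identity. Both traces are thus determined by the same
  function of u.\<close>

lemma trace_resolvent_eq:
  fixes A A' :: "complex^'q^'q"
  assumes eq: "\<And>u. det (mat 1 - mscale u A) = det (mat 1 - mscale u A')"
    and R: "R ** (mat 1 - mscale w A) = mat 1" and R': "R' ** (mat 1 - mscale w A') = mat 1"
  shows "trace (R ** A) = trace (R' ** A')"
proof -
  have d: "((\<lambda>h. det (mat 1 - mscale (w + h) A)) has_field_derivative - (det (mat 1 - mscale w A) * trace (R ** A))) (at 0)"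
    if R: "R ** (mat 1 - mscale w A) = mat 1" for R A :: "complex^'q^'q"
  proof -
    have inv: "(mat 1 - mscale w A) ** R = mat 1" using R by (simp add: matrix_left_right_inverse)
    have e: "det (mat 1 - mscale (w + h) A) = det (mat 1 - mscale w A) * det (mat 1 + mscale h (- (R ** A)))" for h
    proof -
      have "(mat 1 - mscale w A) ** (mat 1 + mscale h (- (R ** A))) =
          (mat 1 - mscale w A) - mscale h (((mat 1 - mscale w A) ** R) ** A)"
        by (simp add: matrix_add_ldistrib matrix_mul_assoc[symmetric])
           (simp add: vec_eq_iff matrix_matrix_mult_def sum_distrib_left sum_negf mult_ac)
      also have "\<dots> = mat 1 - mscale (w + h) A" by (simp add: inv vec_eq_iff algebra_simps)
      finally show ?thesis by (metis det_mul)
    qed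
    have "trace (- (R ** A)) = - trace (R ** A)" by (simp add: trace_def sum_negf)
    then show ?thesis unfolding e
      using DERIV_cmult[OF has_derivative_det_at_one[of "- (R ** A)"], of "det (mat 1 - mscale w A)"] by simp
  qed
  have "det (mat 1 - mscale w A) * trace (R ** A) = det (mat 1 - mscale w A') * trace (R' ** A')"
    using d[OF R] d[OF R'] DERIV_unique unfolding eq by force
  moreover have "det (mat 1 - mscale w A) \<noteq> 0"
    using R invertible_det_nz invertible_left_inverse by blast
  ultimately show ?thesis using eq by simp
qed

lemma matrix_mult_add_rdistrib: "(M + N) ** P = M ** P + N ** (P :: complex^'q^'q)"
  by (simp add: vec_eq_iff matrix_matrix_mult_def sum.distrib algebra_simps)

lemma mscale_matrix_mult: "mscale c M ** N = mscale c (M ** N)"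
  by (simp add: vec_eq_iff matrix_matrix_mult_def sum_distrib_left mult_ac)

lemma matrix_mult_mscale: "M ** mscale c N = mscale c (M ** N)"
  by (simp add: vec_eq_iff matrix_matrix_mult_def sum_distrib_left mult_ac)

lemma resolvent_identity:
  fixes A R :: "complex^'q^'q"
  assumes "R ** (mat 1 - mscale w A) = mat 1"
  shows "R = mat 1 + mscale w (R ** A)"
proof -
  have "mat 1 - mscale w A = mat 1 + mscale (- w) A" by (simp add: vec_eq_iff)
  then have "R ** (mat 1 - mscale w A) = R + mscale (- w) (R ** A)"
    by (simp only: matrix_add_ldistrib matrix_mul_rid matrix_mult_mscale)
  then have "R + mscale (- w) (R ** A) = mat 1" using assms by simp
  then show ?thesis by (simp add: vec_eq_iff algebra_simps)
qed

text \<open>This is the geometric series stopped after n terms with its exact remainder, so that no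
  infinite series of matrices has to be handled.\<close>

lemma resolvent_expansion:
  fixes A R :: "complex^'q^'q"
  assumes R: "R ** (mat 1 - mscale w A) = mat 1"
  shows "trace (R ** A) = (\<Sum>k<n. w ^ k * trace (mpower A (Suc k))) + w ^ n * trace (R ** mpower A (Suc n))"
proof (induction n)
  case (Suc n)
  have "R = mat 1 + mscale w (R ** A)" by (rule resolvent_identity[OF R])
  then have "R ** mpower A (Suc n) = (mat 1 + mscale w (R ** A)) ** mpower A (Suc n)" by simp
  also have "\<dots> = mpower A (Suc n) + mscale w (R ** mpower A (Suc (Suc n)))"
    by (simp add: matrix_mult_add_rdistrib mscale_matrix_mult matrix_mul_assoc)
  finally have "trace (R ** mpower A (Suc n)) = trace (mpower A (Suc n)) + w * trace (R ** mpower A (Suc (Suc n)))"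
    by (simp add: trace_def sum.distrib sum_distrib_left)
  with Suc show ?case by (simp add: algebra_simps)
qed simp

text \<open>Below the threshold 1/2 the matrix w A cannot have eigenvalue 1, and in R = 1 + w R A
  half of the norm of R can be absorbed on the left. The bound 2 is uniform in w, which allows w to
  tend to 0.\<close>

lemma resolvent_exists:
  fixes A :: "complex^'q^'q"
  assumes w: "cmod w * matrix_norm A \<le> 1 / 2"
  obtains R where "R ** (mat 1 - mscale w A) = mat 1" "matrix_norm R \<le> 2"
proof -
  have "det (mat 1 - mscale w A) \<noteq> 0"
  proof
    assume "det (mat 1 - mscale w A) = 0"
    then obtain x where x: "x \<noteq> 0" "mscale w A *v x = 1 *s x" by (rule eigenvector_exists)
    then have "norm x \<le> matrix_norm (mscale w A) * norm x" using norm_matrix_vector_le[of "mscale w A" x] by simp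
    also have "\<dots> \<le> 1 / 2 * norm x"
      by (intro mult_right_mono order_trans[OF matrix_norm_mscale w]) simp
    finally show False using x by simp
  qed
  then obtain R where R: "R ** (mat 1 - mscale w A) = mat 1"
    using invertible_det_nz invertible_left_inverse by blast
  have "R = mat 1 + mscale w (R ** A)" by (rule resolvent_identity[OF R])
  then have "matrix_norm R \<le> 1 + matrix_norm (mscale w (R ** A))" by (metis matrix_norm_add matrix_norm_one)
  also have "\<dots> \<le> 1 + cmod w * (matrix_norm R * matrix_norm A)"
    by (intro add_left_mono order_trans[OF matrix_norm_mscale] mult_left_mono matrix_norm_mult) simp
  also have "\<dots> \<le> 1 + 1 / 2 * matrix_norm R" using mult_right_mono[OF w matrix_norm_nonneg[of R]] by (simp add: mult_ac)
  finally show ?thesis using that[OF R] by simp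
qed

text \<open>
  The logarithmic derivative of \<open>det (1 - w A)\<close> is \<open>- trace ((1 - w A)\<^sup>-\<^sup>1 A)\<close>, whose Taylor
  coefficients at \<open>w = 0\<close> are the traces of the powers of \<open>A\<close>.
\<close>

proposition trace_mpower_eq:
  fixes A A' :: "complex^'q^'q"
  assumes eq: "\<And>u. det (mat 1 - mscale u A) = det (mat 1 - mscale u A')"
  shows "trace (mpower A (Suc k)) = trace (mpower A' (Suc k))"
proof (induction k rule: less_induct)
  case (less k)
  define m where "m = max (matrix_norm A) (matrix_norm A')"
  define c where "c = 2 * real CARD('q) * m ^ Suc (Suc k)"
  have pow: "matrix_norm (mpower X n) \<le> m ^ n" if "matrix_norm X \<le> m" for X :: "complex^'q^'q" and n
  proof (induction n)
    case (Suc n)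
    have "matrix_norm (mpower X (Suc n)) \<le> matrix_norm X * matrix_norm (mpower X n)" by (simp add: matrix_norm_mult)
    also have "\<dots> \<le> m * m ^ n" using that Suc order_trans[OF matrix_norm_nonneg that] by (intro mult_mono) auto
    finally show ?case by simp
  qed simp
  \<comment> \<open>The traces of lower powers cancel by the induction hypothesis and
    \<open>w ^ k\<close> is divided out. What remains is w times a difference of two remainders,
    each at most c: a factor 2 from the resolvent, q from the trace and a power of m. Small w then
    forces equality.\<close>
  have bnd: "cmod (trace (mpower A (Suc k)) - trace (mpower A' (Suc k))) \<le> cmod w * (2 * c)"
    if w: "w \<noteq> 0" "cmod w * m \<le> 1 / 2" for w
  proof -
    have "cmod w * matrix_norm A \<le> 1 / 2" "cmod w * matrix_norm A' \<le> 1 / 2"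
      using w(2) mult_left_mono[of "matrix_norm A" m "cmod w"] mult_left_mono[of "matrix_norm A'" m "cmod w"]
      by (auto simp: m_def)
    then obtain R R' where R: "R ** (mat 1 - mscale w A) = mat 1" "matrix_norm R \<le> 2"
      and R': "R' ** (mat 1 - mscale w A') = mat 1" "matrix_norm R' \<le> 2"
      using resolvent_exists by metis
    have rem: "cmod (trace (S ** mpower X (Suc (Suc k)))) \<le> c"
      if "matrix_norm S \<le> 2" "matrix_norm X \<le> m" for S X :: "complex^'q^'q"
    proof -
      have "matrix_norm (S ** mpower X (Suc (Suc k))) \<le> matrix_norm S * matrix_norm (mpower X (Suc (Suc k)))"
        by (rule matrix_norm_mult)
      also have "\<dots> \<le> 2 * m ^ Suc (Suc k)" by (intro mult_mono that pow) auto
      finally have "real CARD('q) * matrix_norm (S ** mpower X (Suc (Suc k))) \<le> real CARD('q) * (2 * m ^ Suc (Suc k))"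
        by (rule mult_left_mono) simp
      also have "\<dots> = c" by (simp add: c_def)
      finally show ?thesis by (rule order_trans[OF norm_trace_le])
    qed
    have sub_eq: "x - x' = u - t" if "x + t = x' + u" for x x' t u :: complex
      using that by (simp add: algebra_simps)
    have "w ^ k * (trace (mpower A (Suc k)) + w * trace (R ** mpower A (Suc (Suc k)))) =
        w ^ k * (trace (mpower A' (Suc k)) + w * trace (R' ** mpower A' (Suc (Suc k))))"
      using resolvent_expansion[OF R(1), of "Suc k"] resolvent_expansion[OF R'(1), of "Suc k"]
        trace_resolvent_eq[OF eq R(1) R'(1)] less
      by (simp add: algebra_simps)
    then have "trace (mpower A (Suc k)) + w * trace (R ** mpower A (Suc (Suc k))) =
        trace (mpower A' (Suc k)) + w * trace (R' ** mpower A' (Suc (Suc k)))"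
      by (rule mult_left_cancel[THEN iffD1, rotated]) (use w(1) in simp)
    then have "trace (mpower A (Suc k)) - trace (mpower A' (Suc k)) =
        w * (trace (R' ** mpower A' (Suc (Suc k))) - trace (R ** mpower A (Suc (Suc k))))"
      unfolding right_diff_distrib by (rule sub_eq)
    moreover have "cmod (trace (R' ** mpower A' (Suc (Suc k))) - trace (R ** mpower A (Suc (Suc k)))) \<le> c + c"
      using rem[OF R(2)] rem[OF R'(2)] by (intro order_trans[OF norm_triangle_ineq4] add_mono) (auto simp: m_def)
    ultimately show ?thesis by (simp add: norm_mult mult_left_mono)
  qed
  show ?case
  proof (rule ccontr)
    assume "\<not> ?case"
    then have t: "cmod (trace (mpower A (Suc k)) - trace (mpower A' (Suc k))) > 0" (is "?t > 0") by simp
    have small: "\<forall>\<^sub>F r::real in at_right 0. r * d < s" if "s > 0" for d s :: real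
    proof -
      have "((\<lambda>r. r * d) \<longlongrightarrow> 0 * d) (at_right 0)" by (intro tendsto_intros)
      then show ?thesis by (rule order_tendstoD(2)) (use that in simp)
    qed
    have "\<forall>\<^sub>F r::real in at_right 0. r * m < 1 / 2" "\<forall>\<^sub>F r::real in at_right 0. r * (2 * c) < ?t"
      by (rule small, simp) (rule small[OF t])
    moreover have "\<forall>\<^sub>F r::real in at_right 0. 0 < r" by (rule eventually_at_right_less)
    ultimately have "\<forall>\<^sub>F r::real in at_right 0. 0 < r \<and> r * m < 1 / 2 \<and> r * (2 * c) < ?t"
      by eventually_elim auto
    then obtain r :: real where r: "0 < r" "r * m < 1 / 2" "r * (2 * c) < ?t"
      using eventually_happens[of _ "at_right (0::real)"] by force
    with bnd[of "complex_of_real r"] show False by simp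
  qed
qed

lemma det_mat_one_minus_mscale:
  fixes A A' :: "complex^'q^'q"
  assumes "\<And>\<zeta>. det (mat \<zeta> - A) = det (mat \<zeta> - A')"
  shows "det (mat 1 - mscale u A) = det (mat 1 - mscale u A')"
proof (cases "u = 0")
  case False
  then have "mat 1 - mscale u X = mscale u (mat (1 / u) - X)" for X :: "complex^'q^'q"
    by (simp add: vec_eq_iff mat_def right_diff_distrib)
  then show ?thesis using assms[of "1 / u"] by (simp add: det_mscale)
qed (simp add: mscale_simps)

lemma poly_char_poly: "poly (char_poly M) \<zeta> = det (mat \<zeta> - M)"
  unfolding char_poly_def det_def
  by (simp add: poly_sum poly_prod mat_def if_distrib[of "\<lambda>p. poly p _"] cong: if_cong)

section \<open>Multiplicative extensions and eigenvalue bounds\<close>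

definition word_matrix :: "('v::real_normed_vector \<times> 'v \<Rightarrow> complex^'q^'q) \<Rightarrow> ('v \<times> 'v) list \<Rightarrow> complex^'q^'q" where
  "word_matrix \<Phi> ws = foldr (**) (map \<Phi> ws) (mat 1)"

lemma word_matrix_simps [simp]:
  "word_matrix \<Phi> [] = mat 1" "word_matrix \<Phi> (w # ws) = \<Phi> w ** word_matrix \<Phi> ws"
  by (simp_all add: word_matrix_def)

lemma cext_le_cnorm: "cmod (cext \<xi> w) \<le> norm \<xi> * cnorm w"
proof (cases "\<xi> = 0")
  case True
  then show ?thesis by (simp add: cext_def complex_eq_iff flip: zero_complex.code)
next
  case False
  have bound: "cmod (cext \<eta> w) \<le> norm (fst w) + norm (snd w)" if "norm \<eta> \<le> 1" for \<eta>
  proof -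
    have "cmod (cext \<eta> w) \<le> \<bar>blinfun_apply \<eta> (fst w)\<bar> + \<bar>blinfun_apply \<eta> (snd w)\<bar>"
      using cmod_le[of "cext \<eta> w"] by (simp add: cext_def)
    also have "\<dots> \<le> norm (fst w) + norm (snd w)"
      using norm_blinfun[of \<eta> "fst w"] norm_blinfun[of \<eta> "snd w"]
        mult_right_mono[OF that norm_ge_zero[of "fst w"]] mult_right_mono[OF that norm_ge_zero[of "snd w"]]
      by (intro add_mono) auto
    finally show ?thesis .
  qed
  have scale: "cext (r *\<^sub>R \<xi>) w = of_real r * cext \<xi> w" for r
    by (simp add: cext_def blinfun.scaleR_left complex_eq_iff)
  have "cmod (cext (inverse (norm \<xi>) *\<^sub>R \<xi>) w) \<le> cnorm w"
    unfolding cnorm_def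
    by (rule cSUP_upper) (use False bound in \<open>auto intro!: bdd_aboveI2[where M = "norm (fst w) + norm (snd w)"]\<close>)
  then show ?thesis using False by (simp add: scale norm_mult norm_divide field_simps)
qed

lemma cnorm_nonneg: "cnorm w \<ge> 0" for w :: "'v::real_normed_vector \<times> 'v"
proof (cases "\<exists>\<xi> :: 'v \<Rightarrow>\<^sub>L real. \<xi> \<noteq> 0")
  case True
  then obtain \<xi> :: "'v \<Rightarrow>\<^sub>L real" where "norm \<xi> > 0" by auto
  moreover have "0 \<le> norm \<xi> * cnorm w" using cext_le_cnorm[of \<xi> w] norm_ge_zero order_trans by blast
  ultimately show ?thesis by (simp add: zero_le_mult_iff)
next
  case False
  then have "{\<xi> :: 'v \<Rightarrow>\<^sub>L real. norm \<xi> \<le> 1} = {0}" by auto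
  then show ?thesis by (simp add: cnorm_def)
qed

locale matrix_representation =
  fixes B :: "'v::real_normed_vector set" and e :: "'v \<Rightarrow> 'v \<Rightarrow>\<^sub>L real"
    and \<Phi> :: "'v \<times> 'v \<Rightarrow> complex^'q^'q"
  assumes finite_B: "finite B" and coordinates: "\<And>x. x = (\<Sum>b\<in>B. blinfun_apply (e b) x *\<^sub>R b)"
    and linear_\<Phi>: "complex_linear \<Phi>"
begin

lemma finite_spanning: "\<exists>B::'v set. finite B \<and> span B = UNIV"
proof (intro exI conjI)
  show "span B = UNIV"
  proof (intro UNIV_eq_I[symmetric])
    fix x
    have "(\<Sum>b\<in>B. blinfun_apply (e b) x *\<^sub>R b) \<in> span B" by (intro span_sum span_scale span_base)
    then show "x \<in> span B" by (subst coordinates)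
  qed
qed (rule finite_B)

lemma \<Phi>_coordinates: "\<Phi> w = (\<Sum>b\<in>B. mscale (cext (e b) w) (\<Phi> (b, 0)))"
proof -
  interpret Vector_Spaces.linear cscale mscale \<Phi> by (rule linear_\<Phi>)
  have "(\<Sum>b\<in>B. cscale (cext (e b) w) (b, 0)) = (\<Sum>b\<in>B. e b (fst w) *\<^sub>R b, \<Sum>b\<in>B. e b (snd w) *\<^sub>R b)"
    by (simp add: cscale_def cext_def prod_eq_iff fst_sum snd_sum)
  also have "\<dots> = w" using coordinates[of "fst w"] coordinates[of "snd w"] by simp
  finally have "\<Phi> w = \<Phi> (\<Sum>b\<in>B. cscale (cext (e b) w) (b, 0))" by simp
  then show ?thesis by (simp only: sum scale)
qed

text \<open>The projective norm is an infimum over arbitrary decompositions into pure tensors, so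
  the extension must be evaluated on each of them and not just on basis words.\<close>

lemma mult_extension_pure_sum:
  assumes "\<forall>(c, ws)\<in>set xs. length ws = n"
  shows "mult_extension \<Phi> n (\<lambda>\<xi>s. \<Sum>(c, ws)\<leftarrow>xs. c * pure_tensor ws \<xi>s) =
    (\<Sum>(c, ws)\<leftarrow>xs. mscale c (word_matrix \<Phi> ws))"
proof -
  let ?F = "mult_extension \<Phi> n"
  have F: "is_mult_extension \<Phi> n ?F"
    unfolding mult_extension_def by (rule theI'[OF mult_extension_ex1[OF finite_spanning linear_\<Phi>]])
  have lin: "?F (\<lambda>\<xi>s. c * s \<xi>s + d * t \<xi>s) = mscale c (?F s) + mscale d (?F t)"
    if "s \<in> tensor_power n" "t \<in> tensor_power n" for c d s t
    using F that by (simp add: is_mult_extension_def)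
  have zero: "(\<lambda>_. 0) \<in> tensor_power n" by (auto simp: tensor_power_def linear_iff)
  from assms have "(\<lambda>\<xi>s. \<Sum>(c, ws)\<leftarrow>xs. c * pure_tensor ws \<xi>s) \<in> tensor_power n \<and>
      ?F (\<lambda>\<xi>s. \<Sum>(c, ws)\<leftarrow>xs. c * pure_tensor ws \<xi>s) = (\<Sum>(c, ws)\<leftarrow>xs. mscale c (word_matrix \<Phi> ws))"
  proof (induction xs)
    case Nil
    show ?case using zero lin[OF zero zero, of 0 0] by (simp add: mscale_simps)
  next
    case (Cons x xs)
    obtain c ws where x: "x = (c, ws)" by force
    let ?t = "\<lambda>\<xi>s. \<Sum>(c, ws)\<leftarrow>xs. c * pure_tensor ws \<xi>s"
    have ws: "length ws = n" and IH: "?t \<in> tensor_power n" "?F ?t = (\<Sum>(c, ws)\<leftarrow>xs. mscale c (word_matrix \<Phi> ws))"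
      using Cons x by auto
    have "?F (pure_tensor ws) = word_matrix \<Phi> ws"
      using F ws by (simp add: is_mult_extension_def word_matrix_def)
    then show ?case
      using tensor_lincomb[OF pure_tensor_in[OF ws] IH(1), of c 1] lin[OF pure_tensor_in[OF ws] IH(1), of c 1] IH(2)
      by (simp add: x mscale_simps)
  qed
  then show ?thesis by blast
qed

text \<open>Expanding along basis words shows that the set behind the projective norm is nonempty
  and gives an explicit formula for an extension defined by \<open>THE\<close>.\<close>

lemma pure_expansion:
  assumes "t \<in> tensor_power n"
  obtains xs where "\<forall>(c, ws)\<in>set xs. length ws = n" "t = (\<lambda>\<xi>s. \<Sum>(c, ws)\<leftarrow>xs. c * pure_tensor ws \<xi>s)"
    "mult_extension \<Phi> n t = (\<Sum>bs\<in>words_over B n. mscale (t (map e bs)) (word_matrix \<Phi> (map (\<lambda>b. (b, 0)) bs)))"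
proof -
  obtain ys where ys: "set ys = words_over B n" "distinct ys"
    using finite_distinct_list[OF finite_words[OF finite_B]] by blast
  define xs where "xs = map (\<lambda>bs. (t (map e bs), map (\<lambda>b. (b, 0::'v)) bs)) ys"
  have len: "\<forall>(c, ws)\<in>set xs. length ws = n" using ys by (auto simp: xs_def words_over_def)
  have "t \<xi>s = (\<Sum>(c, ws)\<leftarrow>xs. c * pure_tensor ws \<xi>s)" for \<xi>s
    unfolding tensor_expand[OF finite_B coordinates assms, of \<xi>s] xs_def
    by (simp add: ys(1)[symmetric] sum_list_distinct_conv_sum_set[OF ys(2)] o_def)
  then have t: "t = (\<lambda>\<xi>s. \<Sum>(c, ws)\<leftarrow>xs. c * pure_tensor ws \<xi>s)" by blast
  have "mult_extension \<Phi> n t = (\<Sum>(c, ws)\<leftarrow>xs. mscale c (word_matrix \<Phi> ws))"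
    by (subst t) (rule mult_extension_pure_sum[OF len])
  also have "\<dots> = (\<Sum>bs\<in>words_over B n. mscale (t (map e bs)) (word_matrix \<Phi> (map (\<lambda>b. (b, 0)) bs)))"
    by (simp add: xs_def ys(1)[symmetric] sum_list_distinct_conv_sum_set[OF ys(2)] o_def)
  finally show ?thesis by (rule that[OF len t])
qed

text \<open>The same sum serves twice: it bounds \<open>\<Phi>\<close> against \<open>cnorm\<close>,
  and it is the total weight of the letters when the signature is evaluated, hence a factor in the
  eigenvalue bound.\<close>

definition \<Phi>_bound :: real where
  "\<Phi>_bound = (\<Sum>b\<in>B. norm (e b) * matrix_norm (\<Phi> (b, 0)))"

lemma \<Phi>_bound_nonneg: "\<Phi>_bound \<ge> 0"
  unfolding \<Phi>_bound_def by (intro sum_nonneg mult_nonneg_nonneg) auto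

lemma matrix_norm_\<Phi>: "matrix_norm (\<Phi> w) \<le> \<Phi>_bound * cnorm w"
proof -
  have "matrix_norm (\<Phi> w) \<le> (\<Sum>b\<in>B. matrix_norm (mscale (cext (e b) w) (\<Phi> (b, 0))))"
    by (subst \<Phi>_coordinates) (rule matrix_norm_sum)
  also have "\<dots> \<le> (\<Sum>b\<in>B. norm (e b) * cnorm w * matrix_norm (\<Phi> (b, 0)))"
    by (intro sum_mono order_trans[OF matrix_norm_mscale] mult_right_mono cext_le_cnorm) simp
  also have "\<dots> = \<Phi>_bound * cnorm w" by (simp add: \<Phi>_bound_def sum_distrib_left mult_ac)
  finally show ?thesis .
qed

text \<open>The added 1 keeps the base positive, so that its powers can be divided out in
  \<open>matrix_norm_mult_extension\<close>.\<close>

lemma matrix_norm_word_matrix: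
  "matrix_norm (word_matrix \<Phi> ws) \<le> (\<Phi>_bound + 1) ^ length ws * prod_list (map cnorm ws)"
proof (induction ws)
  case (Cons w ws)
  have "matrix_norm (\<Phi> w) \<le> (\<Phi>_bound + 1) * cnorm w"
    using matrix_norm_\<Phi>[of w] cnorm_nonneg[of w] by (simp add: distrib_right)
  then have "matrix_norm (\<Phi> w) * matrix_norm (word_matrix \<Phi> ws) \<le>
      (\<Phi>_bound + 1) * cnorm w * ((\<Phi>_bound + 1) ^ length ws * prod_list (map cnorm ws))"
    using Cons \<Phi>_bound_nonneg cnorm_nonneg[of w] by (intro mult_mono) auto
  then show ?case using matrix_norm_mult[of "\<Phi> w" "word_matrix \<Phi> ws"] by (simp add: mult_ac)
qed simp

text \<open>Every decomposition of t gives the estimate with its own cost; the infimum of the costs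
  is the projective norm.\<close>

lemma matrix_norm_mult_extension:
  assumes "t \<in> tensor_power n"
  shows "matrix_norm (mult_extension \<Phi> n t) \<le> (\<Phi>_bound + 1) ^ n * projective_norm n t"
proof -
  have pos: "(\<Phi>_bound + 1) ^ n > 0" using \<Phi>_bound_nonneg by simp
  have "matrix_norm (mult_extension \<Phi> n t) / (\<Phi>_bound + 1) ^ n \<le> projective_norm n t"
    unfolding projective_norm_def
  proof (rule cInf_greatest)
    show "{\<Sum>(c, ws)\<leftarrow>xs. cmod c * prod_list (map cnorm ws) |xs. (\<forall>(c, ws)\<in>set xs. length ws = n) \<and>
        t = (\<lambda>\<xi>s. \<Sum>(c, ws)\<leftarrow>xs. c * pure_tensor ws \<xi>s)} \<noteq> {}"
      by (rule pure_expansion[OF assms]) blast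
    fix x assume "x \<in> {\<Sum>(c, ws)\<leftarrow>xs. cmod c * prod_list (map cnorm ws) |xs. (\<forall>(c, ws)\<in>set xs. length ws = n) \<and>
        t = (\<lambda>\<xi>s. \<Sum>(c, ws)\<leftarrow>xs. c * pure_tensor ws \<xi>s)}"
    then obtain xs where xs: "\<forall>(c, ws)\<in>set xs. length ws = n" "t = (\<lambda>\<xi>s. \<Sum>(c, ws)\<leftarrow>xs. c * pure_tensor ws \<xi>s)"
      and x: "x = (\<Sum>(c, ws)\<leftarrow>xs. cmod c * prod_list (map cnorm ws))" by blast
    have "matrix_norm (\<Sum>(c, ws)\<leftarrow>xs. mscale c (word_matrix \<Phi> ws)) \<le>
        (\<Phi>_bound + 1) ^ n * (\<Sum>(c, ws)\<leftarrow>xs. cmod c * prod_list (map cnorm ws))"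
      using xs(1)
    proof (induction xs)
      case (Cons x xs)
      obtain c ws where x: "x = (c, ws)" by force
      have "matrix_norm (mscale c (word_matrix \<Phi> ws)) \<le> cmod c * ((\<Phi>_bound + 1) ^ n * prod_list (map cnorm ws))"
        using matrix_norm_word_matrix[of ws] Cons.prems
        by (intro order_trans[OF matrix_norm_mscale] mult_left_mono) (auto simp: x)
      then show ?case
        using Cons by (simp add: x distrib_left mult_ac) (intro order_trans[OF matrix_norm_add] add_mono; simp)
    qed simp
    also have "(\<Sum>(c, ws)\<leftarrow>xs. mscale c (word_matrix \<Phi> ws)) = mult_extension \<Phi> n t"
      by (subst xs(2)) (rule mult_extension_pure_sum[OF xs(1), symmetric])
    finally show "matrix_norm (mult_extension \<Phi> n t) / (\<Phi>_bound + 1) ^ n \<le> x"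
      using pos by (simp add: x field_simps)
  qed
  then show ?thesis using pos by (simp add: field_simps)
qed

text \<open>Infinite radius means that the roots of the projective norms eventually fall below any
  positive number. Choosing that number \<open>\<epsilon>\<close> with
  \<open>K * \<epsilon> \<le> 1 / 2\<close> leaves a geometric majorant.\<close>

lemma summable_mult_extension:
  assumes "radius l = \<infinity>" "multilinear l" "r \<ge> 0"
  shows "summable (\<lambda>n. r ^ n * matrix_norm (mult_extension \<Phi> n (component n l)))"
proof -
  define K where "K = r * (\<Phi>_bound + 1)"
  have K: "K \<ge> 0" using assms(3) \<Phi>_bound_nonneg by (simp add: K_def)
  define \<epsilon> where "\<epsilon> = 1 / (2 * (K + 1))"
  have \<epsilon>: "\<epsilon> > 0" "K * \<epsilon> \<le> 1 / 2" using K by (auto simp: \<epsilon>_def field_simps)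
  let ?p = "\<lambda>n. projective_norm n (component n l)"
  have "limsup (\<lambda>n. ereal (root n (?p n))) = 0"
    using assms(1) unfolding radius_def by (cases "limsup (\<lambda>n. ereal (root n (?p n)))") (auto split: if_splits)
  then have "limsup (\<lambda>n. ereal (root n (?p n))) < ereal \<epsilon>" using \<epsilon> by simp
  then have "\<forall>\<^sub>F n in sequentially. ereal (root n (?p n)) < ereal \<epsilon>" by (rule Limsup_lessD)
  moreover have "\<forall>\<^sub>F n :: nat in sequentially. n > 0" by (rule eventually_gt_at_top)
  ultimately have "\<forall>\<^sub>F n in sequentially.
      norm (r ^ n * matrix_norm (mult_extension \<Phi> n (component n l))) \<le> (1 / 2) ^ n"
  proof eventually_elim
    case (elim n)
    \<comment> \<open>n > 0 allows the root to be undone by the n-th power; if the infimum is not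
      positive the bound is immediate.\<close>
    have p: "?p n \<le> \<epsilon> ^ n"
    proof (cases "?p n \<le> 0")
      case False
      then have "?p n = root n (?p n) ^ n" using elim by simp
      also have "\<dots> \<le> \<epsilon> ^ n" using elim False by (intro power_mono) auto
      finally show ?thesis .
    qed (use \<epsilon> zero_le_power[of \<epsilon> n] in linarith)
    have "r ^ n * matrix_norm (mult_extension \<Phi> n (component n l)) \<le> r ^ n * ((\<Phi>_bound + 1) ^ n * \<epsilon> ^ n)"
      using matrix_norm_mult_extension[OF component_in_tensor_power[OF assms(2)], of n] p assms(3) \<Phi>_bound_nonneg
      by (intro mult_left_mono order_trans[OF _ mult_left_mono[OF p]]) auto
    also have "\<dots> = (K * \<epsilon>) ^ n" by (simp add: K_def power_mult_distrib)
    also have "\<dots> \<le> (1 / 2) ^ n" using \<epsilon> K by (intro power_mono) auto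
    finally show ?case using assms(3) by simp
  qed
  moreover have "summable (\<lambda>n. (1 / 2 :: real) ^ n)" by (rule summable_geometric) simp
  ultimately show ?thesis by (rule summable_comparison_test_ev)
qed

text \<open>The n scaled letters of a word produce \<open>z ^ n\<close>. This moves the series for A
  into the algebra where the exponential is available.\<close>

lemma word_eval_mult_extension:
  assumes "multilinear t"
  shows "fps_nth (word_eval B e (\<lambda>b. endo_of_matrix (mscale z (\<Phi> (b, 0)))) t) n =
    endo_of_matrix (mscale (z ^ n) (mult_extension \<Phi> n (component n t)))"
proof -
  interpret endo: bounded_linear "endo_of_matrix :: complex^'q^'q \<Rightarrow> _" by (rule bounded_linear_endo_of_matrix)
  have word: "prod_list (map (\<lambda>b. endo_of_matrix (mscale z (\<Phi> (b, 0)))) bs) =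
      endo_of_matrix (mscale (z ^ length bs) (word_matrix \<Phi> (map (\<lambda>b. (b, 0)) bs)))" for bs
    by (induction bs) (simp_all add: endo_of_matrix_one endo_of_matrix_mult[symmetric] mscale_mult mscale_simps)
  have scaleR: "r *\<^sub>R endo_of_matrix M = endo_of_matrix (mscale (of_real r) M)" for r and M :: "complex^'q^'q"
  proof -
    have "mscale (of_real r) M = r *\<^sub>R M" by (simp add: vec_eq_iff scaleR_conv_of_real[where 'a = complex])
    then show ?thesis by (simp add: endo.scaleR)
  qed
  have "mult_extension \<Phi> n (component n t) =
      (\<Sum>bs\<in>words_over B n. mscale (component n t (map e bs)) (word_matrix \<Phi> (map (\<lambda>b. (b, 0)) bs)))"
    by (rule pure_expansion[OF component_in_tensor_power[OF assms]])
  then have "endo_of_matrix (mscale (z ^ n) (mult_extension \<Phi> n (component n t))) =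
      (\<Sum>bs\<in>words_over B n. endo_of_matrix (mscale (z ^ n)
        (mscale (component n t (map e bs)) (word_matrix \<Phi> (map (\<lambda>b. (b, 0)) bs)))))"
    by (simp add: mscale_sum endo.sum)
  also have "\<dots> = fps_nth (word_eval B e (\<lambda>b. endo_of_matrix (mscale z (\<Phi> (b, 0)))) t) n"
    unfolding word_eval_def fps_nth_Abs_fps
    by (rule sum.cong) (auto simp: word scaleR words_over_def component_def mscale_mscale mult.commute)
  finally show ?thesis by simp
qed

lemma sum_words_prod_list: "(\<Sum>bs\<in>words_over B n. prod_list (map f bs)) = (\<Sum>b\<in>B. f b :: real) ^ n"
  by (induction n) (simp_all add: words_0 sum_words_Suc[OF finite_B] sum_distrib_left[symmetric] sum_distrib_right)

text \<open>Summing products of letter weights over all words of length n gives the n-th power of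
  the total weight. The number of words thus costs only a geometric factor, and the terms become
  those of an exponential series.\<close>

lemma norm_word_eval_le:
  fixes a :: "'v \<Rightarrow> 'b::real_normed_algebra_1"
  assumes "\<And>\<xi>s. \<bar>g \<xi>s\<bar> \<le> prod_list (map norm \<xi>s) * (c ^ length \<xi>s / fact (length \<xi>s))" "c \<ge> 0"
  shows "norm (fps_nth (word_eval B e a g) n) \<le> (c * (\<Sum>b\<in>B. norm (e b) * norm (a b))) ^ n / fact n"
proof -
  have prod: "norm (prod_list (map a bs)) \<le> prod_list (map (\<lambda>b. norm (a b)) bs)" for bs
    by (induction bs) (auto intro!: order_trans[OF norm_mult_ineq] mult_left_mono)
  have "norm (fps_nth (word_eval B e a g) n) \<le>
      (\<Sum>bs\<in>words_over B n. c ^ n / fact n * prod_list (map (\<lambda>b. norm (e b) * norm (a b)) bs))"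
    unfolding word_eval_def fps_nth_Abs_fps
  proof (intro order_trans[OF norm_sum] sum_mono)
    fix bs assume "bs \<in> words_over B n"
    then have len: "length bs = n" by (simp add: words_over_def)
    have g: "\<bar>g (map e bs)\<bar> \<le> prod_list (map (\<lambda>b. norm (e b)) bs) * (c ^ n / fact n)"
      using assms(1)[of "map e bs"] by (simp add: len o_def)
    have "norm (g (map e bs) *\<^sub>R prod_list (map a bs)) \<le>
        (prod_list (map (\<lambda>b. norm (e b)) bs) * (c ^ n / fact n)) * prod_list (map (\<lambda>b. norm (a b)) bs)"
      unfolding norm_scaleR using g prod order_trans[OF abs_ge_zero g] by (rule mult_mono) simp
    also have "\<dots> = c ^ n / fact n * (prod_list (map (\<lambda>b. norm (e b)) bs) * prod_list (map (\<lambda>b. norm (a b)) bs))"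
      by simp
    also have "prod_list (map (\<lambda>b. norm (e b)) bs) * prod_list (map (\<lambda>b. norm (a b)) bs) =
        prod_list (map (\<lambda>b. norm (e b) * norm (a b)) bs)"
      by (induction bs) (simp_all add: mult_ac)
    finally show "norm (g (map e bs) *\<^sub>R prod_list (map a bs)) \<le>
        c ^ n / fact n * prod_list (map (\<lambda>b. norm (e b) * norm (a b)) bs)" .
  qed
  also have "\<dots> = (c * (\<Sum>b\<in>B. norm (e b) * norm (a b))) ^ n / fact n"
    unfolding sum_distrib_left[symmetric] sum_words_prod_list by (simp add: power_mult_distrib)
  finally show ?thesis .
qed

lemma summable_mscale_mult_extension:
  assumes "radius l = \<infinity>" "multilinear l"
  shows "summable (\<lambda>n. mscale (z ^ n) (mult_extension \<Phi> n (component n l)))"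
proof (rule summable_norm_cancel, rule summable_comparison_test')
  let ?q = "real CARD('q)"
  show "summable (\<lambda>n. ?q * (?q * (cmod z ^ n * matrix_norm (mult_extension \<Phi> n (component n l)))))"
    by (intro summable_mult summable_mult_extension assms norm_ge_zero)
  show "norm (norm (mscale (z ^ n) (mult_extension \<Phi> n (component n l)))) \<le>
      ?q * (?q * (cmod z ^ n * matrix_norm (mult_extension \<Phi> n (component n l))))" for n
    using matrix_norm_mscale[of "z ^ n" "mult_extension \<Phi> n (component n l)"]
    by (simp add: norm_power) (intro order_trans[OF norm_le_matrix_norm] mult_left_mono; simp)
qed

lemma eigenvalue_bound:
  assumes g: "multilinear g" "g [] = 1" "\<And>\<xi>s. \<bar>g \<xi>s\<bar> \<le> prod_list (map norm \<xi>s) * (c ^ length \<xi>s / fact (length \<xi>s))"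
    and c: "c \<ge> 0" and rad: "radius (tseries_log g) = \<infinity>"
    and ev: "det (mat \<mu> - (\<Sum>n. mscale (z ^ Suc n) (mult_extension \<Phi> (Suc n) (component (Suc n) (tseries_log g))))) = 0"
  shows "Re \<mu> \<le> c * \<Phi>_bound * cmod z"
proof -
  let ?l = "tseries_log g" and ?\<alpha> = "\<lambda>b. endo_of_matrix (mscale z (\<Phi> (b, 0)))"
  define M where "M = (\<Sum>n. mscale (z ^ Suc n) (mult_extension \<Phi> (Suc n) (component (Suc n) ?l)))"
  have l: "multilinear ?l" by (rule multilinear_tseries_log[OF g(1)])
  note endo = word_eval_mult_extension[OF l, of z]
  have sm: "summable (\<lambda>n. norm (fps_nth (word_eval B e ?\<alpha> ?l) n))"
  proof (rule summable_comparison_test')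
    show "summable (\<lambda>n. cmod z ^ n * matrix_norm (mult_extension \<Phi> n (component n ?l)))"
      by (rule summable_mult_extension[OF rad l norm_ge_zero])
    show "norm (norm (fps_nth (word_eval B e ?\<alpha> ?l) n)) \<le> cmod z ^ n * matrix_norm (mult_extension \<Phi> n (component n ?l))" for n
      unfolding endo using matrix_norm_mscale[of "z ^ n" "mult_extension \<Phi> n (component n ?l)"]
      by (simp add: matrix_norm_def norm_power)
  qed
  \<comment> \<open>The logarithm has no term of degree 0, so the sum over all degrees is the one
    from degree 1 on that defines M.\<close>
  have "fps_nth (word_eval B e ?\<alpha> ?l) 0 = 0" by (simp add: word_eval_def words_0 tseries_log_def)
  then have "(\<Sum>n. fps_nth (word_eval B e ?\<alpha> ?l) n) = (\<Sum>n. fps_nth (word_eval B e ?\<alpha> ?l) (Suc n))"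
    using suminf_split_head[OF summable_norm_cancel[OF sm]] by simp
  also have "\<dots> = endo_of_matrix M"
    unfolding endo M_def
    by (rule bounded_linear.suminf[OF bounded_linear_endo_of_matrix, symmetric])
       (subst summable_Suc_iff, rule summable_mscale_mult_extension[OF rad l])
  finally have sums: "fps_nth (word_eval B e ?\<alpha> g) sums exp (endo_of_matrix M)"
    using exp_word_eval_log[OF finite_B g(2) sm] by simp
  \<comment> \<open>Each letter carries one factor z, so X grows at most linearly in |z|.\<close>
  define X where "X = c * (\<Sum>b\<in>B. norm (e b) * norm (?\<alpha> b))"
  have X: "X \<le> c * \<Phi>_bound * cmod z"
  proof -
    have "(\<Sum>b\<in>B. norm (e b) * norm (?\<alpha> b)) \<le> (\<Sum>b\<in>B. norm (e b) * (cmod z * matrix_norm (\<Phi> (b, 0))))"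
      by (intro sum_mono mult_left_mono) (simp_all add: matrix_norm_mscale flip: matrix_norm_def)
    also have "\<dots> = \<Phi>_bound * cmod z" by (simp add: \<Phi>_bound_def sum_distrib_left mult_ac)
    finally show ?thesis unfolding X_def using c by (simp add: mult.assoc mult_left_mono)
  qed
  have le: "norm (fps_nth (word_eval B e ?\<alpha> g) n) \<le> X ^ n /\<^sub>R fact n" for n
    using norm_word_eval_le[OF g(3) c, of ?\<alpha> n] by (simp add: X_def divide_inverse mult.commute)
  have Xs: "(\<lambda>n. X ^ n /\<^sub>R fact n) sums exp X" by (rule exp_converges)
  have "norm (exp (endo_of_matrix M)) = norm (\<Sum>n. fps_nth (word_eval B e ?\<alpha> g) n)"
    using sums by (simp add: sums_iff)
  also have "\<dots> \<le> exp X"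
    using norm_suminf_le[OF le sums_summable[OF Xs]] Xs by (simp add: sums_iff)
  finally have norm_exp: "norm (exp (endo_of_matrix M)) \<le> exp X" .
  obtain x where x: "x \<noteq> 0" "M *v x = \<mu> *s x"
    using eigenvector_exists[of \<mu> M] ev unfolding M_def by blast
  have "exp (Re \<mu>) * norm x = norm (endo_apply (exp (endo_of_matrix M)) x)"
    by (simp add: exp_matrix_eigenvector[OF x(2)] norm_smult)
  also have "\<dots> \<le> exp X * norm x"
    using norm_exp by (intro order_trans[OF norm_endo_apply] mult_right_mono) auto
  finally have "Re \<mu> \<le> X" using x(1) by simp
  then show ?thesis using X by simp
qed

end

theorem corollary3p5:
  fixes \<gamma> :: "real \<Rightarrow> 'v::real_normed_vector"
    and T :: real
    and l :: "('v, real) tseries"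
    and v :: 'v
    and \<Phi> :: "'v \<times> 'v \<Rightarrow> complex^'q^'q"
    and A :: "complex \<Rightarrow> complex^'q^'q"
  assumes "\<exists>B::'v set. finite B \<and> span B = UNIV"
    and "0 \<le> T"
    and "continuous_on {0..T} \<gamma>"
    and "\<gamma> has_bounded_variation_on {0..T}"
    and "l = tseries_log (signature \<gamma> T)"
    and "v = vector_of l"
    and "radius l = \<infinity>"
    and "complex_linear \<Phi>"
    and "\<And>z. A z = (\<Sum>n. mscale (z ^ Suc n) (mult_extension \<Phi> (Suc n) (component (Suc n) l)))"
  shows "(\<forall>z \<zeta>. det (mat \<zeta> - A z) = det (mat \<zeta> - mscale z (\<Phi> (v, 0)))) \<and>
    (\<forall>z. eigenvalue_mset (A z) = eigenvalue_mset (mscale z (\<Phi> (v, 0)))) \<and>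
    (\<forall>z. \<forall>p\<ge>1. trace (mpower (A z) p) = z ^ p * trace (mpower (\<Phi> (v, 0)) p))"
proof -
  obtain B0 :: "'v set" where "finite B0" "span B0 = UNIV" using assms(1) by blast
  then obtain B and e :: "'v \<Rightarrow> 'v \<Rightarrow>\<^sub>L real" where B: "finite B" "\<And>x. x = (\<Sum>b\<in>B. blinfun_apply (e b) x *\<^sub>R b)"
    using coordinates_exist by metis
  interpret matrix_representation B e \<Phi> by (rule matrix_representation.intro) (fact B assms(8))+
  obtain \<omega> where \<omega>: "\<omega> 0 = 0" "\<And>s t. 0 \<le> s \<Longrightarrow> s \<le> t \<Longrightarrow> t \<le> T \<Longrightarrow> norm (\<gamma> t - \<gamma> s) \<le> \<omega> t - \<omega> s"
    using bounded_variation_dominated[OF assms(4)] by blast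
  interpret bv_path \<gamma> T \<omega> by unfold_locales (use assms \<omega> in auto)
  have l: "multilinear l" unfolding assms(5) by (rule multilinear_tseries_log[OF multilinear_signature])
  define a where "a n = mult_extension \<Phi> n (component n l)" for n
  \<comment> \<open>\<open>M z\<close> is A(z) / z, extended to z = 0 by lowering the exponents by
    one.\<close>
  define M where "M z = (\<Sum>n. mscale (z ^ n) (a (Suc n)))" for z
  \<comment> \<open>Summability comes from the series of A(z) after division by z; at z = 0 only the
    term with n = 0 survives.\<close>
  have sm: "summable (\<lambda>n. mscale (z ^ n) (a (Suc n)))" for z
  proof (cases "z = 0")
    case False
    have "summable (\<lambda>n. mscale (z ^ Suc n) (a (Suc n)))"
      unfolding a_def by (subst summable_Suc_iff) (rule summable_mscale_mult_extension[OF assms(7) l])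
    moreover have "bounded_linear (mscale (inverse z) :: complex^'q^'q \<Rightarrow> _)"
      by (intro linear_conv_bounded_linear[THEN iffD1] linearI) (auto simp: vec_eq_iff algebra_simps)
    ultimately have "summable (\<lambda>n. mscale (inverse z) (mscale (z ^ Suc n) (a (Suc n))))"
      by (rule bounded_linear.summable[rotated])
    then show ?thesis using False by (simp add: mscale_mscale mult.assoc[symmetric])
  next
    case True
    have "mscale (z ^ n) (a (Suc n)) = 0" if "n \<notin> {0}" for n using that True by (simp add: mscale_simps power_0_left)
    then show ?thesis by (intro summable_finite[of "{0}"]) auto
  qed
  have entry: "(\<lambda>n. a (Suc n) $ i $ j * z ^ n) sums (M z $ i $ j)" for z i j
  proof -
    have "bounded_linear (\<lambda>X :: complex^'q^'q. X $ i $ j)"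
      by (rule bounded_linear_compose[OF bounded_linear_vec_nth bounded_linear_vec_nth])
    from bounded_linear.sums[OF this summable_sums[OF sm]] show ?thesis by (simp add: M_def mult.commute)
  qed
  have A: "A z = mscale z (M z)" for z
  proof -
    have "bounded_linear (mscale z :: complex^'q^'q \<Rightarrow> _)"
      by (intro linear_conv_bounded_linear[THEN iffD1] linearI) (auto simp: vec_eq_iff algebra_simps)
    from bounded_linear.suminf[OF this sm[of z]] show ?thesis by (simp add: assms(9) M_def a_def mscale_mscale)
  qed
  have hol: "(\<lambda>z. M z $ i $ j) holomorphic_on UNIV" for i j
  proof -
    \<comment> \<open>The power series converges everywhere; the radius |w| + 1 merely puts w inside
      the disc.\<close>
    have "(\<lambda>z. M z $ i $ j) holomorphic_on ball 0 (cmod w + 1)" for w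
      by (rule power_series_holomorphic[where a = "\<lambda>n. a (Suc n) $ i $ j"]) (use entry in simp)
    then have "(\<lambda>z. M z $ i $ j) field_differentiable at w" for w
      using holomorphic_on_imp_differentiable_at[of _ "ball 0 (cmod w + 1)" w] by simp
    then show ?thesis by (auto simp: holomorphic_on_def intro: field_differentiable_at_within)
  qed
  \<comment> \<open>The constant term is the extension in degree 1 at the first component of l,
    which is the image of v.\<close>
  have M0: "M 0 = \<Phi> (v, 0)"
  proof -
    have "linear (\<lambda>\<xi>. l [\<xi>])" using l[unfolded multilinear_def, rule_format, of "[]" "[]"] by simp
    from vector_of_ex1[OF assms(1) this] have lv: "l [\<xi>] = blinfun_apply \<xi> v" for \<xi>
      unfolding assms(6) vector_of_def by (rule theI'[THEN spec])
    have "mult_extension \<Phi> 1 (component 1 l) =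
        (\<Sum>bs\<in>words_over B 1. mscale (component 1 l (map e bs)) (word_matrix \<Phi> (map (\<lambda>b. (b, 0)) bs)))"
      by (rule pure_expansion[OF component_in_tensor_power[OF l]])
    also have "\<dots> = (\<Sum>b\<in>B. mscale (l [e b]) (\<Phi> (b, 0)))"
      by (simp add: sum_words_Suc[OF B(1)] words_0 component_def)
    also have "\<dots> = \<Phi> (v, 0)"
      unfolding \<Phi>_coordinates[of "(v, 0)"] by (simp add: lv cext_def complex_of_real_def)
    finally have a1: "a (Suc 0) = \<Phi> (v, 0)" by (simp add: a_def)
    have "M 0 $ i $ j = a (Suc 0) $ i $ j" for i j using entry[where z = 0] by simp
    then show ?thesis by (simp add: a1 vec_eq_iff)
  qed
  have ev: "Re \<mu> \<le> \<omega> T * \<Phi>_bound * cmod z" if "det (mat \<mu> - mscale z (M z)) = 0" for z \<mu>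
  proof (rule eigenvalue_bound[OF multilinear_signature _ signature_bound \<omega>_nonneg[OF T order_refl]])
    show "signature \<gamma> T [] = 1" by (simp add: signature_def)
    show "radius (tseries_log (signature \<gamma> T)) = \<infinity>" using assms(5,7) by simp
    show "det (mat \<mu> - (\<Sum>n. mscale (z ^ Suc n) (mult_extension \<Phi> (Suc n) (component (Suc n) (tseries_log (signature \<gamma> T)))))) = 0"
      using that by (simp add: A[symmetric] assms(9) flip: assms(5))
  qed
  have det: "det (mat \<zeta> - A z) = det (mat \<zeta> - mscale z (\<Phi> (v, 0)))" for z \<zeta>
    using char_poly_constant[OF hol ev, of \<zeta> z] by (simp add: A M0)
  have "char_poly (A z) = char_poly (mscale z (\<Phi> (v, 0)))" for z
    by (rule poly_eq_poly_eq_iff[THEN iffD1]) (simp add: fun_eq_iff poly_char_poly det)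
  moreover have "trace (mpower (A z) p) = z ^ p * trace (mpower (\<Phi> (v, 0)) p)" if "p \<ge> 1" for z p
  proof -
    have "det (mat 1 - mscale u (A z)) = det (mat 1 - mscale u (mscale z (\<Phi> (v, 0))))" for u
      using det_mat_one_minus_mscale[OF det[of _ z]] .
    \<comment> \<open>\<open>trace_mpower_eq\<close> speaks of exponents \<open>Suc k\<close>, hence
      the shift by one.\<close>
    from trace_mpower_eq[OF this, of "p - 1"]
    have "trace (mpower (A z) p) = trace (mpower (mscale z (\<Phi> (v, 0))) p)" using that by simp
    also have "mpower (mscale z (\<Phi> (v, 0))) p = mscale (z ^ p) (mpower (\<Phi> (v, 0)) p)"
      by (induction p) (simp_all add: mscale_mult mscale_simps)
    finally show ?thesis by (simp add: trace_def sum_distrib_left)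
  qed
  ultimately show ?thesis using det by (simp add: eigenvalue_mset_def)
qed

end
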